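(* Let $1<p<\infty$. Let $\Omega\subset\mathbb R^n$ ($n\ge2$) be a bounded Hölder-$\alpha$ domain for some $0<\alpha\le1$, let $d(x)$ denote the distance from $x\in\Omega$ to $\partial\Omega$, and let $s\in(0,1)$, $\tau\in(0,1)$ and $\beta\in\mathbb R$ with $\beta p>-\alpha$. Then there is a constant $C$ such that $$\inf_{c\in\mathbb R}\|u-c\|_{L^p(\Omega,d^{\beta p})}\le C\left(\int_\Omega\int_{\Omega\cap B(x,\tau d(x))}\frac{|u(y)-u(x)|^p}{|y-x|^{n+sp}}\,\delta(x,y)^{(s+\beta+\alpha-1)p}\,dy\,dx\right)^{\frac1p}$$ for every $u\in L^p(\Omega,d^{\beta p})$ for which the right-hand side is finite, where $\delta(x,y)=\min\{d(x),d(y)\}$.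
   Context: Bounded Hölder-$\alpha$ domain: a bounded domain $\Omega\subset\mathbb R^n$ whose boundary is locally the graph of a function $\varphi$ with $|\varphi(x')-\varphi(y')|\le K_\varphi|x'-y'|^\alpha$; that is, near each boundary point, in suitable rigidly moved coordinates $(x',x_n)\in\mathbb R^{n-1}\times\mathbb R$ and within an open box around the point, $\Omega$ coincides with $\{x_n<\varphi(x')\}$ for such a $\varphi$. For a weight $\eta$ (measurable, positive a.e.), $\|f\|_{L^p(\Omega,\eta)}=\left(\int_\Omega|f|^p\eta\right)^{1/p}$. $B(x,r)$ is the open ball with center $x$ and radius $r$. *)

theory Defs
  imports "HOL-Analysis.Analysis"
begin

definition rigid_motion :: "('a::euclidean_space \<Rightarrow> 'a) \<Rightarrow> bool" where
  "rigid_motion T \<longleftrightarrow> (\<exists>f c. orthogonal_transformation f \<and> T = (\<lambda>x. f x + c))"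

definition holder_on :: "real \<Rightarrow> real \<Rightarrow> 'a::metric_space set \<Rightarrow> ('a \<Rightarrow> real) \<Rightarrow> bool" where
  "holder_on \<alpha> K S \<phi> \<longleftrightarrow> (\<forall>x\<in>S. \<forall>y\<in>S. \<bar>\<phi> x - \<phi> y\<bar> \<le> K * dist x y powr \<alpha>)"

(* In moved coordinates z = T x, a basis vector e plays the role of the x_n-axis:
   x_n is z \<bullet> e, and x' is the projection z - (z \<bullet> e) *\<^sub>R e onto the hyperplane
   {w. w \<bullet> e = 0}, a copy of R^(n-1) on which \<phi> lives. "Domain" means nonempty,
   open and connected. *)
definition bounded_holder_domain :: "real \<Rightarrow> 'a::euclidean_space set \<Rightarrow> bool" where
  "bounded_holder_domain \<alpha> \<Omega> \<longleftrightarrow>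
     \<Omega> \<noteq> {} \<and> open \<Omega> \<and> connected \<Omega> \<and> bounded \<Omega> \<and>
     (\<forall>x\<in>frontier \<Omega>. \<exists>T e a b \<phi> K.
        rigid_motion T \<and> e \<in> Basis \<and> T x \<in> box a b \<and>
        holder_on \<alpha> K {w. w \<bullet> e = 0} \<phi> \<and>
        T ` \<Omega> \<inter> box a b = {z \<in> box a b. z \<bullet> e < \<phi> (z - (z \<bullet> e) *\<^sub>R e)})"

(* t^(1/p) on [0, \<infinity>], with value \<infinity> at \<infinity>. *)
definition enn_root :: "real \<Rightarrow> ennreal \<Rightarrow> ennreal" where
  "enn_root p t = (if t = \<infinity> then \<infinity> else ennreal (enn2real t powr (1 / p)))"

definition weighted_Lp_norm ::
    "real \<Rightarrow> 'a::euclidean_space set \<Rightarrow> ('a \<Rightarrow> real) \<Rightarrow> ('a \<Rightarrow> real) \<Rightarrow> ennreal" where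
  "weighted_Lp_norm p \<Omega> \<eta> f =
     enn_root p (\<integral>\<^sup>+x\<in>\<Omega>. ennreal (\<bar>f x\<bar> powr p * \<eta> x) \<partial>lebesgue)"

definition weighted_Lp ::
    "real \<Rightarrow> 'a::euclidean_space set \<Rightarrow> ('a \<Rightarrow> real) \<Rightarrow> ('a \<Rightarrow> real) set" where
  "weighted_Lp p \<Omega> \<eta> =
     {f \<in> borel_measurable (lebesgue_on \<Omega>). weighted_Lp_norm p \<Omega> \<eta> f < \<infinity>}"

definition bdist :: "'a::euclidean_space set \<Rightarrow> 'a \<Rightarrow> real" where
  "bdist \<Omega> x = infdist x (frontier \<Omega>)"

(* The double integral on the right-hand side, before taking the p-th root. The
   exponent \<gamma> is the full exponent of \<delta>(x,y) = min (d x) (d y). On the null set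
   y = x the integrand is 0 since x / 0 = 0. *)
definition frac_energy ::
    "real \<Rightarrow> real \<Rightarrow> real \<Rightarrow> real \<Rightarrow> 'a::euclidean_space set \<Rightarrow> ('a \<Rightarrow> real) \<Rightarrow> ennreal" where
  "frac_energy p s \<tau> \<gamma> \<Omega> u =
     (\<integral>\<^sup>+x\<in>\<Omega>. (\<integral>\<^sup>+y\<in>\<Omega> \<inter> ball x (\<tau> * bdist \<Omega> x).
        ennreal (\<bar>u y - u x\<bar> powr p / norm (y - x) powr (real DIM('a) + s * p)
                 * min (bdist \<Omega> x) (bdist \<Omega> y) powr \<gamma>) \<partial>lebesgue) \<partial>lebesgue)"

end

theory Submission
  imports Defs
begin

text \<open>Write \<open>d\<close> for the distance to the boundary. Near a boundary point let \<open>v\<close> be the depth below the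
  graph; there \<open>d \<le> v \<le> K * d powr \<alpha>\<close>, and \<open>d\<close> increases along vertical lines into \<open>\<Omega>\<close>. A vertical line is
  cut at depths \<open>t\<^sub>0 > t\<^sub>1 > \<dots>\<close> with \<open>t\<^sub>j - t\<^bsub>j+1\<^esub> = \<kappa> * d\<close>. With a weight \<open>w\<close> for which \<open>t * w t\<close> increases fast
  enough, the convexity estimate \<open>(1 - \<omega>) |a|^p + (\<omega>/2) |b|^p \<le> |b|^p + C \<omega>^(1-p) |a - b|^p\<close> with
  \<open>\<omega>\<close> comparable to \<open>d / t\<close>, applied to pairs of points from neighbouring intervals, telescopes to a Hardy
  inequality whose right-hand side involves only differences at distance comparable to \<open>d\<close>. Integrating over
  lines and inserting an average over a ball of radius comparable to \<open>d\<close> bounds these differences by an energy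
  on balls, which the fractional energy dominates. What remains is \<open>u - c\<close> on a compact subset
  of \<open>\<Omega>\<close>, handled by chains of balls; since only differences occur, \<open>c\<close> may be a value of \<open>u\<close>.\<close>

section \<open>Elementary inequalities\<close>

text \<open>The obstacle is that depth and distance are not comparable: for \<alpha> < 1 the
  distance d may be as small as a multiple of t^(1/\<alpha>) at depth t, while the right-hand side
  sees only differences over distances below \<tau> d. Steps proportional to t are therefore too
  long, and steps of length \<kappa> d cost a factor (t/d)^(p-1) through \<omega>^(1-p). The
  relation t \<le> K d^\<alpha> turns this loss into the exponent of the theorem: w t^p is bounded
  by d^(\<alpha> p + b), which leaves d^(\<alpha> p + b - p - 1) for differences along a line and
  d^q with q = \<alpha> p + b - p - n for the energy on balls. For b = \<beta> p this q equals (s +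
  \<beta> + \<alpha> - 1) p - s p - n, so s enters only when kernels are compared at the end. The
  condition b > -\<alpha> makes t w(t) increase for negative b, where w is t^(b/\<alpha>) and 1 +
  b/\<alpha> has to be positive. All estimates are additive, take values in [0, \<infinity>] and
  concern Borel functions; the Lebesgue measurable u of the theorem is replaced by a Borel
  version.\<close>

lemma powr_add_le:
  fixes a b p :: real
  assumes "1 < p" "0 \<le> a" "0 \<le> b" "0 < \<mu>" "\<mu> < 1"
  shows "(a + b) powr p \<le> (1 - \<mu>) powr (1 - p) * a powr p + \<mu> powr (1 - p) * b powr p"
proof (cases "a = 0 \<or> b = 0")
  case True
  have "1 \<le> (1 - \<mu>) powr (1 - p)" "1 \<le> \<mu> powr (1 - p)"
    using assms by (auto simp: powr_mono_both intro!: powr_mono2'[of "1-p" _ 1, simplified])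
  then show ?thesis
    using True assms by (auto simp: mult_le_cancel_right1)
next
  case False
  then have pos: "0 < a" "0 < b" using assms by auto
  have "((1 - \<mu>) *\<^sub>R (a / (1 - \<mu>)) + \<mu> *\<^sub>R (b / \<mu>)) powr p
      \<le> (1 - \<mu>) * (a / (1 - \<mu>)) powr p + \<mu> * (b / \<mu>) powr p"
    using convex_onD[OF powr_convex[of p], of \<mu> "a / (1 - \<mu>)" "b / \<mu>"] pos assms by simp
  also have "(1 - \<mu>) * (a / (1 - \<mu>)) powr p = (1 - \<mu>) powr (1 - p) * a powr p"
    using pos assms by (simp add: powr_divide powr_diff)
  also have "\<mu> * (b / \<mu>) powr p = \<mu> powr (1 - p) * b powr p"
    using pos assms by (simp add: powr_divide powr_diff)
  finally show ?thesis using assms by simp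
qed

lemma powr_abs_add_le:
  fixes a b p :: real
  assumes "1 < p"
  shows "\<bar>a + b\<bar> powr p \<le> 2 powr p * (\<bar>a\<bar> powr p + \<bar>b\<bar> powr p)"
proof -
  have "\<bar>a + b\<bar> powr p \<le> (\<bar>a\<bar> + \<bar>b\<bar>) powr p"
    using assms by (intro powr_mono2) auto
  also have "\<dots> \<le> (1/2) powr (1 - p) * (\<bar>a\<bar> powr p + \<bar>b\<bar> powr p)"
    using powr_add_le[OF assms, of "\<bar>a\<bar>" "\<bar>b\<bar>" "1/2"] by (simp add: algebra_simps)
  also have "(1/2) powr (1 - p) \<le> 2 powr p"
    using assms by (simp add: powr_diff powr_divide)
  finally show ?thesis by (simp add: mult_right_mono)
qed

text \<open>Apply \<open>powr_add_le\<close> to |a| \<le> |b| + |a - b| with \<mu> = \<omega>/(2m).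
  Bernoulli gives (1 - \<mu>)^(p-1) \<ge> 1 - \<omega>/2, for which the integer m replaces p - 1.
  Since 1 - \<omega> \<le> (1 - \<omega>/2)^2, the coefficient of |b|^p drops to 1 - \<omega>/2, and
  the remaining \<omega>/2 pays for the second term on the left.\<close>

lemma powr_absorb:
  fixes a b p \<omega> :: real
  assumes p: "1 < p" and \<omega>: "0 < \<omega>" "\<omega> \<le> 1" and m: "1 \<le> m" "p - 1 \<le> real m"
  shows "(1 - \<omega>) * \<bar>a\<bar> powr p + \<omega> / 2 * \<bar>b\<bar> powr p
    \<le> \<bar>b\<bar> powr p + (2 * real m) powr (p - 1) * \<omega> powr (1 - p) * \<bar>a - b\<bar> powr p"
proof -
  define \<mu> where "\<mu> = \<omega> / (2 * real m)"
  have \<mu>: "0 < \<mu>" "\<mu> < 1" "\<mu> \<le> \<omega> / 2" using \<omega> m by (auto simp: \<mu>_def field_simps mult_le_cancel_left)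
  have "1 - \<omega> / 2 = 1 + real m * (- \<mu>)" using m by (simp add: \<mu>_def)
  also have "\<dots> \<le> (1 + (- \<mu>)) ^ m" by (rule Bernoulli_inequality) (use \<mu> in auto)
  also have "\<dots> = (1 - \<mu>) powr real m" using \<mu> by (simp add: powr_realpow)
  also have "\<dots> \<le> (1 - \<mu>) powr (p - 1)" using \<mu> m by (intro powr_mono') auto
  finally have 1: "1 - \<omega> / 2 \<le> (1 - \<mu>) powr (p - 1)" .
  have 2: "(1 - \<mu>) powr (p - 1) * (1 - \<mu>) powr (1 - p) = 1"
    using \<mu> by (simp flip: powr_add)
  have "(1 - \<omega>) * (1 - \<mu>) powr (1 - p) \<le> (1 - \<omega>/2) * (1 - \<omega>/2) * (1 - \<mu>) powr (1 - p)"
    using \<omega> by (intro mult_right_mono) (auto simp: algebra_simps)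
  also have "\<dots> \<le> (1 - \<omega>/2) * (1 - \<mu>) powr (p - 1) * (1 - \<mu>) powr (1 - p)"
    using \<omega> 1 by (intro mult_right_mono mult_left_mono) auto
  also have "\<dots> = 1 - \<omega>/2" using 2 by (simp add: mult.assoc)
  finally have 3: "(1 - \<omega>) * (1 - \<mu>) powr (1 - p) \<le> 1 - \<omega>/2" .
  have 4: "\<mu> powr (1 - p) = (2 * real m) powr (p - 1) * \<omega> powr (1 - p)"
    using \<omega> m unfolding \<mu>_def by (simp add: powr_divide powr_diff)
  have "\<bar>a\<bar> powr p \<le> (\<bar>b\<bar> + \<bar>a - b\<bar>) powr p" using p by (intro powr_mono2) auto
  also have "\<dots> \<le> (1 - \<mu>) powr (1 - p) * \<bar>b\<bar> powr p + \<mu> powr (1 - p) * \<bar>a - b\<bar> powr p"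
    using \<mu> p by (intro powr_add_le) auto
  finally have "(1 - \<omega>) * \<bar>a\<bar> powr p \<le>
      (1 - \<omega>) * ((1 - \<mu>) powr (1 - p) * \<bar>b\<bar> powr p + \<mu> powr (1 - p) * \<bar>a - b\<bar> powr p)"
    using \<omega> by (intro mult_left_mono) auto
  also have "\<dots> = (1 - \<omega>) * (1 - \<mu>) powr (1 - p) * \<bar>b\<bar> powr p
      + (1 - \<omega>) * (\<mu> powr (1 - p) * \<bar>a - b\<bar> powr p)" by (simp add: algebra_simps)
  also have "\<dots> \<le> (1 - \<omega>/2) * \<bar>b\<bar> powr p + 1 * (\<mu> powr (1 - p) * \<bar>a - b\<bar> powr p)"
    using 3 \<omega> by (intro add_mono mult_right_mono) auto
  finally show ?thesis unfolding 4 by (simp add: algebra_simps)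
qed

lemma powr_comparable:
  fixes x y a :: real
  assumes "0 < x" "x / 2 \<le> y" "y \<le> 2 * x"
  shows "x powr a \<le> 2 powr \<bar>a\<bar> * y powr a"
proof -
  have y: "0 < y" using assms by auto
  have "x powr a = (x / y) powr a * y powr a" using assms y by (simp add: powr_divide)
  also have "(x / y) powr a \<le> 2 powr \<bar>a\<bar>"
  proof (cases "0 \<le> a")
    case True
    then show ?thesis using assms y by (auto intro!: powr_mono2 simp: field_simps)
  next
    case False
    have "(x / y) powr a = (y / x) powr (- a)"
      using assms y by (simp add: powr_divide powr_minus field_simps)
    also have "\<dots> \<le> 2 powr \<bar>a\<bar>"
      using False assms y by (auto intro!: powr_mono2 simp: field_simps)
    finally show ?thesis .
  qed
  finally show ?thesis by (simp add: mult_right_mono)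
qed

section \<open>Translation and exchange of Lebesgue integrals\<close>

lemma nn_integral_lborel_translate:
  fixes f :: "'a::euclidean_space \<Rightarrow> ennreal"
  assumes [measurable]: "f \<in> borel_measurable borel"
  shows "(\<integral>\<^sup>+x. f (x + c) \<partial>lborel) = (\<integral>\<^sup>+x. f x \<partial>lborel)"
proof -
  have "(\<integral>\<^sup>+x. f x \<partial>lborel) = (\<integral>\<^sup>+x. f x \<partial>distr lborel borel ((+) c))"
    by (simp only: lborel_distr_plus)
  also have "\<dots> = (\<integral>\<^sup>+x. f (c + x) \<partial>lborel)"
    by (rule nn_integral_distr) auto
  finally show ?thesis by (simp add: add.commute)
qed

lemma nn_integral_lborel_swap:
  fixes f :: "'a::euclidean_space \<Rightarrow> 'b::euclidean_space \<Rightarrow> ennreal"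
  assumes "case_prod f \<in> borel_measurable (borel \<Otimes>\<^sub>M borel)"
  shows "(\<integral>\<^sup>+x. (\<integral>\<^sup>+y. f x y \<partial>lborel) \<partial>lborel) = (\<integral>\<^sup>+y. (\<integral>\<^sup>+x. f x y \<partial>lborel) \<partial>lborel)"
proof -
  have "case_prod f \<in> borel_measurable (lborel \<Otimes>\<^sub>M lborel)"
    using assms by (simp add: lborel_prod borel_prod)
  from lborel_pair.Fubini'[OF this] show ?thesis by simp
qed

section \<open>A one-dimensional Hardy inequality\<close>

lemma nn_integral_stepwise:
  fixes t :: "nat \<Rightarrow> real"
  assumes [measurable]: "h \<in> borel_measurable borel" and t: "\<And>j. t (Suc j) \<le> t j"
  shows "(\<integral>\<^sup>+x\<in>{t n..<t 0}. h x \<partial>lborel) = (\<Sum>j<n. \<integral>\<^sup>+x\<in>{t (Suc j)..<t j}. h x \<partial>lborel)"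
proof (induction n)
  case (Suc n)
  have "t n \<le> t 0" using lift_Suc_antimono_le[of t 0 n] t by simp
  then have "h x * indicator {t (Suc n)..<t 0} x =
      h x * indicator {t n..<t 0} x + h x * indicator {t (Suc n)..<t n} x" for x
    using t[of n] by (auto simp: indicator_def)
  then have "(\<integral>\<^sup>+x\<in>{t (Suc n)..<t 0}. h x \<partial>lborel) =
      (\<integral>\<^sup>+x\<in>{t n..<t 0}. h x \<partial>lborel) + (\<integral>\<^sup>+x\<in>{t (Suc n)..<t n}. h x \<partial>lborel)"
    by (simp add: nn_integral_add)
  with Suc show ?case by (simp add: add.commute)
qed simp

text \<open>Each term in one variable picks up the length of the other interval. For this reason
  \<open>hardy_step\<close> divides its pointwise inequality by both lengths before integrating over
  I \<times> J.\<close>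

lemma nn_integral_pair_sum:
  fixes F :: "real \<Rightarrow> ennreal" and a b :: ennreal
  assumes [measurable]: "F \<in> borel_measurable borel" "I \<in> sets borel" "J \<in> sets borel"
  shows "(\<integral>\<^sup>+t\<in>I. (\<integral>\<^sup>+s\<in>J. (a * F s + b * F t) \<partial>lborel) \<partial>lborel)
    = a * emeasure lborel I * (\<integral>\<^sup>+s\<in>J. F s \<partial>lborel) + b * emeasure lborel J * (\<integral>\<^sup>+t\<in>I. F t \<partial>lborel)"
proof -
  have "(\<integral>\<^sup>+s\<in>J. (a * F s + b * F t) \<partial>lborel)
      = a * (\<integral>\<^sup>+s\<in>J. F s \<partial>lborel) + b * emeasure lborel J * F t" for t
    by (simp add: distrib_right nn_integral_add nn_integral_cmult mult.assoc)
       (simp add: mult.commute mult.left_commute nn_integral_cmult)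
  moreover have "(\<integral>\<^sup>+t\<in>I. (a * X + b * Y * F t) \<partial>lborel)
      = a * emeasure lborel I * X + b * Y * (\<integral>\<^sup>+t\<in>I. F t \<partial>lborel)" for X Y
    by (simp add: distrib_right nn_integral_add nn_integral_cmult mult.assoc)
       (simp add: mult.commute mult.left_commute)
  ultimately show ?thesis by simp
qed

lemma ennreal_combination_le:
  fixes a b c d x y z v :: real
  assumes "a * x + b * y \<le> c * z + d * v"
    and "0 \<le> a" "0 \<le> b" "0 \<le> c" "0 \<le> d" "0 \<le> x" "0 \<le> y" "0 \<le> z" "0 \<le> v"
  shows "ennreal a * ennreal x + ennreal b * ennreal y \<le> ennreal c * ennreal z + ennreal d * ennreal v"
proof -
  have "ennreal (a * x + b * y) \<le> ennreal (c * z + d * v)" by (intro ennreal_leI assms)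
  then show ?thesis using assms by (simp add: ennreal_mult)
qed

text \<open>The factor (2m)^(p-1), m = \<lceil>p\<rceil>, comes from \<open>powr_absorb\<close>;
  c^(1-p) and \<kappa>^(-p-1) come from \<omega> = c \<kappa> D / t and the two interval lengths; M
  from the bound on w t^p; 2 and 2^|g-1| from replacing values of D by the value at another point of
  the step.\<close>

definition hardy_const :: "real \<Rightarrow> real \<Rightarrow> real \<Rightarrow> real \<Rightarrow> real \<Rightarrow> real" where
  "hardy_const p \<kappa> c M g =
     2 * (2 * real (nat \<lceil>p\<rceil>)) powr (p - 1) * c powr (1 - p) * \<kappa> powr (- p - 1) * M * 2 powr \<bar>g - 1\<bar>"

lemma hardy_const_nonneg: "0 \<le> M \<Longrightarrow> 0 \<le> hardy_const p \<kappa> c M g"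
  by (simp add: hardy_const_def)

text \<open>Exponent count: (D/t)^(1-p) t w / D^2 = w t^p D^(-p-1), and w t^p \<le> M D^(g+p) leaves
  D^(g-1). Here D and D' are the distances at the upper ends of two neighbouring intervals, and d is
  the distance at a point of the first.\<close>

lemma hardy_coeff_le:
  fixes p \<kappa> c M g t w D D' :: real
  assumes p: "1 < p" and \<kappa>: "0 < \<kappa>" and c: "0 < c" and t: "0 < t" and w: "0 < w"
    and D: "0 < D" "D / 2 \<le> D'" "D' \<le> D" and d: "D / 2 \<le> d" "d \<le> D"
    and wt: "w * t powr p \<le> M * D powr (g + p)"
  shows "(2 * real (nat \<lceil>p\<rceil>)) powr (p - 1) * (c * (\<kappa> * D) / t) powr (1 - p) * (t * w) / ((\<kappa> * D) * (\<kappa> * D'))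
      \<le> hardy_const p \<kappa> c M g * d powr (g - 1)"
proof -
  define A where "A = (2 * real (nat \<lceil>p\<rceil>)) powr (p - 1)"
  have A: "0 \<le> A" by (simp add: A_def)
  have D': "0 < D'" using D by auto
  have M: "0 \<le> M * D powr (g + p)" using wt w t by (smt (verit) mult_nonneg_nonneg powr_ge_zero)
  then have M: "0 \<le> M" using D by (simp add: zero_le_mult_iff)
  have e1: "A * (c * (\<kappa> * D) / t) powr (1 - p) * (t * w)
      = A * c powr (1 - p) * \<kappa> powr (1 - p) * D powr (1 - p) * (w * t powr p)"
    using c \<kappa> D t by (simp add: powr_divide powr_mult powr_diff mult_ac)
  also have "\<dots> \<le> A * c powr (1 - p) * \<kappa> powr (1 - p) * D powr (1 - p) * (M * D powr (g + p))"
    using wt A by (intro mult_left_mono) auto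
  also have "\<dots> = A * c powr (1 - p) * \<kappa> powr (1 - p) * M * D powr (g + 1)"
    using D by (simp add: powr_add powr_diff field_simps)
  finally have le: "A * (c * (\<kappa> * D) / t) powr (1 - p) * (t * w)
    \<le> A * c powr (1 - p) * \<kappa> powr (1 - p) * M * D powr (g + 1)" .
  have "A * (c * (\<kappa> * D) / t) powr (1 - p) * (t * w) / ((\<kappa> * D) * (\<kappa> * D'))
      \<le> A * c powr (1 - p) * \<kappa> powr (1 - p) * M * D powr (g + 1) / ((\<kappa> * D) * (\<kappa> * (D / 2)))"
    using le A M D \<kappa> D' c by (intro frac_le mult_left_mono) auto
  also have "\<dots> = 2 * A * c powr (1 - p) * \<kappa> powr (- p - 1) * M * D powr (g - 1)"
  proof -
    have 1: "D powr (g + 1) = D powr (g - 1) * D * D"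
      using D by (simp add: powr_add powr_diff)
    have 2: "\<kappa> powr (1 - p) = \<kappa> powr (- p - 1) * \<kappa> * \<kappa>"
      using \<kappa> by (simp add: powr_add powr_diff powr_minus field_simps)
    show ?thesis unfolding 1 2 using D \<kappa> by (simp add: field_simps)
  qed
  also have "\<dots> \<le> 2 * A * c powr (1 - p) * \<kappa> powr (- p - 1) * M * (2 powr \<bar>g - 1\<bar> * d powr (g - 1))"
    using A M D d by (intro mult_left_mono powr_comparable) auto
  finally show ?thesis by (simp add: hardy_const_def A_def mult.assoc)
qed

text \<open>The variable t is a depth and D the distance to the boundary along one line.
  \<open>flux\<close> is the integrated form of (t w)' \<ge> c w. \<open>D_w\<close> bounds the
  desired weight D^b by w; it allows s down to t/2 because one step never more than halves the
  depth. \<open>w_D\<close> limits how large w may be for the final exponent.\<close>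

locale hardy_line =
  fixes p \<kappa> c M b g T :: real and D w f :: "real \<Rightarrow> real"
  assumes p: "1 < p" and \<kappa>: "0 < \<kappa>" "\<kappa> \<le> 1/2" and c: "0 < c" "c \<le> 1" and M: "0 \<le> M" and T: "0 < T"
    and D_meas [measurable]: "D \<in> borel_measurable borel"
    and f_meas [measurable]: "f \<in> borel_measurable borel"
    and D: "\<And>t. 0 < t \<Longrightarrow> t \<le> T \<Longrightarrow> 0 < D t" "\<And>t. 0 < t \<Longrightarrow> t \<le> T \<Longrightarrow> D t \<le> t"
    and w: "\<And>t. 0 < t \<Longrightarrow> t \<le> T \<Longrightarrow> 0 < w t"
    and D_mono: "\<And>s t. 0 < s \<Longrightarrow> s \<le> t \<Longrightarrow> t \<le> T \<Longrightarrow> D s \<le> D t"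
    and D_lip: "\<And>s t. 0 < s \<Longrightarrow> s \<le> t \<Longrightarrow> t \<le> T \<Longrightarrow> D t - D s \<le> t - s"
    and flux: "\<And>s t. 0 < s \<Longrightarrow> s \<le> t \<Longrightarrow> t \<le> T \<Longrightarrow> s * w s \<le> t * w t - c * (t - s) * w t"
    and D_w: "\<And>s t. 0 < t \<Longrightarrow> t \<le> T \<Longrightarrow> t / 2 \<le> s \<Longrightarrow> s \<le> t \<Longrightarrow> D s powr b \<le> M * w t"
    and w_D: "\<And>t. 0 < t \<Longrightarrow> t \<le> T \<Longrightarrow> w t * t powr p \<le> M * D t powr (g + p)"
begin

definition \<sigma> :: "nat \<Rightarrow> real" where
  "\<sigma> = rec_nat T (\<lambda>_ t. t - \<kappa> * D t)"

lemma \<sigma>_0: "\<sigma> 0 = T" and \<sigma>_Suc: "\<sigma> (Suc j) = \<sigma> j - \<kappa> * D (\<sigma> j)"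
  by (simp_all add: \<sigma>_def)

lemma step_bounds:
  assumes "0 < t" "t \<le> T"
  shows "t / 2 \<le> t - \<kappa> * D t" "0 < t - \<kappa> * D t" "t - \<kappa> * D t < t"
proof -
  have "\<kappa> * D t \<le> 1/2 * t"
    using assms D \<kappa> by (intro mult_mono) (auto intro: less_imp_le)
  then show "t / 2 \<le> t - \<kappa> * D t" "0 < t - \<kappa> * D t" using assms by auto
  show "t - \<kappa> * D t < t" using D(1)[OF assms] \<kappa> by auto
qed

lemma \<sigma>_pos: "0 < \<sigma> j" and \<sigma>_le: "\<sigma> j \<le> T"
proof -
  have "0 < \<sigma> j \<and> \<sigma> j \<le> T"
    by (induction j) (use T step_bounds in \<open>force simp: \<sigma>_0 \<sigma>_Suc\<close>)+
  then show "0 < \<sigma> j" "\<sigma> j \<le> T" by auto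
qed

lemma \<sigma>_dec: "\<sigma> (Suc j) < \<sigma> j" and \<sigma>_half: "\<sigma> j / 2 \<le> \<sigma> (Suc j)"
  using step_bounds[OF \<sigma>_pos \<sigma>_le, of j] by (auto simp: \<sigma>_Suc)

text \<open>At a positive limit l, monotonicity of D would make every step at least \<kappa> D(l) >
  0 long, while the steps of a convergent sequence tend to 0.\<close>

lemma \<sigma>_tendsto_0: "\<sigma> \<longlonglongrightarrow> 0"
proof -
  have "decseq \<sigma>" using \<sigma>_dec by (auto intro!: decseq_SucI less_imp_le)
  moreover have "\<And>i. 0 \<le> \<sigma> i" using \<sigma>_pos less_imp_le by auto
  ultimately obtain l where l: "\<sigma> \<longlonglongrightarrow> l" "\<And>i. l \<le> \<sigma> i"
    using decseq_convergent by blast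
  have "0 \<le> l" by (rule LIMSEQ_le_const[OF l(1)]) (use \<sigma>_pos less_imp_le in auto)
  moreover have "\<not> 0 < l"
  proof
    assume "0 < l"
    then have lT: "l \<le> T" using l(2)[of 0] by (simp add: \<sigma>_0)
    have "(\<lambda>j. \<sigma> j - \<sigma> (Suc j)) \<longlonglongrightarrow> l - l"
      using l(1) by (intro tendsto_diff LIMSEQ_Suc)
    moreover have "\<kappa> * D l \<le> \<sigma> j - \<sigma> (Suc j)" for j
      using D_mono[OF \<open>0 < l\<close> l(2) \<sigma>_le, of j] \<kappa> by (simp add: \<sigma>_Suc)
    ultimately have "\<kappa> * D l \<le> l - l"
      by (intro LIMSEQ_le_const[where X = "\<lambda>j. \<sigma> j - \<sigma> (Suc j)"]) auto
    then show False using D(1)[OF \<open>0 < l\<close> lT] \<kappa> by (auto simp: mult_le_0_iff)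
  qed
  ultimately show ?thesis using l by simp
qed

definition mass :: "nat \<Rightarrow> ennreal" where
  "mass j = (\<integral>\<^sup>+t\<in>{\<sigma> (Suc j)..<\<sigma> j}. ennreal (\<bar>f t\<bar> powr p) \<partial>lborel)"

text \<open>The radius is fixed by neighbouring intervals: for t in one of them and s in the next,
  the distance is at most the sum of the two lengths, and each length is at most 2 \<kappa> D(t)
  because D at most halves within a step.\<close>

definition osc :: "real \<Rightarrow> ennreal" where
  "osc t = (\<integral>\<^sup>+s\<in>{0<..<T} \<inter> {s. \<bar>s - t\<bar> < 4 * \<kappa> * D t}.
     ennreal (\<bar>f s - f t\<bar> powr p * D t powr (g - 1)) \<partial>lborel)"

lemma osc_meas [measurable]: "osc \<in> borel_measurable borel"
proof -
  have "osc = (\<lambda>t. \<integral>\<^sup>+s. ennreal (\<bar>f s - f t\<bar> powr p * D t powr (g - 1)) *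
      (indicator {0<..<T} s * indicator {r. r < 4 * \<kappa> * D t} \<bar>s - t\<bar>) \<partial>lborel)"
    unfolding osc_def by (intro ext nn_integral_cong) (auto simp: indicator_def)
  also have "\<dots> \<in> borel_measurable borel"
    unfolding indicator_def by measurable
  finally show ?thesis .
qed

lemma D_on_step:
  assumes "\<sigma> (Suc j) \<le> t" "t \<le> \<sigma> j"
  shows "D (\<sigma> j) / 2 \<le> D t" "D t \<le> D (\<sigma> j)"
proof -
  have t: "0 < t" using \<sigma>_pos[of "Suc j"] assms by simp
  show "D t \<le> D (\<sigma> j)" using D_mono[OF t] assms \<sigma>_le by blast
  have "D (\<sigma> j) - D t \<le> \<sigma> j - t" using D_lip[OF t] assms \<sigma>_le by blast
  also have "\<dots> \<le> \<kappa> * D (\<sigma> j)" using assms by (simp add: \<sigma>_Suc)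
  also have "\<dots> \<le> 1/2 * D (\<sigma> j)"
    using \<kappa> D(1)[OF \<sigma>_pos \<sigma>_le, of j] by (intro mult_right_mono) auto
  finally show "D (\<sigma> j) / 2 \<le> D t" by simp
qed

text \<open>Since \<kappa> D is the interval length, the telescoping quantity is t w(t) times the
  mean of |f|^p over the step below t. \<open>flux\<close> makes t w(t) fall by the factor 1 -
  \<omega> from one cut to the next, and \<open>powr_absorb\<close>, averaged over pairs of points,
  turns this slack into the gain c w/2 times \<open>mass j\<close>.\<close>

lemma hardy_step:
  "ennreal (\<sigma> (Suc j) * w (\<sigma> (Suc j)) / (\<kappa> * D (\<sigma> (Suc j)))) * mass (Suc j)
      + ennreal (c * w (\<sigma> j) / 2) * mass j
    \<le> ennreal (\<sigma> j * w (\<sigma> j) / (\<kappa> * D (\<sigma> j))) * mass j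
      + ennreal (hardy_const p \<kappa> c M g) * (\<integral>\<^sup>+t\<in>{\<sigma> (Suc j)..<\<sigma> j}. osc t \<partial>lborel)"
proof -
  define t0 t1 t2 where "t0 = \<sigma> j" and "t1 = \<sigma> (Suc j)" and "t2 = \<sigma> (Suc (Suc j))"
  define l l' where "l = \<kappa> * D t0" and "l' = \<kappa> * D t1"
  have t0: "0 < t0" "t0 \<le> T" and t1: "0 < t1" "t1 \<le> T" and t2: "0 < t2"
    using \<sigma>_pos \<sigma>_le by (auto simp: t0_def t1_def t2_def)
  have l: "0 < l" "t0 - t1 = l" and l': "0 < l'" "t1 - t2 = l'"
    using D(1) t0 t1 \<kappa> by (auto simp: l_def l'_def t0_def t1_def t2_def \<sigma>_Suc)
  have lt: "l \<le> t0" using l t1 by simp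
  define I J where "I = {t1..<t0}" and "J = {t2..<t1}"
  define F where "F = (\<lambda>s. ennreal (\<bar>f s\<bar> powr p))"
  \<comment> \<open>Chosen so that \<omega> t0 w(t0) = c (t0 - t1) w(t0), the decrease provided by
    \<open>flux\<close>.\<close>
  define \<omega> where "\<omega> = c * l / t0"
  have \<omega>: "0 < \<omega>" "\<omega> \<le> 1"
    using c l lt t0 by (auto simp: \<omega>_def field_simps intro: mult_le_one order_trans[OF mult_right_mono[of c 1 l]])
  define A where "A = (2 * real (nat \<lceil>p\<rceil>)) powr (p - 1)"
  define K where "K = hardy_const p \<kappa> c M g"
  have [measurable]: "F \<in> borel_measurable borel" "I \<in> sets borel" "J \<in> sets borel"
    by (auto simp: F_def I_def J_def)
  have fl: "t1 * w t1 \<le> (1 - \<omega>) * (t0 * w t0)"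
  proof -
    have e: "\<omega> * (t0 * w t0) = c * (t0 - t1) * w t0" using t0 l by (simp add: \<omega>_def)
    have "t1 * w t1 \<le> t0 * w t0 - \<omega> * (t0 * w t0)"
      unfolding e using flux[OF t1(1), of t0] l t0 by simp
    then show ?thesis by (simp add: left_diff_distrib)
  qed
  have pt: "ennreal (t1 * w t1 / (l * l')) * F s + ennreal (c * w t0 / 2 / l') * F t
      \<le> ennreal (t0 * w t0 / (l * l')) * F t + ennreal K * ennreal (\<bar>f s - f t\<bar> powr p * D t powr (g - 1))"
    if "t \<in> I" for s t
  proof -
    have Dt: "D t0 / 2 \<le> D t" "D t \<le> D t0" and Dt1: "D t0 / 2 \<le> D t1" "D t1 \<le> D t0"
      using D_on_step[of j t] D_on_step[of j t1] that \<sigma>_dec[of j]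
      by (auto simp: I_def t0_def t1_def)
    have m: "1 \<le> nat \<lceil>p\<rceil>" "p - 1 \<le> real (nat \<lceil>p\<rceil>)" using p by linarith+
    have "t1 * w t1 * \<bar>f s\<bar> powr p + \<omega> / 2 * (t0 * w t0) * \<bar>f t\<bar> powr p
        \<le> (t0 * w t0) * ((1 - \<omega>) * \<bar>f s\<bar> powr p + \<omega> / 2 * \<bar>f t\<bar> powr p)"
      using mult_right_mono[OF fl, of "\<bar>f s\<bar> powr p"] by (simp add: algebra_simps)
    also have "\<dots> \<le> (t0 * w t0) * (\<bar>f t\<bar> powr p + A * \<omega> powr (1 - p) * \<bar>f s - f t\<bar> powr p)"
      unfolding A_def using powr_absorb[OF p \<omega> m, of "f s" "f t"] t0 w by (intro mult_left_mono) (auto intro: less_imp_le)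
    finally have 1: "t1 * w t1 * \<bar>f s\<bar> powr p + \<omega> / 2 * (t0 * w t0) * \<bar>f t\<bar> powr p
        \<le> t0 * w t0 * \<bar>f t\<bar> powr p + A * \<omega> powr (1 - p) * (t0 * w t0) * \<bar>f s - f t\<bar> powr p"
      by (simp add: algebra_simps)
    have "(t1 * w t1 * \<bar>f s\<bar> powr p + \<omega> / 2 * (t0 * w t0) * \<bar>f t\<bar> powr p) / (l * l')
        \<le> (t0 * w t0 * \<bar>f t\<bar> powr p + A * \<omega> powr (1 - p) * (t0 * w t0) * \<bar>f s - f t\<bar> powr p) / (l * l')"
      using 1 l l' by (intro divide_right_mono) auto
    then have 2: "t1 * w t1 / (l * l') * \<bar>f s\<bar> powr p + (\<omega> / 2 * (t0 * w t0)) / (l * l') * \<bar>f t\<bar> powr p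
        \<le> t0 * w t0 / (l * l') * \<bar>f t\<bar> powr p + (A * \<omega> powr (1 - p) * (t0 * w t0) / (l * l')) * \<bar>f s - f t\<bar> powr p"
      by (simp add: add_divide_distrib)
    have e: "(\<omega> / 2 * (t0 * w t0)) / (l * l') = c * w t0 / 2 / l'"
      using l(1) l'(1) t0(1) by (simp add: \<omega>_def)
    have co: "A * \<omega> powr (1 - p) * (t0 * w t0) / (l * l') \<le> K * D t powr (g - 1)"
      unfolding A_def \<omega>_def l_def l'_def K_def
      using hardy_coeff_le[OF p \<kappa>(1) c(1) t0(1) w[OF t0] D(1)[OF t0] Dt1 Dt w_D[OF t0]] .
    have 3: "t1 * w t1 / (l * l') * \<bar>f s\<bar> powr p + c * w t0 / 2 / l' * \<bar>f t\<bar> powr p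
        \<le> t0 * w t0 / (l * l') * \<bar>f t\<bar> powr p + K * (\<bar>f s - f t\<bar> powr p * D t powr (g - 1))"
      using 2 mult_right_mono[OF co, of "\<bar>f s - f t\<bar> powr p"] unfolding e by (simp add: algebra_simps)
    have nn: "0 \<le> t1 * w t1 / (l * l')" "0 \<le> c * w t0 / 2 / l'" "0 \<le> t0 * w t0 / (l * l')" "0 \<le> K"
      using t1 t0 w l l' c M by (auto simp: K_def hardy_const_nonneg intro!: divide_nonneg_pos mult_nonneg_nonneg less_imp_le)
    show ?thesis
      unfolding F_def by (intro ennreal_combination_le 3 nn) auto
  qed
  define G where "G = (\<lambda>t. \<integral>\<^sup>+s\<in>J. ennreal (\<bar>f s - f t\<bar> powr p * D t powr (g - 1)) \<partial>lborel)"
  have [measurable]: "G \<in> borel_measurable borel" unfolding G_def by measurable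
  have G_le: "G t \<le> osc t" if "t \<in> I" for t
  proof -
    have Dt: "D t0 / 2 \<le> D t" and Dt1: "D t1 \<le> D t0"
      using D_on_step[of j t] D_on_step[of j t1] that \<sigma>_dec[of j]
      by (auto simp: I_def t0_def t1_def)
    have "l' \<le> \<kappa> * (2 * D t)" "l \<le> \<kappa> * (2 * D t)"
      unfolding l_def l'_def using Dt Dt1 \<kappa> by (intro mult_left_mono; simp)+
    then have "J \<subseteq> {0<..<T} \<inter> {s. \<bar>s - t\<bar> < 4 * \<kappa> * D t}"
      using that l l' t0 t2 unfolding I_def J_def by (auto simp: abs_if)
    then show ?thesis unfolding G_def osc_def
      by (intro nn_integral_mono mult_left_mono) (auto simp: indicator_def)
  qed
  have emI: "emeasure lborel I = ennreal l" and emJ: "emeasure lborel J = ennreal l'"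
    using l l' unfolding I_def J_def by auto
  have N: "mass j = (\<integral>\<^sup>+t\<in>I. F t \<partial>lborel)" "mass (Suc j) = (\<integral>\<^sup>+t\<in>J. F t \<partial>lborel)"
    by (simp_all add: mass_def I_def J_def F_def t0_def t1_def t2_def)
  have w01: "0 < w t0" "0 < w t1" using w t0 t1 by auto
  have "ennreal (t1 * w t1 / l') * mass (Suc j) + ennreal (c * w t0 / 2) * mass j
      = ennreal (t1 * w t1 / (l * l')) * ennreal l * mass (Suc j) + ennreal (c * w t0 / 2 / l') * ennreal l' * mass j"
    using l l' w01 t0 t1 c by (simp flip: ennreal_mult)
  also have "\<dots> = (\<integral>\<^sup>+t\<in>I. (\<integral>\<^sup>+s\<in>J. (ennreal (t1 * w t1 / (l * l')) * F s + ennreal (c * w t0 / 2 / l') * F t) \<partial>lborel) \<partial>lborel)"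
    by (subst nn_integral_pair_sum) (simp_all add: N emI emJ)
  also have "\<dots> \<le> (\<integral>\<^sup>+t\<in>I. (\<integral>\<^sup>+s\<in>J. (ennreal (t0 * w t0 / (l * l')) * F t
      + ennreal K * ennreal (\<bar>f s - f t\<bar> powr p * D t powr (g - 1))) \<partial>lborel) \<partial>lborel)"
  proof (intro nn_integral_mono)
    fix t
    show "(\<integral>\<^sup>+s\<in>J. (ennreal (t1 * w t1 / (l * l')) * F s + ennreal (c * w t0 / 2 / l') * F t) \<partial>lborel) * indicator I t
      \<le> (\<integral>\<^sup>+s\<in>J. (ennreal (t0 * w t0 / (l * l')) * F t
      + ennreal K * ennreal (\<bar>f s - f t\<bar> powr p * D t powr (g - 1))) \<partial>lborel) * indicator I t"
    proof (cases "t \<in> I")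
      case True
      then show ?thesis using pt[OF True]
        by (intro mult_right_mono nn_integral_mono) auto
    qed simp
  qed
  also have "\<dots> = (\<integral>\<^sup>+t\<in>I. (ennreal (t0 * w t0 / (l * l')) * ennreal l' * F t + ennreal K * G t) \<partial>lborel)"
  proof (intro nn_integral_cong arg_cong2[where f = "(*)"] refl)
    fix t
    have "(\<integral>\<^sup>+s\<in>J. (ennreal (t0 * w t0 / (l * l')) * F t
      + ennreal K * ennreal (\<bar>f s - f t\<bar> powr p * D t powr (g - 1))) \<partial>lborel)
      = (\<integral>\<^sup>+s. (ennreal (t0 * w t0 / (l * l')) * F t) * indicator J s
      + ennreal K * (ennreal (\<bar>f s - f t\<bar> powr p * D t powr (g - 1)) * indicator J s) \<partial>lborel)"
      by (intro nn_integral_cong) (simp add: distrib_right mult.assoc)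
    also have "\<dots> = (ennreal (t0 * w t0 / (l * l')) * F t) * emeasure lborel J + ennreal K * G t"
      unfolding G_def by (subst nn_integral_add) (simp_all add: nn_integral_cmult)
    finally show "(\<integral>\<^sup>+s\<in>J. (ennreal (t0 * w t0 / (l * l')) * F t
      + ennreal K * ennreal (\<bar>f s - f t\<bar> powr p * D t powr (g - 1))) \<partial>lborel)
      = ennreal (t0 * w t0 / (l * l')) * ennreal l' * F t + ennreal K * G t"
      by (simp add: emJ mult.assoc mult.left_commute mult.commute)
  qed
  also have "\<dots> = ennreal (t0 * w t0 / (l * l')) * ennreal l' * mass j + ennreal K * (\<integral>\<^sup>+t\<in>I. G t \<partial>lborel)"
    by (simp add: N distrib_right nn_integral_add nn_integral_cmult mult.assoc)
  also have "ennreal (t0 * w t0 / (l * l')) * ennreal l' = ennreal (t0 * w t0 / l)"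
    using l l' w01 t0 by (simp flip: ennreal_mult)
  also have "(\<integral>\<^sup>+t\<in>I. G t \<partial>lborel) \<le> (\<integral>\<^sup>+t\<in>I. osc t \<partial>lborel)"
    using G_le by (intro nn_integral_mono) (auto simp: indicator_def)
  finally show ?thesis
    by (simp add: K_def I_def l_def l'_def t0_def t1_def add_left_mono mult_left_mono)
qed

text \<open>The old telescoping term stands on the right of \<open>hardy_step\<close> and the new
  one on the left, so that the sum closes without subtraction in [0, \<infinity>].\<close>

lemma hardy_sum:
  "ennreal (\<sigma> n * w (\<sigma> n) / (\<kappa> * D (\<sigma> n))) * mass n + (\<Sum>j<n. ennreal (c * w (\<sigma> j) / 2) * mass j)
    \<le> ennreal (T * w T / (\<kappa> * D T)) * mass 0
      + ennreal (hardy_const p \<kappa> c M g) * (\<Sum>j<n. \<integral>\<^sup>+t\<in>{\<sigma> (Suc j)..<\<sigma> j}. osc t \<partial>lborel)"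
proof (induction n)
  case (Suc n)
  have "ennreal (\<sigma> (Suc n) * w (\<sigma> (Suc n)) / (\<kappa> * D (\<sigma> (Suc n)))) * mass (Suc n)
      + (\<Sum>j<Suc n. ennreal (c * w (\<sigma> j) / 2) * mass j)
      = (ennreal (\<sigma> (Suc n) * w (\<sigma> (Suc n)) / (\<kappa> * D (\<sigma> (Suc n)))) * mass (Suc n)
      + ennreal (c * w (\<sigma> n) / 2) * mass n) + (\<Sum>j<n. ennreal (c * w (\<sigma> j) / 2) * mass j)"
    by (simp add: ac_simps)
  also have "\<dots> \<le> (ennreal (\<sigma> n * w (\<sigma> n) / (\<kappa> * D (\<sigma> n))) * mass n
      + ennreal (hardy_const p \<kappa> c M g) * (\<integral>\<^sup>+t\<in>{\<sigma> (Suc n)..<\<sigma> n}. osc t \<partial>lborel))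
      + (\<Sum>j<n. ennreal (c * w (\<sigma> j) / 2) * mass j)"
    by (intro add_right_mono hardy_step)
  also have "\<dots> = (ennreal (\<sigma> n * w (\<sigma> n) / (\<kappa> * D (\<sigma> n))) * mass n
      + (\<Sum>j<n. ennreal (c * w (\<sigma> j) / 2) * mass j))
      + ennreal (hardy_const p \<kappa> c M g) * (\<integral>\<^sup>+t\<in>{\<sigma> (Suc n)..<\<sigma> n}. osc t \<partial>lborel)"
    by (simp add: ac_simps)
  also have "\<dots> \<le> (ennreal (T * w T / (\<kappa> * D T)) * mass 0
      + ennreal (hardy_const p \<kappa> c M g) * (\<Sum>j<n. \<integral>\<^sup>+t\<in>{\<sigma> (Suc j)..<\<sigma> j}. osc t \<partial>lborel))
      + ennreal (hardy_const p \<kappa> c M g) * (\<integral>\<^sup>+t\<in>{\<sigma> (Suc n)..<\<sigma> n}. osc t \<partial>lborel)"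
    by (intro add_right_mono Suc)
  finally show ?case by (simp add: distrib_left ac_simps)
qed (simp add: \<sigma>_0)

text \<open>The term left over at depth \<open>\<sigma> n\<close> is nonnegative and is dropped, so
  the bound does not depend on n; since \<open>\<sigma> n\<close> tends to 0, monotone convergence
  reaches all of (0, T). The starting term \<open>mass 0\<close> lives in the upper half [T/2, T],
  because the first step at most halves the depth.\<close>

lemma hardy_inequality:
  "(\<integral>\<^sup>+t\<in>{0<..<T}. ennreal (\<bar>f t\<bar> powr p * D t powr b) \<partial>lborel)
    \<le> ennreal (2 * M / c) * (ennreal (T * w T / (\<kappa> * D T)) * (\<integral>\<^sup>+t\<in>{T/2..T}. ennreal (\<bar>f t\<bar> powr p) \<partial>lborel)
        + ennreal (hardy_const p \<kappa> c M g) * (\<integral>\<^sup>+t\<in>{0<..<T}. osc t \<partial>lborel))"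
    (is "_ \<le> ?R")
proof -
  define h where "h = (\<lambda>t. ennreal (\<bar>f t\<bar> powr p * D t powr b))"
  have [measurable]: "h \<in> borel_measurable borel" unfolding h_def by measurable
  have dec: "\<sigma> (Suc j) \<le> \<sigma> j" for j using \<sigma>_dec[of j] by simp
  have anti: "antimono \<sigma>" using decseq_SucI[of \<sigma>] dec by simp
  have part: "(\<integral>\<^sup>+t\<in>{\<sigma> n..<T}. h t \<partial>lborel) \<le> ?R" for n
  proof -
    have "(\<integral>\<^sup>+t\<in>{\<sigma> n..<T}. h t \<partial>lborel) = (\<Sum>j<n. \<integral>\<^sup>+t\<in>{\<sigma> (Suc j)..<\<sigma> j}. h t \<partial>lborel)"
      using nn_integral_stepwise[of h \<sigma> n] dec by (simp add: \<sigma>_0)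
    also have "\<dots> \<le> (\<Sum>j<n. ennreal (2 * M / c) * (ennreal (c * w (\<sigma> j) / 2) * mass j))"
    proof (intro sum_mono)
      fix j
      have wj: "0 < w (\<sigma> j)" using w \<sigma>_pos \<sigma>_le by auto
      have "(\<integral>\<^sup>+t\<in>{\<sigma> (Suc j)..<\<sigma> j}. h t \<partial>lborel)
          \<le> (\<integral>\<^sup>+t. ennreal (M * w (\<sigma> j)) * (ennreal (\<bar>f t\<bar> powr p) * indicator {\<sigma> (Suc j)..<\<sigma> j} t) \<partial>lborel)"
      proof (intro nn_integral_mono)
        fix t
        show "h t * indicator {\<sigma> (Suc j)..<\<sigma> j} t
          \<le> ennreal (M * w (\<sigma> j)) * (ennreal (\<bar>f t\<bar> powr p) * indicator {\<sigma> (Suc j)..<\<sigma> j} t)"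
        proof (cases "t \<in> {\<sigma> (Suc j)..<\<sigma> j}")
          case True
          then have "D t powr b \<le> M * w (\<sigma> j)"
            using \<sigma>_half[of j] by (intro D_w \<sigma>_pos \<sigma>_le) auto
          then have "D t powr b * \<bar>f t\<bar> powr p \<le> M * w (\<sigma> j) * \<bar>f t\<bar> powr p"
            by (intro mult_right_mono) auto
          then show ?thesis using True wj M
            by (simp add: h_def mult.commute ennreal_leI flip: ennreal_mult)
        qed simp
      qed
      also have "\<dots> = ennreal (M * w (\<sigma> j)) * mass j"
        unfolding mass_def by (intro nn_integral_cmult) auto
      also have "\<dots> = ennreal (2 * M / c) * (ennreal (c * w (\<sigma> j) / 2) * mass j)"
        using M c wj by (simp add: mult.assoc[symmetric] flip: ennreal_mult)
      finally show "(\<integral>\<^sup>+t\<in>{\<sigma> (Suc j)..<\<sigma> j}. h t \<partial>lborel)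
          \<le> ennreal (2 * M / c) * (ennreal (c * w (\<sigma> j) / 2) * mass j)" .
    qed
    also have "\<dots> = ennreal (2 * M / c) * (\<Sum>j<n. ennreal (c * w (\<sigma> j) / 2) * mass j)"
      by (simp add: sum_distrib_left)
    also have "\<dots> \<le> ennreal (2 * M / c) * (ennreal (\<sigma> n * w (\<sigma> n) / (\<kappa> * D (\<sigma> n))) * mass n
        + (\<Sum>j<n. ennreal (c * w (\<sigma> j) / 2) * mass j))"
      by (intro mult_left_mono) auto
    also have "\<dots> \<le> ennreal (2 * M / c) * (ennreal (T * w T / (\<kappa> * D T)) * mass 0
      + ennreal (hardy_const p \<kappa> c M g) * (\<Sum>j<n. \<integral>\<^sup>+t\<in>{\<sigma> (Suc j)..<\<sigma> j}. osc t \<partial>lborel))"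
      by (intro mult_left_mono hardy_sum) auto
    also have "(\<Sum>j<n. \<integral>\<^sup>+t\<in>{\<sigma> (Suc j)..<\<sigma> j}. osc t \<partial>lborel) = (\<integral>\<^sup>+t\<in>{\<sigma> n..<T}. osc t \<partial>lborel)"
      using nn_integral_stepwise[of osc \<sigma> n] dec by (simp add: \<sigma>_0)
    also have "\<dots> \<le> (\<integral>\<^sup>+t\<in>{0<..<T}. osc t \<partial>lborel)"
      using \<sigma>_pos[of n] by (intro nn_integral_mono mult_left_mono) (auto simp: indicator_def)
    also have "mass 0 \<le> (\<integral>\<^sup>+t\<in>{T/2..T}. ennreal (\<bar>f t\<bar> powr p) \<partial>lborel)"
      using \<sigma>_half[of 0] unfolding mass_def
      by (intro nn_integral_mono mult_left_mono) (auto simp: indicator_def \<sigma>_0)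
    finally show ?thesis by (simp add: mult_left_mono add_mono)
  qed
  have "h t * indicator {0<..<T} t = (SUP n. h t * indicator {\<sigma> n..<T} t)" for t
  proof (cases "t \<in> {0<..<T}")
    case True
    then have "eventually (\<lambda>n. \<sigma> n < t) sequentially"
      using \<sigma>_tendsto_0 by (auto intro: order_tendstoD)
    then obtain n where "\<sigma> n < t" by (auto simp: eventually_sequentially)
    then have "h t * indicator {0<..<T} t \<le> h t * indicator {\<sigma> n..<T} t" using True by simp
    also have "\<dots> \<le> (SUP n. h t * indicator {\<sigma> n..<T} t)" by (intro SUP_upper) auto
    finally show ?thesis using True
      by (intro antisym SUP_least) (auto simp: indicator_def)
  next
    case False
    then have "t \<notin> {\<sigma> n..<T}" for n using \<sigma>_pos[of n] by auto
    with False show ?thesis by simp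
  qed
  then have "(\<integral>\<^sup>+t\<in>{0<..<T}. h t \<partial>lborel) = (\<integral>\<^sup>+t. (SUP n. h t * indicator {\<sigma> n..<T} t) \<partial>lborel)"
    by simp
  also have "\<dots> = (SUP n. \<integral>\<^sup>+t\<in>{\<sigma> n..<T}. h t \<partial>lborel)"
  proof (intro nn_integral_monotone_convergence_SUP)
    show "incseq (\<lambda>n t. h t * indicator {\<sigma> n..<T} t)"
      using anti by (auto simp: incseq_def le_fun_def antimono_def indicator_def) (meson order_trans)
  qed auto
  also have "\<dots> \<le> ?R" by (intro SUP_least part)
  finally show ?thesis by (simp add: h_def)
qed

end

text \<open>The graph of the concave power x^\<theta> lies below its tangent at t. With \<theta> = 1
  + b/\<alpha> this is \<open>flux\<close> for the weight t^(b/\<alpha>).\<close>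

lemma powr_tangent_le:
  fixes s t \<theta> :: real
  assumes "0 < s" "0 < t" "0 \<le> \<theta>" "\<theta> \<le> 1"
  shows "s powr \<theta> \<le> t powr \<theta> - \<theta> * (t - s) * t powr (\<theta> - 1)"
proof -
  have "s powr \<theta> = s powr \<theta> * t powr (1 - \<theta>) * t powr (\<theta> - 1)"
    using assms by (simp add: mult.assoc flip: powr_add)
  also have "\<dots> \<le> (\<theta> * s + (1 - \<theta>) * t) * t powr (\<theta> - 1)"
    using assms by (intro mult_right_mono Youngs_inequality_0) auto
  also have "\<dots> = t * t powr (\<theta> - 1) - \<theta> * (t - s) * t powr (\<theta> - 1)"
    by (simp add: algebra_simps)
  also have "t * t powr (\<theta> - 1) = t powr \<theta>"
    using assms by (simp add: powr_diff)
  finally show ?thesis .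
qed

lemma holder_lower_bound:
  fixes t K x \<alpha> :: real
  assumes "0 < \<alpha>" "0 < K" "0 \<le> t" "0 \<le> x" "t \<le> K * x powr \<alpha>"
  shows "(t / K) powr (1 / \<alpha>) \<le> x"
proof -
  have "(t / K) powr (1 / \<alpha>) \<le> (x powr \<alpha>) powr (1 / \<alpha>)"
    using assms by (intro powr_mono2) (auto simp: field_simps)
  also have "\<dots> = x" using assms by (simp add: powr_powr)
  finally show ?thesis .
qed

text \<open>For \<open>b < 0\<close> the function \<open>t * D t powr b\<close> need not be increasing, so the weight
  \<open>D powr b\<close> is replaced by the larger \<open>t powr (b / \<alpha>)\<close>.\<close>

lemma hardy_line_holder:
  fixes p \<alpha> b K \<kappa> T :: real
  assumes p: "1 < p" and \<alpha>: "0 < \<alpha>" "\<alpha> \<le> 1" and b: "- \<alpha> < b" and K: "1 \<le> K"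
    and \<kappa>: "0 < \<kappa>" "\<kappa> \<le> 1/2" and T: "0 < T"
  obtains C :: real where "0 \<le> C"
    "\<And>D f. D \<in> borel_measurable borel \<Longrightarrow> f \<in> borel_measurable borel \<Longrightarrow>
      (\<And>t. 0 < t \<Longrightarrow> t \<le> T \<Longrightarrow> 0 < D t \<and> D t \<le> t \<and> t \<le> K * D t powr \<alpha>) \<Longrightarrow>
      (\<And>s t. 0 < s \<Longrightarrow> s \<le> t \<Longrightarrow> t \<le> T \<Longrightarrow> D s \<le> D t \<and> D t - D s \<le> t - s) \<Longrightarrow>
      (\<integral>\<^sup>+t\<in>{0<..<T}. ennreal (\<bar>f t\<bar> powr p * D t powr b) \<partial>lborel)
      \<le> ennreal C * ((\<integral>\<^sup>+t\<in>{T/2..T}. ennreal (\<bar>f t\<bar> powr p) \<partial>lborel)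
        + (\<integral>\<^sup>+t\<in>{0<..<T}. (\<integral>\<^sup>+s\<in>{0<..<T} \<inter> {s. \<bar>s - t\<bar> < 4 * \<kappa> * D t}.
            ennreal (\<bar>f s - f t\<bar> powr p * D t powr (\<alpha> * p + b - p - 1)) \<partial>lborel) \<partial>lborel))"
proof
  define g where "g = \<alpha> * p + b - p"
  \<comment> \<open>The relative growth of t w(t): for b \<ge> 0 the weight D^b is itself increasing
    and c = 1 works; for t^(b/\<alpha>) it is the exponent 1 + b/\<alpha>, positive by b >
    -\<alpha>.\<close>
  define c where "c = (if 0 \<le> b then 1 else 1 + b / \<alpha>)"
  \<comment> \<open>The summands serve, in this order, \<open>D_w\<close> and \<open>w_D\<close> for
    b \<ge> 0, then \<open>D_w\<close> and \<open>w_D\<close> for b < 0.\<close>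
  define M where "M = 1 + K powr p + (2 * K) powr (- b / \<alpha>) + K powr (p + b / \<alpha>)"
  define H where "H = hardy_const p \<kappa> c M g"
  \<comment> \<open>Bounds the starting coefficient T w(T) / (\<kappa> D(T)) uniformly in D, using
    D(T) \<ge> (T/K)^(1/\<alpha>); the constant has to be fixed before D and f.\<close>
  define C0 where "C0 = T * (T powr b + T powr (b / \<alpha>)) / (\<kappa> * (T / K) powr (1 / \<alpha>))"
  define C where "C = 2 * M / c * (C0 + H)"
  have c: "0 < c" "c \<le> 1" using \<alpha> b by (auto simp: c_def field_simps)
  have M: "0 \<le> M" by (simp add: M_def)
  have H: "0 \<le> H" by (simp add: H_def hardy_const_nonneg M)
  have C0: "0 \<le> C0" using T \<kappa> by (simp add: C0_def)
  show "0 \<le> C" unfolding C_def using c M C0 H by simp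
  fix D f :: "real \<Rightarrow> real"
  assume meas: "D \<in> borel_measurable borel" "f \<in> borel_measurable borel"
    and D: "\<And>t. 0 < t \<Longrightarrow> t \<le> T \<Longrightarrow> 0 < D t \<and> D t \<le> t \<and> t \<le> K * D t powr \<alpha>"
    and D2: "\<And>s t. 0 < s \<Longrightarrow> s \<le> t \<Longrightarrow> t \<le> T \<Longrightarrow> D s \<le> D t \<and> D t - D s \<le> t - s"
  define w where "w = (if 0 \<le> b then (\<lambda>t. D t powr b) else (\<lambda>t. t powr (b / \<alpha>)))"
  have ap: "b + \<alpha> * p \<ge> 0" using b p \<alpha> by (smt (verit) mult_less_cancel_left1)
  have ap': "0 \<le> p + b / \<alpha>" using ap \<alpha> by (simp add: field_simps)
  have M_ge: "1 \<le> M" "K powr p \<le> M" "(2 * K) powr (- b / \<alpha>) \<le> M" "K powr (p + b / \<alpha>) \<le> M"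
    by (auto simp: M_def)
  have Dlow: "(t / K) powr (1 / \<alpha>) \<le> D t" if "0 < t" "t \<le> T" for t
    using D[OF that] that \<alpha> K by (intro holder_lower_bound) auto
  interpret hardy_line p \<kappa> c M b g T D w f
  proof
    show "0 < w t" if "0 < t" "t \<le> T" for t using D[OF that] that by (simp add: w_def)
    show "s * w s \<le> t * w t - c * (t - s) * w t" if "0 < s" "s \<le> t" "t \<le> T" for s t
    proof (cases "0 \<le> b")
      case True
      have "D s powr b \<le> D t powr b"
        using D2[OF that] D[of s] that True by (intro powr_mono2) auto
      then have "s * D s powr b \<le> s * D t powr b" using that by (intro mult_left_mono) auto
      then show ?thesis using True by (simp add: w_def c_def algebra_simps)
    next
      case False
      have "r * r powr (b / \<alpha>) = r powr (1 + b / \<alpha>)" if "0 < r" for r :: real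
        using that by (simp add: powr_add)
      then show ?thesis
        using powr_tangent_le[of s t c] that c False by (simp add: w_def c_def)
    qed
    show "D s powr b \<le> M * w t" if "0 < t" "t \<le> T" "t / 2 \<le> s" "s \<le> t" for s t
    proof (cases "0 \<le> b")
      case True
      have "D s powr b \<le> D t powr b"
        using D2[of s t] D[of s] that True by (intro powr_mono2) auto
      also have "\<dots> \<le> M * D t powr b" using M_ge by (simp add: mult_le_cancel_right1)
      finally show ?thesis using True by (simp add: w_def)
    next
      case False
      \<comment> \<open>For negative b an upper bound on D(s)^b requires a lower bound on D(s); the
        restriction s \<ge> t/2 is the source of the 2 in \<open>2 * K\<close>.\<close>
      have "(t / 2 / K) powr (1 / \<alpha>) \<le> (s / K) powr (1 / \<alpha>)"
        using that K \<alpha> divide_right_mono[of "t / 2" s K] by (intro powr_mono2) auto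
      also have "\<dots> \<le> D s" using that by (intro Dlow) auto
      finally have "D s powr b \<le> ((t / 2 / K) powr (1 / \<alpha>)) powr b"
        using False that K by (intro powr_mono2') auto
      also have "\<dots> = (2 * K) powr (- b / \<alpha>) * t powr (b / \<alpha>)"
        using that K by (simp add: powr_powr powr_divide powr_mult powr_minus field_simps)
      also have "\<dots> \<le> M * t powr (b / \<alpha>)" by (intro mult_right_mono M_ge) auto
      finally show ?thesis using False by (simp add: w_def)
    qed
    show "w t * t powr p \<le> M * D t powr (g + p)" if "0 < t" "t \<le> T" for t
    proof (cases "0 \<le> b")
      case True
      have "t powr p \<le> (K * D t powr \<alpha>) powr p" using D[OF that] that p by (intro powr_mono2) auto
      also have "\<dots> = K powr p * D t powr (\<alpha> * p)" using K by (simp add: powr_mult powr_powr)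
      also have "\<dots> \<le> M * D t powr (\<alpha> * p)" by (intro mult_right_mono M_ge) auto
      finally have "D t powr b * t powr p \<le> D t powr b * (M * D t powr (\<alpha> * p))"
        by (intro mult_left_mono) auto
      then show ?thesis using True by (simp add: w_def g_def powr_add mult_ac)
    next
      case False
      have "w t * t powr p = t powr (p + b / \<alpha>)" using False by (simp add: w_def powr_add)
      also have "\<dots> \<le> (K * D t powr \<alpha>) powr (p + b / \<alpha>)"
        using D[OF that] that ap' by (intro powr_mono2) auto
      also have "\<dots> = K powr (p + b / \<alpha>) * D t powr (\<alpha> * (p + b / \<alpha>))"
        using K by (simp add: powr_mult powr_powr)
      also have "\<dots> \<le> M * D t powr (\<alpha> * (p + b / \<alpha>))" by (intro mult_right_mono M_ge) auto
      also have "\<alpha> * (p + b / \<alpha>) = g + p" using \<alpha> by (simp add: g_def field_simps)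
      finally show ?thesis .
    qed
  qed (use p \<kappa> c M T meas D D2 in auto)
  have wT: "w T \<le> T powr b + T powr (b / \<alpha>)"
  proof (cases "0 \<le> b")
    case True
    then have "D T powr b \<le> T powr b" using D[of T] T by (intro powr_mono2) auto
    then show ?thesis using True by (simp add: w_def add_increasing2)
  qed (simp add: w_def)
  have wT0: "0 < w T" using T w by simp
  have "T * w T / (\<kappa> * D T) \<le> C0"
    unfolding C0_def using wT wT0 Dlow[of T] T \<kappa> K
    by (intro frac_le mult_left_mono) (auto intro: less_imp_le)
  then have "(\<integral>\<^sup>+t\<in>{0<..<T}. ennreal (\<bar>f t\<bar> powr p * D t powr b) \<partial>lborel)
      \<le> ennreal (2 * M / c) * (ennreal C0 * (\<integral>\<^sup>+t\<in>{T/2..T}. ennreal (\<bar>f t\<bar> powr p) \<partial>lborel)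
        + ennreal H * (\<integral>\<^sup>+t\<in>{0<..<T}. osc t \<partial>lborel))"
    unfolding H_def by (intro order_trans[OF hardy_inequality] mult_left_mono add_mono mult_right_mono)
       (auto intro: ennreal_leI)
  also have "\<dots> \<le> ennreal (2 * M / c) * (ennreal (C0 + H) * (\<integral>\<^sup>+t\<in>{T/2..T}. ennreal (\<bar>f t\<bar> powr p) \<partial>lborel)
        + ennreal (C0 + H) * (\<integral>\<^sup>+t\<in>{0<..<T}. osc t \<partial>lborel))"
    using C0 H by (intro mult_left_mono add_mono mult_right_mono ennreal_leI) auto
  also have "\<dots> = ennreal C * ((\<integral>\<^sup>+t\<in>{T/2..T}. ennreal (\<bar>f t\<bar> powr p) \<partial>lborel) + (\<integral>\<^sup>+t\<in>{0<..<T}. osc t \<partial>lborel))"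
  proof -
    have "ennreal C = ennreal (2 * M / c) * ennreal (C0 + H)"
      unfolding C_def using M c C0 H by (intro ennreal_mult) auto
    then show ?thesis by (simp add: distrib_left mult.assoc)
  qed
  finally show "(\<integral>\<^sup>+t\<in>{0<..<T}. ennreal (\<bar>f t\<bar> powr p * D t powr b) \<partial>lborel)
      \<le> ennreal C * ((\<integral>\<^sup>+t\<in>{T/2..T}. ennreal (\<bar>f t\<bar> powr p) \<partial>lborel)
        + (\<integral>\<^sup>+t\<in>{0<..<T}. (\<integral>\<^sup>+s\<in>{0<..<T} \<inter> {s. \<bar>s - t\<bar> < 4 * \<kappa> * D t}.
            ennreal (\<bar>f s - f t\<bar> powr p * D t powr (\<alpha> * p + b - p - 1)) \<partial>lborel) \<partial>lborel))"
    unfolding osc_def unfolding g_def by simp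
qed

section \<open>Distance to the boundary\<close>

lemma bdist_nonneg: "0 \<le> bdist \<Omega> x"
  by (simp add: bdist_def infdist_nonneg)

lemma bdist_lipschitz: "\<bar>bdist \<Omega> x - bdist \<Omega> y\<bar> \<le> dist x y"
  unfolding bdist_def by (rule infdist_triangle_abs)

lemma continuous_bdist [continuous_intros]:
  "continuous_on S f \<Longrightarrow> continuous_on S (\<lambda>x. bdist \<Omega> (f x))"
  unfolding bdist_def by (intro continuous_intros)

lemma borel_measurable_bdist [measurable]:
  fixes \<Omega> :: "'a::euclidean_space set"
  shows "bdist \<Omega> \<in> borel_measurable borel"
  by (intro borel_measurable_continuous_onI continuous_intros)

lemma bdist_le_dist:
  fixes \<Omega> :: "'a::euclidean_space set"
  assumes "x \<in> \<Omega>" "y \<notin> \<Omega>"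
  shows "bdist \<Omega> x \<le> dist x y"
proof -
  have "closed_segment x y \<inter> frontier \<Omega> \<noteq> {}"
    using assms by (intro connected_Int_frontier) auto
  then obtain z where z: "z \<in> closed_segment x y" "z \<in> frontier \<Omega>" by auto
  have "bdist \<Omega> x \<le> dist x z" unfolding bdist_def by (rule infdist_le[OF z(2)])
  also have "\<dots> \<le> dist x y" using dist_in_closed_segment[OF z(1)] by (simp add: dist_commute)
  finally show ?thesis .
qed

lemma ball_bdist_subset:
  fixes \<Omega> :: "'a::euclidean_space set"
  assumes "x \<in> \<Omega>" "r \<le> bdist \<Omega> x"
  shows "ball x r \<subseteq> \<Omega>"
  using bdist_le_dist[OF assms(1)] assms(2) by force

lemma frontier_bounded_nonempty:
  fixes \<Omega> :: "'a::euclidean_space set"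
  assumes "bounded \<Omega>" "\<Omega> \<noteq> {}"
  shows "frontier \<Omega> \<noteq> {}"
  using assms not_bounded_UNIV by (auto simp: frontier_eq_empty)

lemma bdist_pos:
  fixes \<Omega> :: "'a::euclidean_space set"
  assumes "open \<Omega>" "bounded \<Omega>" "x \<in> \<Omega>"
  shows "0 < bdist \<Omega> x"
  unfolding bdist_def using assms frontier_bounded_nonempty[of \<Omega>]
  by (intro infdist_pos_not_in_closed) (auto simp: frontier_def interior_open)

lemma bdist_attained:
  fixes \<Omega> :: "'a::euclidean_space set"
  assumes "bounded \<Omega>" "\<Omega> \<noteq> {}"
  obtains z where "z \<in> frontier \<Omega>" "bdist \<Omega> x = dist x z"
  unfolding bdist_def using infdist_attains_inf[of "frontier \<Omega>"] frontier_bounded_nonempty[OF assms]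
  by (metis frontier_closed)

lemma bdist_comparable:
  assumes "dist x y \<le> bdist \<Omega> x / 2"
  shows "bdist \<Omega> x / 2 \<le> bdist \<Omega> y" "bdist \<Omega> y \<le> 2 * bdist \<Omega> x"
  using bdist_lipschitz[of \<Omega> x y] assms bdist_nonneg[of \<Omega> x] by auto

section \<open>Boundary charts\<close>

text \<open>A chart in the original coordinates: \<open>v y\<close> is the depth of \<open>y\<close> below the graph,
  measured along the unit vector \<open>\<nu>\<close>.\<close>

locale holder_chart =
  fixes \<Omega> :: "'a::euclidean_space set" and \<alpha> K R :: real and x0 \<nu> :: 'a and v :: "'a \<Rightarrow> real"
  assumes \<alpha>: "0 < \<alpha>" "\<alpha> \<le> 1" and K: "1 \<le> K" and R: "0 < R" "R \<le> 1"
    and open_\<Omega>: "open \<Omega>" and bounded_\<Omega>: "bounded \<Omega>" and x0: "x0 \<in> frontier \<Omega>"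
    and \<nu>: "norm \<nu> = 1"
    and v_shift: "\<And>y t. v (y + t *\<^sub>R \<nu>) = v y - t"
    and v_holder: "\<And>y z. dist y z \<le> 1 \<Longrightarrow> \<bar>v y - v z\<bar> \<le> K * dist y z powr \<alpha>"
    and \<Omega>_iff: "\<And>y. y \<in> ball x0 R \<Longrightarrow> y \<in> \<Omega> \<longleftrightarrow> 0 < v y"

lemma bounded_holder_domain_chart:
  fixes \<Omega> :: "'a::euclidean_space set"
  assumes \<Omega>: "bounded_holder_domain \<alpha> \<Omega>" and \<alpha>: "0 < \<alpha>" "\<alpha> \<le> 1" and x0: "x0 \<in> frontier \<Omega>"
  obtains K R \<nu> v where "holder_chart \<Omega> \<alpha> K R x0 \<nu> v"
proof -
  obtain T e a b \<phi> K where T: "rigid_motion T" and e: "e \<in> Basis" and box: "T x0 \<in> box a b"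
    and \<phi>: "holder_on \<alpha> K {w. w \<bullet> e = 0} \<phi>"
    and graph: "T ` \<Omega> \<inter> box a b = {z \<in> box a b. z \<bullet> e < \<phi> (z - (z \<bullet> e) *\<^sub>R e)}"
    using \<Omega> x0 unfolding bounded_holder_domain_def by meson
  obtain f c where f: "orthogonal_transformation f" and Tf: "T = (\<lambda>x. f x + c)"
    using T by (auto simp: rigid_motion_def)
  obtain \<nu> where \<nu>: "f \<nu> = e" using orthogonal_transformation_surj[OF f] by (metis surjD)
  have lin: "linear f" using f orthogonal_transformation_linear by blast
  have nf: "norm (f x) = norm x" for x using f by (simp add: orthogonal_transformation_norm)
  have e1: "e \<bullet> e = 1" using e by simp
  define v where "v y = \<phi> (T y - (T y \<bullet> e) *\<^sub>R e) - T y \<bullet> e" for y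
  have T_shift: "T (y + t *\<^sub>R \<nu>) = T y + t *\<^sub>R e" for y t
    using linear_add[OF lin] linear_scale[OF lin] \<nu> by (simp add: Tf)
  have v_shift: "v (y + t *\<^sub>R \<nu>) = v y - t" for y t
    by (simp add: v_def T_shift inner_add_left e1 algebra_simps)
  have v_hold: "\<bar>v y - v z\<bar> \<le> (\<bar>K\<bar> + 1) * dist y z powr \<alpha>" if d1: "dist y z \<le> 1" for y z
  proof -
    define h where "h = f (y - z)"
    have h: "h = T y - T z" by (simp add: h_def Tf linear_diff[OF lin])
    have nh: "norm h = dist y z" by (simp add: h_def nf dist_norm)
    define P where "P x = x - (x \<bullet> e) *\<^sub>R e" for x
    have P0: "P x \<bullet> e = 0" for x by (simp add: P_def inner_diff_left e1)
    have "P (T y) - P (T z) = P h" by (simp add: P_def h inner_diff_left algebra_simps)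
    moreover have "norm (P h) \<le> norm h"
    proof -
      have "(norm (P h))\<^sup>2 = (norm h)\<^sup>2 - (h \<bullet> e)\<^sup>2"
        unfolding power2_norm_eq_inner P_def
        by (simp add: inner_diff_left inner_diff_right e1 inner_commute power2_eq_square)
      then have "(norm (P h))\<^sup>2 \<le> (norm h)\<^sup>2" by simp
      then show ?thesis by (rule power2_le_imp_le) simp
    qed
    ultimately have "dist (P (T y)) (P (T z)) \<le> dist y z" by (simp add: dist_norm nh)
    then have "dist (P (T y)) (P (T z)) powr \<alpha> \<le> dist y z powr \<alpha>"
      using \<alpha> by (intro powr_mono2) auto
    then have "\<bar>K\<bar> * dist (P (T y)) (P (T z)) powr \<alpha> \<le> \<bar>K\<bar> * dist y z powr \<alpha>"
      by (intro mult_left_mono) auto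
    moreover have "\<bar>\<phi> (P (T y)) - \<phi> (P (T z))\<bar> \<le> K * dist (P (T y)) (P (T z)) powr \<alpha>"
      using \<phi> P0 by (auto simp: holder_on_def)
    moreover have "K * dist (P (T y)) (P (T z)) powr \<alpha> \<le> \<bar>K\<bar> * dist (P (T y)) (P (T z)) powr \<alpha>"
      by (intro mult_right_mono) auto
    ultimately have 1: "\<bar>\<phi> (P (T y)) - \<phi> (P (T z))\<bar> \<le> \<bar>K\<bar> * dist y z powr \<alpha>" by linarith
    have "\<bar>T y \<bullet> e - T z \<bullet> e\<bar> \<le> norm h * norm e"
      using Cauchy_Schwarz_ineq2[of h e] by (simp add: h inner_diff_left)
    also have "\<dots> = dist y z" using e by (simp add: nh)
    also have "\<dots> \<le> dist y z powr \<alpha>"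
      using powr_mono'[of \<alpha> 1 "dist y z"] \<alpha> d1 by simp
    finally show ?thesis using 1 by (simp add: v_def P_def algebra_simps abs_if split: if_splits)
  qed
  define P where "P = T -` box a b"
  have "open P" unfolding P_def Tf
    by (intro open_vimage open_box continuous_intros linear_continuous_on linear_linear[THEN iffD2] lin)
  moreover have "x0 \<in> P" using box by (simp add: P_def)
  ultimately obtain R where R: "0 < R" "ball x0 R \<subseteq> P" by (auto simp: open_contains_ball)
  have injT: "inj T" using orthogonal_transformation_inj[OF f] by (auto simp: inj_def Tf)
  have iff: "y \<in> \<Omega> \<longleftrightarrow> 0 < v y" if "y \<in> ball x0 (min R 1)" for y
  proof -
    have "T y \<in> box a b" using that R by (auto simp: P_def)
    then have "T y \<in> T ` \<Omega> \<longleftrightarrow> T y \<bullet> e < \<phi> (T y - (T y \<bullet> e) *\<^sub>R e)" using graph by blast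
    then show ?thesis using injT by (simp add: inj_image_mem_iff v_def)
  qed
  have "norm \<nu> = 1" using nf[of \<nu>] \<nu> e by simp
  then have "holder_chart \<Omega> \<alpha> (\<bar>K\<bar> + 1) (min R 1) x0 \<nu> v"
    using \<Omega> R v_shift v_hold iff \<alpha> x0
    unfolding holder_chart_def bounded_holder_domain_def by auto
  then show ?thesis by (rule that)
qed

context holder_chart
begin

lemma \<Omega>_nonempty: "\<Omega> \<noteq> {}"
  using x0 by auto

lemma continuous_v: "continuous_on S v"
proof -
  have "isCont v y" for y
  proof -
    have "((\<lambda>z. dist z y) \<longlongrightarrow> dist y y) (at y)"
      by (intro tendsto_dist tendsto_ident_at tendsto_const)
    then have "((\<lambda>z. K * dist z y powr \<alpha>) \<longlongrightarrow> K * 0) (at y)"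
      using \<alpha> by (intro tendsto_mult tendsto_const tendsto_zero_powrI[where b = \<alpha>]) auto
    then have 1: "((\<lambda>z. K * dist z y powr \<alpha>) \<longlongrightarrow> 0) (at y)" by simp
    have 2: "\<forall>\<^sub>F z in at y. norm (v z - v y) \<le> K * dist z y powr \<alpha>"
      unfolding eventually_at using v_holder by (intro exI[of _ 1]) auto
    have "((\<lambda>z. v z - v y) \<longlongrightarrow> 0) (at y)"
      by (rule Lim_null_comparison[OF 2 1])
    then show ?thesis unfolding isCont_def by (rule LIM_zero_cancel)
  qed
  then show ?thesis by (simp add: continuous_at_imp_continuous_on)
qed

lemma v_meas [measurable]: "v \<in> borel_measurable borel"
  by (intro borel_measurable_continuous_onI continuous_v)

lemma v_frontier:
  assumes b: "b \<in> frontier \<Omega>" "b \<in> ball x0 R"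
  shows "v b = 0"
proof (rule antisym)
  have "b \<notin> \<Omega>" using b open_\<Omega> by (auto simp: frontier_def interior_open)
  then show "v b \<le> 0" using \<Omega>_iff[OF b(2)] by auto
  have "b \<in> closure (\<Omega> \<inter> ball x0 R)"
    using b open_Int_closure_subset[of "ball x0 R" \<Omega>] by (auto simp: frontier_def Int_commute)
  moreover have "closure (\<Omega> \<inter> ball x0 R) \<subseteq> {y. 0 \<le> v y}"
    using \<Omega>_iff by (intro closure_minimal closed_Collect_le continuous_v continuous_on_const) (force intro: less_imp_le)
  ultimately show "0 \<le> v b" by auto
qed

text \<open>Since x0 is itself a boundary point, the distance is below R/4, and a nearest boundary
  point cannot leave the ball on which the chart describes \<Omega>. This is the reason for working
  in the quarter ball.\<close>

lemma bdist_nearest: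
  assumes "y \<in> ball x0 (R / 4)"
  obtains b where "b \<in> frontier \<Omega>" "bdist \<Omega> y = dist y b" "dist y b < R / 4" "b \<in> ball x0 (R / 2)"
proof -
  obtain b where b: "b \<in> frontier \<Omega>" "bdist \<Omega> y = dist y b"
    using bdist_attained[OF bounded_\<Omega> \<Omega>_nonempty] by blast
  have "bdist \<Omega> y \<le> dist y x0" unfolding bdist_def by (rule infdist_le[OF x0])
  then have 1: "dist y b < R / 4" using assms b by (simp add: dist_commute)
  moreover have "dist x0 b \<le> dist x0 y + dist y b" by (rule dist_triangle)
  then have "b \<in> ball x0 (R / 2)" using 1 assms by simp
  ultimately show ?thesis using b that by blast
qed

lemma v_le_bdist:
  assumes "y \<in> ball x0 (R / 4)"
  shows "v y \<le> K * bdist \<Omega> y powr \<alpha>"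
proof -
  obtain b where b: "b \<in> frontier \<Omega>" "bdist \<Omega> y = dist y b" "dist y b < R / 4" "b \<in> ball x0 (R / 2)"
    using bdist_nearest[OF assms] .
  have "v b = 0" using b R by (intro v_frontier) auto
  moreover have "\<bar>v y - v b\<bar> \<le> K * dist y b powr \<alpha>" using b R by (intro v_holder) auto
  ultimately show ?thesis using b by simp
qed

text \<open>Moving by v y along \<nu> reaches depth 0, a point outside \<Omega>; the bound on v y
  keeps that point inside the chart.\<close>

lemma bdist_le_v:
  assumes "y \<in> \<Omega>" "y \<in> ball x0 (R / 4)" "v y \<le> R / 4"
  shows "bdist \<Omega> y \<le> v y"
proof -
  have vy: "0 < v y" using \<Omega>_iff[of y] assms R by auto
  define z where "z = y + v y *\<^sub>R \<nu>"
  have dz: "dist y z = v y" using vy \<nu> by (simp add: z_def dist_norm)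
  have "dist x0 z \<le> dist x0 y + dist y z" by (rule dist_triangle)
  then have "z \<in> ball x0 R" using assms dz R by simp
  moreover have "v z = 0" by (simp add: z_def v_shift)
  ultimately have "z \<notin> \<Omega>" using \<Omega>_iff[of z] by simp
  then show ?thesis using bdist_le_dist[OF assms(1)] dz by metis
qed

text \<open>Near \<open>x0\<close> the domain is invariant under translation by \<open>- t *\<^sub>R \<nu>\<close>, hence so is
  every ball contained in it.\<close>

lemma bdist_mono_shift:
  assumes y: "y \<in> \<Omega>" "y \<in> ball x0 (R / 4)" and z: "z \<in> ball x0 (R / 4)"
    and yz: "y = z + t *\<^sub>R \<nu>" "0 \<le> t"
  shows "bdist \<Omega> y \<le> bdist \<Omega> z"
proof -
  obtain b where b: "b \<in> frontier \<Omega>" "bdist \<Omega> z = dist z b" "dist z b < R / 4" "b \<in> ball x0 (R / 2)"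
    using bdist_nearest[OF z] .
  have vb: "v b = 0" using b R by (intro v_frontier) auto
  have t: "t < R / 2"
  proof -
    have "t = dist y z" using yz \<nu> by (simp add: dist_norm)
    also have "\<dots> \<le> dist x0 y + dist x0 z" by (simp add: dist_triangle3)
    finally show ?thesis using y z by simp
  qed
  \<comment> \<open>The boundary point nearest to z, moved along with z to y, has depth -t and
    therefore lies outside \<Omega>; its distance to y is that of b to z. The bound t < R/2 keeps it
    in the chart.\<close>
  define b' where "b' = b + t *\<^sub>R \<nu>"
  have "dist x0 b' \<le> dist x0 b + dist b b'" by (rule dist_triangle)
  also have "dist b b' = t" using \<nu> yz by (simp add: b'_def dist_norm)
  finally have "b' \<in> ball x0 R" using b t by simp
  moreover have "v b' \<le> 0" using vb yz by (simp add: b'_def v_shift)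
  ultimately have "b' \<notin> \<Omega>" using \<Omega>_iff[of b'] by simp
  then have "bdist \<Omega> y \<le> dist y b'" by (rule bdist_le_dist[OF y(1)])
  also have "dist y b' = dist z b" by (simp add: yz b'_def)
  finally show ?thesis using b by simp
qed

end

lemma nn_integral_lborel_reflect:
  fixes f :: "real \<Rightarrow> ennreal"
  assumes "f \<in> borel_measurable borel"
  shows "(\<integral>\<^sup>+x. f (c - x) \<partial>lborel) = (\<integral>\<^sup>+x. f x \<partial>lborel)"
  using nn_integral_real_affine[of f "-1" c] assms by simp

section \<open>Integration along vertical lines\<close>

context holder_chart
begin

text \<open>The union of all lines parallel to \<nu> that meet the ball. A ball would not be
  invariant under translation along \<nu>, on which the Fubini argument for columns rests.\<close>

definition tube :: "real \<Rightarrow> 'a set" where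
  "tube \<rho> = {y. \<exists>s. y + s *\<^sub>R \<nu> \<in> ball x0 \<rho>}"

lemma tube_shift: "y + t *\<^sub>R \<nu> \<in> tube \<rho> \<longleftrightarrow> y \<in> tube \<rho>"
proof -
  have "y + t *\<^sub>R \<nu> + s *\<^sub>R \<nu> = y + (t + s) *\<^sub>R \<nu>"
    and "y + s *\<^sub>R \<nu> = y + t *\<^sub>R \<nu> + (s - t) *\<^sub>R \<nu>" for s
    by (simp_all add: algebra_simps)
  then show ?thesis unfolding tube_def mem_Collect_eq by metis
qed

lemma ball_subset_tube: "ball x0 \<rho> \<subseteq> tube \<rho>"
  unfolding tube_def by (auto intro!: exI[of _ 0])

lemma tube_borel [measurable]: "tube \<rho> \<in> sets borel"
proof -
  have "tube \<rho> = (\<Union>s. (\<lambda>y. y + s *\<^sub>R \<nu>) -` ball x0 \<rho>)" by (auto simp: tube_def)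
  then have "open (tube \<rho>)"
    by (auto intro!: open_vimage continuous_intros)
  then show ?thesis by simp
qed

text \<open>The line through y meets the \<rho>-ball at a point whose depth is at most K
  \<rho>^\<alpha> \<le> T in absolute value. Depth changes at unit speed along the line, so y is at
  most 2 T away from that point, and 2 T + \<rho> < R/4.\<close>

lemma tube_depth_in_ball:
  assumes y: "y \<in> tube \<rho>" "0 \<le> v y" "v y \<le> T"
    and \<rho>: "0 < \<rho>" "\<rho> \<le> R / 16" and T: "T \<le> R / 16" and \<rho>T: "K * \<rho> powr \<alpha> \<le> T"
  shows "y \<in> ball x0 (R / 4)"
proof -
  obtain s where s: "y + s *\<^sub>R \<nu> \<in> ball x0 \<rho>" using y by (auto simp: tube_def)
  have d: "dist (y + s *\<^sub>R \<nu>) x0 < \<rho>" using s by (simp add: dist_commute)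
  have "v x0 = 0" using x0 R by (intro v_frontier) auto
  then have "\<bar>v (y + s *\<^sub>R \<nu>)\<bar> \<le> K * dist (y + s *\<^sub>R \<nu>) x0 powr \<alpha>"
    using v_holder[of "y + s *\<^sub>R \<nu>" x0] d \<rho> R by simp
  also have "\<dots> \<le> K * \<rho> powr \<alpha>" using d \<alpha> K by (intro mult_left_mono powr_mono2) auto
  finally have "\<bar>v y - s\<bar> \<le> T" using \<rho>T by (simp add: v_shift)
  then have "\<bar>s\<bar> \<le> 2 * T" using y by linarith
  moreover have "dist x0 y \<le> dist x0 (y + s *\<^sub>R \<nu>) + dist (y + s *\<^sub>R \<nu>) y" by (rule dist_triangle)
  moreover have "dist (y + s *\<^sub>R \<nu>) y = \<bar>s\<bar>" using \<nu> by (simp add: dist_norm)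
  ultimately show ?thesis using d \<rho> T R by (simp add: dist_commute)
qed

text \<open>Fubini along the lines \<open>x + span \<nu>\<close>, parametrised by depth; each line is counted once for
  every point of it of depth in \<open>(0, S)\<close>.\<close>

lemma column_integral:
  assumes [measurable]: "g \<in> borel_measurable borel" "J \<in> sets borel" and S: "0 \<le> S"
  shows "(\<integral>\<^sup>+x\<in>{x \<in> tube \<rho>. 0 < v x \<and> v x < S}. (\<integral>\<^sup>+t\<in>J. g (x + (v x - t) *\<^sub>R \<nu>) \<partial>lborel) \<partial>lborel)
    = ennreal S * (\<integral>\<^sup>+y\<in>{y \<in> tube \<rho>. v y \<in> J}. g y \<partial>lborel)"
proof -
  define Q where "Q = (indicator (tube \<rho>) :: 'a \<Rightarrow> ennreal)"
  define \<zeta> where "\<zeta> = (indicator {0<..<S} :: real \<Rightarrow> ennreal)"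
  define \<psi> where "\<psi> = (indicator J :: real \<Rightarrow> ennreal)"
  have [measurable]: "Q \<in> borel_measurable borel" "\<zeta> \<in> borel_measurable borel" "\<psi> \<in> borel_measurable borel"
    by (auto simp: Q_def \<zeta>_def \<psi>_def)
  have Q_shift: "Q (y + t *\<^sub>R \<nu>) = Q y" for y t by (simp add: Q_def indicator_def tube_shift)
  have "(\<integral>\<^sup>+x\<in>{x \<in> tube \<rho>. 0 < v x \<and> v x < S}. (\<integral>\<^sup>+t\<in>J. g (x + (v x - t) *\<^sub>R \<nu>) \<partial>lborel) \<partial>lborel)
      = (\<integral>\<^sup>+x. (\<integral>\<^sup>+r. Q x * \<zeta> (v x) * \<psi> (v x - r) * g (x + r *\<^sub>R \<nu>) \<partial>lborel) \<partial>lborel)"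
  proof (intro nn_integral_cong)
    fix x
    have "(\<integral>\<^sup>+t\<in>J. g (x + (v x - t) *\<^sub>R \<nu>) \<partial>lborel) = (\<integral>\<^sup>+r. \<psi> (v x - r) * g (x + r *\<^sub>R \<nu>) \<partial>lborel)"
      using nn_integral_lborel_reflect[of "\<lambda>r. \<psi> (v x - r) * g (x + r *\<^sub>R \<nu>)" "v x"]
      by (simp add: \<psi>_def mult.commute)
    then have "(\<integral>\<^sup>+r. Q x * \<zeta> (v x) * \<psi> (v x - r) * g (x + r *\<^sub>R \<nu>) \<partial>lborel)
        = Q x * \<zeta> (v x) * (\<integral>\<^sup>+t\<in>J. g (x + (v x - t) *\<^sub>R \<nu>) \<partial>lborel)"
      by (simp add: nn_integral_cmult mult.assoc)
    moreover have "indicator {x \<in> tube \<rho>. 0 < v x \<and> v x < S} x = Q x * \<zeta> (v x)"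
      by (auto simp: Q_def \<zeta>_def indicator_def)
    ultimately show "(\<integral>\<^sup>+t\<in>J. g (x + (v x - t) *\<^sub>R \<nu>) \<partial>lborel) * indicator {x \<in> tube \<rho>. 0 < v x \<and> v x < S} x
        = (\<integral>\<^sup>+r. Q x * \<zeta> (v x) * \<psi> (v x - r) * g (x + r *\<^sub>R \<nu>) \<partial>lborel)"
      by (simp add: mult.commute)
  qed
  \<comment> \<open>For fixed r substitute y = x + r \<nu>: the tube is unchanged and v x becomes v
    y + r. After exchanging back, only the indicator of (0, S) at v y + r depends on r, and its
    integral is the length S.\<close>
  also have "\<dots> = (\<integral>\<^sup>+r. (\<integral>\<^sup>+x. Q x * \<zeta> (v x) * \<psi> (v x - r) * g (x + r *\<^sub>R \<nu>) \<partial>lborel) \<partial>lborel)"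
    by (rule nn_integral_lborel_swap) measurable
  also have "\<dots> = (\<integral>\<^sup>+r. (\<integral>\<^sup>+y. Q y * \<zeta> (v y + r) * \<psi> (v y) * g y \<partial>lborel) \<partial>lborel)"
  proof (rule nn_integral_cong)
    fix r
    have "(\<integral>\<^sup>+x. Q x * \<zeta> (v x) * \<psi> (v x - r) * g (x + r *\<^sub>R \<nu>) \<partial>lborel)
        = (\<integral>\<^sup>+x. (\<lambda>y. Q y * \<zeta> (v y + r) * \<psi> (v y) * g y) (x + r *\<^sub>R \<nu>) \<partial>lborel)"
      by (intro nn_integral_cong) (simp add: Q_shift v_shift)
    also have "\<dots> = (\<integral>\<^sup>+y. Q y * \<zeta> (v y + r) * \<psi> (v y) * g y \<partial>lborel)"
      by (rule nn_integral_lborel_translate) measurable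
    finally show "(\<integral>\<^sup>+x. Q x * \<zeta> (v x) * \<psi> (v x - r) * g (x + r *\<^sub>R \<nu>) \<partial>lborel)
        = (\<integral>\<^sup>+y. Q y * \<zeta> (v y + r) * \<psi> (v y) * g y \<partial>lborel)" .
  qed
  also have "\<dots> = (\<integral>\<^sup>+y. (\<integral>\<^sup>+r. Q y * \<zeta> (v y + r) * \<psi> (v y) * g y \<partial>lborel) \<partial>lborel)"
    by (rule nn_integral_lborel_swap) measurable
  also have "\<dots> = (\<integral>\<^sup>+y. ennreal S * (Q y * \<psi> (v y) * g y) \<partial>lborel)"
  proof (intro nn_integral_cong)
    fix y
    have "(\<integral>\<^sup>+r. \<zeta> (v y + r) \<partial>lborel) = (\<integral>\<^sup>+r. \<zeta> r \<partial>lborel)"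
      using nn_integral_lborel_translate[of \<zeta> "v y"] by (simp add: add.commute)
    also have "\<dots> = ennreal S" using S by (simp add: \<zeta>_def)
    finally have "(\<integral>\<^sup>+r. (Q y * \<psi> (v y) * g y) * \<zeta> (v y + r) \<partial>lborel) = (Q y * \<psi> (v y) * g y) * ennreal S"
      by (simp add: nn_integral_cmult)
    then show "(\<integral>\<^sup>+r. Q y * \<zeta> (v y + r) * \<psi> (v y) * g y \<partial>lborel) = ennreal S * (Q y * \<psi> (v y) * g y)"
      by (simp add: mult_ac)
  qed
  also have "\<dots> = ennreal S * (\<integral>\<^sup>+y. Q y * \<psi> (v y) * g y \<partial>lborel)"
    by (simp add: nn_integral_cmult)
  also have "(\<integral>\<^sup>+y. Q y * \<psi> (v y) * g y \<partial>lborel) = (\<integral>\<^sup>+y\<in>{y \<in> tube \<rho>. v y \<in> J}. g y \<partial>lborel)"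
    by (intro nn_integral_cong) (auto simp: Q_def \<psi>_def indicator_def)
  finally show ?thesis .
qed

text \<open>The line inequality holds on every line of the tube with the same constant, so it may be
  integrated over the columns; the multiplicity T appears on both sides and cancels. Points of depth
  at least T/2 satisfy d \<ge> \<eta> by t \<le> K d^\<alpha>, which makes the starting term an
  interior one.\<close>

lemma near_boundary_estimate:
  fixes p b \<kappa> :: real
  assumes p: "1 < p" and b: "- \<alpha> < b" and \<kappa>: "0 < \<kappa>" "\<kappa> \<le> 1/2"
  obtains \<rho> \<eta> C :: real where "0 < \<rho>" "0 < \<eta>" "0 \<le> C"
    "\<And>u. u \<in> borel_measurable borel \<Longrightarrow>
      (\<integral>\<^sup>+y\<in>\<Omega> \<inter> ball x0 \<rho>. ennreal (\<bar>u y\<bar> powr p * bdist \<Omega> y powr b) \<partial>lborel)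
      \<le> ennreal C * ((\<integral>\<^sup>+y\<in>{y \<in> \<Omega>. \<eta> \<le> bdist \<Omega> y}. ennreal (\<bar>u y\<bar> powr p) \<partial>lborel)
        + (\<integral>\<^sup>+y\<in>\<Omega>. (\<integral>\<^sup>+r\<in>{r. \<bar>r\<bar> < 4 * \<kappa> * bdist \<Omega> y}.
            ennreal (\<bar>u (y + r *\<^sub>R \<nu>) - u y\<bar> powr p * bdist \<Omega> y powr (\<alpha> * p + b - p - 1)) \<partial>lborel) \<partial>lborel))"
proof -
  define T where "T = R / 16"
  have T: "0 < T" using R by (simp add: T_def)
  \<comment> \<open>Small enough for K \<rho>^\<alpha> \<le> T: then \<Omega> \<inter>
    \<open>ball x0 \<rho>\<close> contains only depths below T, and the tube at depths up to T stays
    in the quarter ball.\<close>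
  define \<rho> where "\<rho> = min (R / 16) ((T / K) powr (1 / \<alpha>))"
  have \<rho>: "0 < \<rho>" "\<rho> \<le> R / 16" using R T K by (auto simp: \<rho>_def)
  have "\<rho> powr \<alpha> \<le> ((T / K) powr (1 / \<alpha>)) powr \<alpha>"
    using \<rho> \<alpha> by (intro powr_mono2) (auto simp: \<rho>_def)
  then have \<rho>T: "K * \<rho> powr \<alpha> \<le> T" using \<alpha> K T by (simp add: powr_powr field_simps)
  define \<eta> where "\<eta> = (T / 2 / K) powr (1 / \<alpha>)"
  have \<eta>: "0 < \<eta>" using T K by (simp add: \<eta>_def)
  obtain C where C: "0 \<le> C" and line: "\<And>D f. D \<in> borel_measurable borel \<Longrightarrow> f \<in> borel_measurable borel \<Longrightarrow>
      (\<And>t. 0 < t \<Longrightarrow> t \<le> T \<Longrightarrow> 0 < D t \<and> D t \<le> t \<and> t \<le> K * D t powr \<alpha>) \<Longrightarrow>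
      (\<And>s t. 0 < s \<Longrightarrow> s \<le> t \<Longrightarrow> t \<le> T \<Longrightarrow> D s \<le> D t \<and> D t - D s \<le> t - s) \<Longrightarrow>
      (\<integral>\<^sup>+t\<in>{0<..<T}. ennreal (\<bar>f t\<bar> powr p * D t powr b) \<partial>lborel)
      \<le> ennreal C * ((\<integral>\<^sup>+t\<in>{T/2..T}. ennreal (\<bar>f t\<bar> powr p) \<partial>lborel)
        + (\<integral>\<^sup>+t\<in>{0<..<T}. (\<integral>\<^sup>+s\<in>{0<..<T} \<inter> {s. \<bar>s - t\<bar> < 4 * \<kappa> * D t}.
            ennreal (\<bar>f s - f t\<bar> powr p * D t powr (\<alpha> * p + b - p - 1)) \<partial>lborel) \<partial>lborel))"
    using hardy_line_holder[OF p \<alpha> b K \<kappa> T] by blast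
  have near: "y \<in> \<Omega> \<and> y \<in> ball x0 (R / 4)" if "y \<in> tube \<rho>" "0 < v y" "v y \<le> T" for y
  proof -
    have "y \<in> ball x0 (R / 4)"
      using tube_depth_in_ball[OF that(1) _ that(3) \<rho> _ \<rho>T] that by (simp add: T_def)
    then show ?thesis using \<Omega>_iff[of y] that R by auto
  qed
  show ?thesis
  proof (rule that[OF \<rho>(1) \<eta> C])
    fix u :: "'a \<Rightarrow> real" assume [measurable]: "u \<in> borel_measurable borel"
    define e where "e = \<alpha> * p + b - p - 1"
    define g0 where "g0 y = ennreal (\<bar>u y\<bar> powr p * bdist \<Omega> y powr b)" for y
    define g1 where "g1 y = ennreal (\<bar>u y\<bar> powr p)" for y
    define g2 where "g2 y = (\<integral>\<^sup>+r\<in>{r. \<bar>r\<bar> < 4 * \<kappa> * bdist \<Omega> y}.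
            ennreal (\<bar>u (y + r *\<^sub>R \<nu>) - u y\<bar> powr p * bdist \<Omega> y powr e) \<partial>lborel)" for y
    have [measurable]: "g0 \<in> borel_measurable borel" "g1 \<in> borel_measurable borel"
      unfolding g0_def g1_def by measurable
    have [measurable]: "g2 \<in> borel_measurable borel"
      unfolding g2_def indicator_def by measurable
    \<comment> \<open>The point of depth t on the vertical line through x.\<close>
    define F where "F x t = x + (v x - t) *\<^sub>R \<nu>" for x t
    have [measurable]: "F x \<in> borel_measurable borel" for x
      unfolding F_def by measurable
    have [measurable]: "case_prod F \<in> borel_measurable (borel \<Otimes>\<^sub>M borel)"
      unfolding F_def by measurable
    have column: "(\<integral>\<^sup>+t\<in>{0<..<T}. g0 (F x t) \<partial>lborel)
        \<le> ennreal C * ((\<integral>\<^sup>+t\<in>{T/2..T}. g1 (F x t) \<partial>lborel) + (\<integral>\<^sup>+t\<in>{0<..<T}. g2 (F x t) \<partial>lborel))"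
      if x: "x \<in> tube \<rho>" for x
    proof -
      have vF: "v (F x t) = t" for t using v_shift[of x "v x - t"] by (simp add: F_def)
      have tF: "F x t \<in> tube \<rho>" for t using x by (simp add: F_def tube_shift)
      have FF: "F x s = F x t + (t - s) *\<^sub>R \<nu>" for s t by (simp add: F_def algebra_simps)
      have nF: "F x t \<in> \<Omega>" "F x t \<in> ball x0 (R / 4)" if "0 < t" "t \<le> T" for t
        using near[OF tF, of t] that by (auto simp: vF)
      have dF: "dist (F x t) (F x s) = \<bar>t - s\<bar>" for s t
        using \<nu> by (subst FF[of s t]) (simp add: dist_norm)
      have "(\<integral>\<^sup>+t\<in>{0<..<T}. ennreal (\<bar>u (F x t)\<bar> powr p * bdist \<Omega> (F x t) powr b) \<partial>lborel)
        \<le> ennreal C * ((\<integral>\<^sup>+t\<in>{T/2..T}. ennreal (\<bar>u (F x t)\<bar> powr p) \<partial>lborel)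
        + (\<integral>\<^sup>+t\<in>{0<..<T}. (\<integral>\<^sup>+s\<in>{0<..<T} \<inter> {s. \<bar>s - t\<bar> < 4 * \<kappa> * bdist \<Omega> (F x t)}.
            ennreal (\<bar>u (F x s) - u (F x t)\<bar> powr p * bdist \<Omega> (F x t) powr (\<alpha> * p + b - p - 1)) \<partial>lborel) \<partial>lborel))"
      proof (rule line)
        show "0 < bdist \<Omega> (F x t) \<and> bdist \<Omega> (F x t) \<le> t \<and> t \<le> K * bdist \<Omega> (F x t) powr \<alpha>"
          if t: "0 < t" "t \<le> T" for t
          using bdist_pos[OF open_\<Omega> bounded_\<Omega> nF(1)[OF t]] bdist_le_v[OF nF[OF t]] v_le_bdist[OF nF(2)[OF t]]
            t R by (simp add: vF T_def)
        show "bdist \<Omega> (F x s) \<le> bdist \<Omega> (F x t) \<and> bdist \<Omega> (F x t) - bdist \<Omega> (F x s) \<le> t - s"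
          if st: "0 < s" "s \<le> t" "t \<le> T" for s t
          using bdist_mono_shift[OF nF(1) nF(2) nF(2) FF, of s t] bdist_lipschitz[of \<Omega> "F x t" "F x s"] st
          by (simp add: dF)
      qed measurable
      also have "\<dots> \<le> ennreal C * ((\<integral>\<^sup>+t\<in>{T/2..T}. g1 (F x t) \<partial>lborel) + (\<integral>\<^sup>+t\<in>{0<..<T}. g2 (F x t) \<partial>lborel))"
      proof (intro mult_left_mono add_mono nn_integral_mono mult_right_mono)
        fix t
        define k where "k r = ennreal (\<bar>u (F x t + r *\<^sub>R \<nu>) - u (F x t)\<bar> powr p * bdist \<Omega> (F x t) powr e)
          * indicator {r. \<bar>r\<bar> < 4 * \<kappa> * bdist \<Omega> (F x t)} r" for r
        have [measurable]: "k \<in> borel_measurable borel" unfolding k_def by measurable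
        have "(\<integral>\<^sup>+s\<in>{0<..<T} \<inter> {s. \<bar>s - t\<bar> < 4 * \<kappa> * bdist \<Omega> (F x t)}.
            ennreal (\<bar>u (F x s) - u (F x t)\<bar> powr p * bdist \<Omega> (F x t) powr (\<alpha> * p + b - p - 1)) \<partial>lborel)
          \<le> (\<integral>\<^sup>+s. k (t - s) \<partial>lborel)"
          unfolding k_def FF[of _ t, symmetric] e_def
          by (intro nn_integral_mono mult_left_mono) (auto simp: indicator_def abs_minus_commute)
        also have "\<dots> = (\<integral>\<^sup>+r. k r \<partial>lborel)" by (rule nn_integral_lborel_reflect) measurable
        also have "\<dots> = g2 (F x t)" by (simp add: k_def g2_def)
        finally show "(\<integral>\<^sup>+s\<in>{0<..<T} \<inter> {s. \<bar>s - t\<bar> < 4 * \<kappa> * bdist \<Omega> (F x t)}.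
            ennreal (\<bar>u (F x s) - u (F x t)\<bar> powr p * bdist \<Omega> (F x t) powr (\<alpha> * p + b - p - 1)) \<partial>lborel)
          \<le> g2 (F x t)" .
      qed (auto simp: g1_def)
      finally show ?thesis by (simp add: g0_def)
    qed
    define V where "V = {y \<in> tube \<rho>. 0 < v y \<and> v y < T}"
    have [measurable]: "V \<in> sets borel" unfolding V_def by measurable
    have V_eq: "{y \<in> tube \<rho>. v y \<in> {0<..<T}} = V" by (auto simp: V_def)
    have "ennreal T * (\<integral>\<^sup>+y\<in>V. g0 y \<partial>lborel) = (\<integral>\<^sup>+x\<in>V. (\<integral>\<^sup>+t\<in>{0<..<T}. g0 (F x t) \<partial>lborel) \<partial>lborel)"
      using column_integral[of g0 "{0<..<T}" T \<rho>] T unfolding V_eq F_def by (simp add: V_def)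
    also have "\<dots> \<le> (\<integral>\<^sup>+x. ennreal C * ((\<integral>\<^sup>+t\<in>{T/2..T}. g1 (F x t) \<partial>lborel) * indicator V x
        + (\<integral>\<^sup>+t\<in>{0<..<T}. g2 (F x t) \<partial>lborel) * indicator V x) \<partial>lborel)"
      using column by (intro nn_integral_mono) (auto simp: V_def indicator_def)
    also have "\<dots> = ennreal C * ((\<integral>\<^sup>+x\<in>V. (\<integral>\<^sup>+t\<in>{T/2..T}. g1 (F x t) \<partial>lborel) \<partial>lborel)
        + (\<integral>\<^sup>+x\<in>V. (\<integral>\<^sup>+t\<in>{0<..<T}. g2 (F x t) \<partial>lborel) \<partial>lborel))"
      by (subst nn_integral_cmult) (auto simp: nn_integral_add)
    also have "(\<integral>\<^sup>+x\<in>V. (\<integral>\<^sup>+t\<in>{T/2..T}. g1 (F x t) \<partial>lborel) \<partial>lborel)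
        = ennreal T * (\<integral>\<^sup>+y\<in>{y \<in> tube \<rho>. v y \<in> {T/2..T}}. g1 y \<partial>lborel)"
      using column_integral[of g1 "{T/2..T}" T \<rho>] T unfolding F_def by (simp add: V_def)
    also have "(\<integral>\<^sup>+x\<in>V. (\<integral>\<^sup>+t\<in>{0<..<T}. g2 (F x t) \<partial>lborel) \<partial>lborel) = ennreal T * (\<integral>\<^sup>+y\<in>V. g2 y \<partial>lborel)"
      using column_integral[of g2 "{0<..<T}" T \<rho>] T unfolding V_eq F_def by (simp add: V_def)
    finally have "ennreal T * (\<integral>\<^sup>+y\<in>V. g0 y \<partial>lborel)
      \<le> ennreal T * (ennreal C * ((\<integral>\<^sup>+y\<in>{y \<in> tube \<rho>. v y \<in> {T/2..T}}. g1 y \<partial>lborel) + (\<integral>\<^sup>+y\<in>V. g2 y \<partial>lborel)))"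
      by (simp add: distrib_left mult_ac)
    then have main: "(\<integral>\<^sup>+y\<in>V. g0 y \<partial>lborel)
      \<le> ennreal C * ((\<integral>\<^sup>+y\<in>{y \<in> tube \<rho>. v y \<in> {T/2..T}}. g1 y \<partial>lborel) + (\<integral>\<^sup>+y\<in>V. g2 y \<partial>lborel))"
      using T by (simp add: ennreal_mult_le_mult_iff)
    have "\<Omega> \<inter> ball x0 \<rho> \<subseteq> V"
    proof
      fix y assume y: "y \<in> \<Omega> \<inter> ball x0 \<rho>"
      have "v x0 = 0" using x0 R by (intro v_frontier) auto
      then have "\<bar>v y\<bar> \<le> K * dist y x0 powr \<alpha>"
        using v_holder[of y x0] y \<rho> R by (simp add: dist_commute)
      also have "\<dots> < K * \<rho> powr \<alpha>"
        using y \<alpha> K by (intro mult_strict_left_mono powr_less_mono2) (auto simp: dist_commute)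
      finally have "v y < T" using \<rho>T by simp
      moreover have "0 < v y" using \<Omega>_iff[of y] y \<rho> R by auto
      ultimately show "y \<in> V" using y ball_subset_tube[of \<rho>] by (auto simp: V_def)
    qed
    then have "(\<integral>\<^sup>+y\<in>\<Omega> \<inter> ball x0 \<rho>. g0 y \<partial>lborel) \<le> (\<integral>\<^sup>+y\<in>V. g0 y \<partial>lborel)"
      by (intro nn_integral_mono mult_left_mono) (auto simp: indicator_def)
    also note main
    also have "(\<integral>\<^sup>+y\<in>{y \<in> tube \<rho>. v y \<in> {T/2..T}}. g1 y \<partial>lborel)
        \<le> (\<integral>\<^sup>+y\<in>{y \<in> \<Omega>. \<eta> \<le> bdist \<Omega> y}. g1 y \<partial>lborel)"
    proof -
      have "y \<in> \<Omega> \<and> \<eta> \<le> bdist \<Omega> y" if "y \<in> tube \<rho>" "T/2 \<le> v y" "v y \<le> T" for y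
      proof -
        have y: "y \<in> \<Omega>" "y \<in> ball x0 (R / 4)" using near[of y] that T by auto
        have "\<eta> \<le> bdist \<Omega> y" unfolding \<eta>_def
          using v_le_bdist[OF y(2)] that T \<alpha> K bdist_nonneg by (intro holder_lower_bound) auto
        then show ?thesis using y by simp
      qed
      then show ?thesis by (intro nn_integral_mono mult_left_mono) (auto simp: indicator_def)
    qed
    also have "(\<integral>\<^sup>+y\<in>V. g2 y \<partial>lborel) \<le> (\<integral>\<^sup>+y\<in>\<Omega>. g2 y \<partial>lborel)"
      using near by (intro nn_integral_mono mult_left_mono) (auto simp: indicator_def V_def)
    finally show "(\<integral>\<^sup>+y\<in>\<Omega> \<inter> ball x0 \<rho>. ennreal (\<bar>u y\<bar> powr p * bdist \<Omega> y powr b) \<partial>lborel)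
      \<le> ennreal C * ((\<integral>\<^sup>+y\<in>{y \<in> \<Omega>. \<eta> \<le> bdist \<Omega> y}. ennreal (\<bar>u y\<bar> powr p) \<partial>lborel)
        + (\<integral>\<^sup>+y\<in>\<Omega>. (\<integral>\<^sup>+r\<in>{r. \<bar>r\<bar> < 4 * \<kappa> * bdist \<Omega> y}.
            ennreal (\<bar>u (y + r *\<^sub>R \<nu>) - u y\<bar> powr p * bdist \<Omega> y powr (\<alpha> * p + b - p - 1)) \<partial>lborel) \<partial>lborel))"
      by (simp add: g0_def g1_def g2_def e_def add_mono mult_left_mono)
  qed
qed

end

section \<open>The scale-invariant energy\<close>

text \<open>The integrand of the fractional energy at the single scale \<tau> d(x): the singular
  factor |y - x|^(-n-sp) is replaced by d(x)^(-n-sp), which is absorbed in the exponent q.\<close>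

definition osc_density ::
    "real \<Rightarrow> real \<Rightarrow> real \<Rightarrow> 'a::euclidean_space set \<Rightarrow> ('a \<Rightarrow> real) \<Rightarrow> 'a \<Rightarrow> ennreal" where
  "osc_density p q \<tau> \<Omega> u x =
     (\<integral>\<^sup>+y\<in>ball x (\<tau> * bdist \<Omega> x). ennreal (\<bar>u y - u x\<bar> powr p * bdist \<Omega> x powr q) \<partial>lborel)"

definition osc_energy ::
    "real \<Rightarrow> real \<Rightarrow> real \<Rightarrow> 'a::euclidean_space set \<Rightarrow> ('a \<Rightarrow> real) \<Rightarrow> ennreal" where
  "osc_energy p q \<tau> \<Omega> u = (\<integral>\<^sup>+x\<in>\<Omega>. osc_density p q \<tau> \<Omega> u x \<partial>lborel)"

lemma nn_integral_moving_ball_measurable: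
  fixes h :: "'a::euclidean_space \<Rightarrow> 'a \<Rightarrow> ennreal"
  assumes [measurable]: "case_prod h \<in> borel_measurable (borel \<Otimes>\<^sub>M borel)" "R \<in> borel_measurable borel"
  shows "(\<lambda>x. \<integral>\<^sup>+y\<in>ball x (R x). h x y \<partial>lborel) \<in> borel_measurable borel"
  unfolding indicator_def mem_ball by measurable

lemma osc_density_measurable [measurable]:
  assumes [measurable]: "u \<in> borel_measurable borel"
  shows "osc_density p q \<tau> \<Omega> u \<in> borel_measurable borel"
  unfolding osc_density_def by (intro nn_integral_moving_ball_measurable) measurable

lemma osc_density_eq:
  assumes [measurable]: "u \<in> borel_measurable borel"
  shows "osc_density p q \<tau> \<Omega> u x =
    ennreal (bdist \<Omega> x powr q) * (\<integral>\<^sup>+y\<in>ball x (\<tau> * bdist \<Omega> x). ennreal (\<bar>u y - u x\<bar> powr p) \<partial>lborel)"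
proof -
  have [measurable]: "ball x (\<tau> * bdist \<Omega> x) \<in> sets borel" by simp
  have "osc_density p q \<tau> \<Omega> u x = (\<integral>\<^sup>+y. ennreal (bdist \<Omega> x powr q) *
      (ennreal (\<bar>u y - u x\<bar> powr p) * indicator (ball x (\<tau> * bdist \<Omega> x)) y) \<partial>lborel)"
    unfolding osc_density_def
    by (intro nn_integral_cong) (simp add: ennreal_mult mult_ac)
  also have "\<dots> = ennreal (bdist \<Omega> x powr q) *
      (\<integral>\<^sup>+y\<in>ball x (\<tau> * bdist \<Omega> x). ennreal (\<bar>u y - u x\<bar> powr p) \<partial>lborel)"
    by (rule nn_integral_cmult) auto
  finally show ?thesis .
qed

text \<open>Split a - b at the value u z and average over z in A; a single difference is thereby
  traded for integrals over A, as needed for passing from points or lines to balls.\<close>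

lemma powr_diff_le_average:
  fixes u :: "'a::euclidean_space \<Rightarrow> real"
  assumes p: "1 < p" and [measurable]: "u \<in> borel_measurable borel" "A \<in> sets borel"
  shows "ennreal (\<bar>a - b\<bar> powr p) * emeasure lborel A
    \<le> ennreal (2 powr p) * ((\<integral>\<^sup>+z\<in>A. ennreal (\<bar>a - u z\<bar> powr p) \<partial>lborel) + (\<integral>\<^sup>+z\<in>A. ennreal (\<bar>u z - b\<bar> powr p) \<partial>lborel))"
proof -
  have "ennreal (\<bar>a - b\<bar> powr p) * emeasure lborel A = (\<integral>\<^sup>+z\<in>A. ennreal (\<bar>a - b\<bar> powr p) \<partial>lborel)"
    using assms by (subst nn_integral_cmult_indicator) auto
  also have "\<dots> \<le> (\<integral>\<^sup>+z. ennreal (2 powr p) * (ennreal (\<bar>a - u z\<bar> powr p) * indicator A z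
      + ennreal (\<bar>u z - b\<bar> powr p) * indicator A z) \<partial>lborel)"
  proof (intro nn_integral_mono)
    fix z
    have "ennreal (\<bar>a - b\<bar> powr p) \<le> ennreal (2 powr p * (\<bar>a - u z\<bar> powr p + \<bar>u z - b\<bar> powr p))"
      using powr_abs_add_le[OF p, of "a - u z" "u z - b"] by (intro ennreal_leI) simp
    then show "ennreal (\<bar>a - b\<bar> powr p) * indicator A z
      \<le> ennreal (2 powr p) * (ennreal (\<bar>a - u z\<bar> powr p) * indicator A z + ennreal (\<bar>u z - b\<bar> powr p) * indicator A z)"
      by (auto simp: indicator_def ennreal_mult)
  qed
  also have "\<dots> = ennreal (2 powr p) * ((\<integral>\<^sup>+z\<in>A. ennreal (\<bar>a - u z\<bar> powr p) \<partial>lborel) + (\<integral>\<^sup>+z\<in>A. ennreal (\<bar>u z - b\<bar> powr p) \<partial>lborel))"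
    by (simp add: nn_integral_cmult nn_integral_add)
  finally show ?thesis .
qed

text \<open>Differences in one direction are averaged over z in a ball of radius \<kappa> d(y)
  around y, splitting them at u z. Dividing by the volume turns d^(q+n-1) into d^(q-1), and
  integrating r over an interval of length comparable to d restores d^q. The half that belongs to y
  + r \<nu> is reduced to the one at y by a translation for each fixed r.\<close>

lemma directional_energy_le:
  fixes \<Omega> :: "'a::euclidean_space set" and p q \<tau> \<kappa> :: real and \<nu> :: 'a
  assumes \<Omega>: "open \<Omega>" "bounded \<Omega>" and p: "1 < p" and \<kappa>: "0 < \<kappa>" "\<kappa> \<le> 1/2" "4 * \<kappa> \<le> \<tau>" and \<nu>: "norm \<nu> = 1"
  obtains C :: real where "0 \<le> C"
    "\<And>u. u \<in> borel_measurable borel \<Longrightarrow>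
      (\<integral>\<^sup>+y\<in>\<Omega>. (\<integral>\<^sup>+r\<in>{r. \<bar>r\<bar> < \<kappa> * bdist \<Omega> y}.
          ennreal (\<bar>u (y + r *\<^sub>R \<nu>) - u y\<bar> powr p * bdist \<Omega> y powr (q + real DIM('a) - 1)) \<partial>lborel) \<partial>lborel)
      \<le> ennreal C * osc_energy p q \<tau> \<Omega> u"
proof -
  define N where "N = real DIM('a)"
  define V where "V = unit_ball_vol N * \<kappa> powr N"
  have V: "0 < V" using \<kappa> by (simp add: V_def N_def)
  define c0 where "c0 = 2 powr p / V"
  define c1 where "c1 = 2 powr \<bar>q - 1\<bar>"
  define C where "C = 2 * c0 * c1 * (4 * \<kappa>)"
  have c0: "0 \<le> c0" and c1: "0 \<le> c1" using V by (simp_all add: c0_def c1_def)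
  have c1_ge: "1 \<le> c1" by (simp add: c1_def ge_one_powr_ge_zero)
  show ?thesis
  proof (rule that)
    show "0 \<le> C" using c0 c1 \<kappa> by (simp add: C_def)
    fix u :: "'a \<Rightarrow> real" assume u [measurable]: "u \<in> borel_measurable borel"
    have [measurable]: "\<Omega> \<in> sets borel" using \<Omega> by simp
    define L where "L y = (\<integral>\<^sup>+z\<in>ball y (\<tau> * bdist \<Omega> y). ennreal (\<bar>u z - u y\<bar> powr p) \<partial>lborel)" for y
    have [measurable]: "L \<in> borel_measurable borel"
      unfolding L_def by (intro nn_integral_moving_ball_measurable) measurable
    \<comment> \<open>A common majorant of both halves, as a function of base point and shift. The
      condition |r| < 2 \<kappa> d instead of |r| < \<kappa> d, and the factor c1, keep it valid at
      the shifted point, where the distance to the boundary may differ by a factor 2.\<close>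
    define m where "m y r = ennreal c1 * (indicator \<Omega> y * indicator {r. \<bar>r\<bar> < 2 * \<kappa> * bdist \<Omega> y} r
        * ennreal (bdist \<Omega> y powr (q - 1)) * L y)" for y and r :: real
    have m_meas [measurable]: "case_prod m \<in> borel_measurable (borel \<Otimes>\<^sub>M borel)"
    proof -
      have "(\<lambda>(y, r). ennreal c1 * (indicator \<Omega> y * (if \<bar>r\<bar> < 2 * \<kappa> * bdist \<Omega> y then 1 else 0)
        * ennreal (bdist \<Omega> y powr (q - 1)) * L y)) \<in> borel_measurable (borel \<Otimes>\<^sub>M (borel :: real measure))"
        by measurable
      then show ?thesis by (simp add: m_def[abs_def] indicator_def)
    qed
    have pt: "ennreal (\<bar>u (y + r *\<^sub>R \<nu>) - u y\<bar> powr p * bdist \<Omega> y powr (q + N - 1))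
        \<le> ennreal c0 * (m (y + r *\<^sub>R \<nu>) r + m y r)"
      if y: "y \<in> \<Omega>" and r: "\<bar>r\<bar> < \<kappa> * bdist \<Omega> y" for y r
    proof -
      define d y' where "d = bdist \<Omega> y" and "y' = y + r *\<^sub>R \<nu>"
      have d: "0 < d" using bdist_pos[OF \<Omega> y] by (simp add: d_def)
      have dyy: "dist y y' = \<bar>r\<bar>" using \<nu> by (simp add: y'_def dist_norm)
      have "\<kappa> * d \<le> 1/2 * d" using \<kappa> d by (intro mult_right_mono) auto
      then have r2: "\<bar>r\<bar> < d / 2" using r by (simp add: d_def)
      have y': "y' \<in> \<Omega>" using ball_bdist_subset[OF y, of d] r2 dyy d by (auto simp: d_def)
      have d': "d / 2 \<le> bdist \<Omega> y'" "bdist \<Omega> y' \<le> 2 * d"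
        using bdist_comparable[of y y' \<Omega>] dyy r2 by (auto simp: d_def)
      have "\<kappa> * d \<le> \<kappa> * (2 * bdist \<Omega> y')" using d' \<kappa> by (intro mult_left_mono) auto
      then have kd: "\<kappa> * d \<le> 2 * \<kappa> * bdist \<Omega> y'" by simp
      define B where "B = ball y (\<kappa> * d)"
      have [measurable]: "B \<in> sets borel" by (simp add: B_def)
      have emB: "emeasure lborel B = ennreal (V * d powr N)"
        using d \<kappa> by (simp add: B_def emeasure_ball V_def N_def powr_realpow power_mult_distrib mult.assoc)
      have "\<bar>u y' - u y\<bar> powr p * d powr (q + N - 1) = 1 / V * d powr (q - 1) * (\<bar>u y' - u y\<bar> powr p * (V * d powr N))"
        using V d by (simp add: powr_add powr_diff field_simps)
      then have "ennreal (\<bar>u y' - u y\<bar> powr p * d powr (q + N - 1))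
          = ennreal (1 / V * d powr (q - 1)) * (ennreal (\<bar>u y' - u y\<bar> powr p) * emeasure lborel B)"
        using V by (simp add: emB flip: ennreal_mult)
      also have "\<dots> \<le> ennreal (1 / V * d powr (q - 1)) * (ennreal (2 powr p) *
          ((\<integral>\<^sup>+z\<in>B. ennreal (\<bar>u y' - u z\<bar> powr p) \<partial>lborel) + (\<integral>\<^sup>+z\<in>B. ennreal (\<bar>u z - u y\<bar> powr p) \<partial>lborel)))"
        by (intro mult_left_mono powr_diff_le_average p) measurable
      also have "\<dots> = ennreal c0 * (ennreal (d powr (q - 1)) * (\<integral>\<^sup>+z\<in>B. ennreal (\<bar>u y' - u z\<bar> powr p) \<partial>lborel)
          + ennreal (d powr (q - 1)) * (\<integral>\<^sup>+z\<in>B. ennreal (\<bar>u z - u y\<bar> powr p) \<partial>lborel))"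
      proof -
        have "ennreal c0 * ennreal (d powr (q - 1)) = ennreal (1 / V * d powr (q - 1)) * ennreal (2 powr p)"
          using V by (simp add: c0_def mult_ac flip: ennreal_mult)
        then show ?thesis by (simp add: distrib_left mult.assoc[symmetric])
      qed
      also have "\<dots> \<le> ennreal c0 * (m y' r + m y r)"
      proof (intro mult_left_mono add_mono)
        have Bsub: "B \<subseteq> ball y' (\<tau> * bdist \<Omega> y')"
        proof
          fix z assume "z \<in> B"
          then have "dist y z < \<kappa> * d" by (simp add: B_def)
          moreover have "dist y' z \<le> dist y y' + dist y z" by (rule dist_triangle3)
          moreover have "\<bar>r\<bar> < \<kappa> * d" using r by (simp add: d_def)
          ultimately have "dist y' z < 4 * \<kappa> * bdist \<Omega> y'" using dyy kd by simp
          also have "\<dots> \<le> \<tau> * bdist \<Omega> y'" using \<kappa> bdist_nonneg by (intro mult_right_mono) auto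
          finally show "z \<in> ball y' (\<tau> * bdist \<Omega> y')" by simp
        qed
        have "(\<integral>\<^sup>+z\<in>B. ennreal (\<bar>u y' - u z\<bar> powr p) \<partial>lborel) \<le> L y'"
          unfolding L_def using Bsub
          by (intro nn_integral_mono) (auto simp: indicator_def abs_minus_commute)
        moreover have "ennreal (d powr (q - 1)) \<le> ennreal c1 * ennreal (bdist \<Omega> y' powr (q - 1))"
          unfolding c1_def using powr_comparable[OF d d'] by (simp add: ennreal_leI flip: ennreal_mult)
        moreover have "\<bar>r\<bar> < 2 * \<kappa> * bdist \<Omega> y'" using r kd by (simp add: d_def)
        ultimately show "ennreal (d powr (q - 1)) * (\<integral>\<^sup>+z\<in>B. ennreal (\<bar>u y' - u z\<bar> powr p) \<partial>lborel) \<le> m y' r"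
          using y' by (simp add: m_def mult.assoc[symmetric] mult_mono)
        have "\<kappa> * d \<le> \<tau> * d" using \<kappa> d by (intro mult_right_mono) auto
        then have "(\<integral>\<^sup>+z\<in>B. ennreal (\<bar>u z - u y\<bar> powr p) \<partial>lborel) \<le> L y"
          unfolding L_def B_def
          by (intro nn_integral_mono) (auto simp: indicator_def d_def)
        moreover have "1 * d powr (q - 1) \<le> c1 * d powr (q - 1)"
          using c1_ge by (intro mult_right_mono) auto
        then have "ennreal (d powr (q - 1)) \<le> ennreal c1 * ennreal (bdist \<Omega> y powr (q - 1))"
          using c1 by (simp add: ennreal_leI d_def flip: ennreal_mult)
        moreover have "\<bar>r\<bar> < 2 * \<kappa> * bdist \<Omega> y" using r d \<kappa> by (simp add: d_def)
        ultimately show "ennreal (d powr (q - 1)) * (\<integral>\<^sup>+z\<in>B. ennreal (\<bar>u z - u y\<bar> powr p) \<partial>lborel) \<le> m y r"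
          using y by (simp add: m_def mult.assoc[symmetric] mult_mono)
      qed simp
      finally show ?thesis by (simp add: d_def y'_def)
    qed
    have shift: "(\<integral>\<^sup>+y. (\<integral>\<^sup>+r. m (y + r *\<^sub>R \<nu>) r \<partial>lborel) \<partial>lborel) = (\<integral>\<^sup>+y. (\<integral>\<^sup>+r. m y r \<partial>lborel) \<partial>lborel)"
    proof -
      have "(\<integral>\<^sup>+y. (\<integral>\<^sup>+r. m (y + r *\<^sub>R \<nu>) r \<partial>lborel) \<partial>lborel) = (\<integral>\<^sup>+r. (\<integral>\<^sup>+y. m (y + r *\<^sub>R \<nu>) r \<partial>lborel) \<partial>lborel)"
        by (rule nn_integral_lborel_swap) measurable
      also have "\<dots> = (\<integral>\<^sup>+r. (\<integral>\<^sup>+y. m y r \<partial>lborel) \<partial>lborel)"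
        by (rule nn_integral_cong, rule nn_integral_lborel_translate) measurable
      also have "\<dots> = (\<integral>\<^sup>+y. (\<integral>\<^sup>+r. m y r \<partial>lborel) \<partial>lborel)"
        by (rule nn_integral_lborel_swap[symmetric]) measurable
      finally show ?thesis .
    qed
    have m_int: "(\<integral>\<^sup>+r. m y r \<partial>lborel) = ennreal (c1 * (4 * \<kappa>)) * (osc_density p q \<tau> \<Omega> u y * indicator \<Omega> y)" for y
    proof (cases "y \<in> \<Omega>")
      case True
      define d where "d = bdist \<Omega> y"
      have d: "0 < d" using bdist_pos[OF \<Omega> True] by (simp add: d_def)
      have "{r. \<bar>r\<bar> < 2 * \<kappa> * d} = {- (2 * \<kappa> * d)<..<2 * \<kappa> * d}" by auto
      then have em: "emeasure lborel {r. \<bar>r\<bar> < 2 * \<kappa> * d} = ennreal (4 * \<kappa> * d)" using d \<kappa> by simp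
      have "(\<integral>\<^sup>+r. m y r \<partial>lborel) = (\<integral>\<^sup>+r. ennreal c1 * (ennreal (d powr (q - 1)) * L y)
          * indicator {r. \<bar>r\<bar> < 2 * \<kappa> * d} r \<partial>lborel)"
        using True by (intro nn_integral_cong) (simp add: m_def d_def mult_ac)
      also have "\<dots> = ennreal c1 * (ennreal (d powr (q - 1)) * L y) * ennreal (4 * \<kappa> * d)"
        by (subst nn_integral_cmult_indicator) (auto simp: em)
      also have "\<dots> = ennreal (c1 * (4 * \<kappa>)) * (ennreal d * ennreal (d powr (q - 1))) * L y"
        using c1 d \<kappa> by (simp add: ennreal_mult mult_ac)
      also have "ennreal d * ennreal (d powr (q - 1)) = ennreal (d powr q)"
        using d by (simp add: powr_diff flip: ennreal_mult)
      finally show ?thesis using True by (simp add: osc_density_eq L_def d_def mult.assoc)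
    qed (simp add: m_def)
    have "(\<integral>\<^sup>+y\<in>\<Omega>. (\<integral>\<^sup>+r\<in>{r. \<bar>r\<bar> < \<kappa> * bdist \<Omega> y}.
          ennreal (\<bar>u (y + r *\<^sub>R \<nu>) - u y\<bar> powr p * bdist \<Omega> y powr (q + N - 1)) \<partial>lborel) \<partial>lborel)
      \<le> (\<integral>\<^sup>+y. (\<integral>\<^sup>+r. ennreal c0 * (m (y + r *\<^sub>R \<nu>) r + m y r) \<partial>lborel) \<partial>lborel)"
    proof (rule nn_integral_mono)
      fix y
      show "(\<integral>\<^sup>+r\<in>{r. \<bar>r\<bar> < \<kappa> * bdist \<Omega> y}.
          ennreal (\<bar>u (y + r *\<^sub>R \<nu>) - u y\<bar> powr p * bdist \<Omega> y powr (q + N - 1)) \<partial>lborel) * indicator \<Omega> y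
        \<le> (\<integral>\<^sup>+r. ennreal c0 * (m (y + r *\<^sub>R \<nu>) r + m y r) \<partial>lborel)"
      proof (cases "y \<in> \<Omega>")
        case True
        then show ?thesis using pt
          by (auto intro!: nn_integral_mono simp: indicator_def)
      qed simp
    qed
    also have "\<dots> = (\<integral>\<^sup>+y. ennreal c0 * ((\<integral>\<^sup>+r. m (y + r *\<^sub>R \<nu>) r \<partial>lborel) + (\<integral>\<^sup>+r. m y r \<partial>lborel)) \<partial>lborel)"
      by (simp add: nn_integral_cmult nn_integral_add)
    also have "\<dots> = ennreal c0 * ((\<integral>\<^sup>+y. (\<integral>\<^sup>+r. m (y + r *\<^sub>R \<nu>) r \<partial>lborel) \<partial>lborel)
        + (\<integral>\<^sup>+y. (\<integral>\<^sup>+r. m y r \<partial>lborel) \<partial>lborel))"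
      by (simp add: nn_integral_cmult nn_integral_add)
    also have "\<dots> = ennreal c0 * (2 * (ennreal (c1 * (4 * \<kappa>)) * osc_energy p q \<tau> \<Omega> u))"
      unfolding shift m_int osc_energy_def mult_2
      by (simp add: nn_integral_cmult)
    also have "\<dots> = ennreal C * osc_energy p q \<tau> \<Omega> u"
    proof -
      have "ennreal C = ennreal c0 * (ennreal 2 * ennreal (c1 * (4 * \<kappa>)))"
        using c0 c1 \<kappa> by (simp add: C_def ennreal_mult mult_ac)
      then show ?thesis by (simp add: mult.assoc)
    qed
    finally show "(\<integral>\<^sup>+y\<in>\<Omega>. (\<integral>\<^sup>+r\<in>{r. \<bar>r\<bar> < \<kappa> * bdist \<Omega> y}.
          ennreal (\<bar>u (y + r *\<^sub>R \<nu>) - u y\<bar> powr p * bdist \<Omega> y powr (q + real DIM('a) - 1)) \<partial>lborel) \<partial>lborel)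
      \<le> ennreal C * osc_energy p q \<tau> \<Omega> u"
      by (simp add: N_def)
  qed
qed

section \<open>The interior Poincare inequality\<close>

lemma nn_integral_finite_cover:
  assumes [measurable]: "h \<in> borel_measurable M" and "finite I" "\<And>i. i \<in> I \<Longrightarrow> B i \<in> sets M"
    and sub: "A \<subseteq> (\<Union>i\<in>I. B i)"
  shows "(\<integral>\<^sup>+x\<in>A. h x \<partial>M) \<le> (\<Sum>i\<in>I. \<integral>\<^sup>+x\<in>B i. h x \<partial>M)"
proof -
  have "(\<integral>\<^sup>+x\<in>A. h x \<partial>M) \<le> (\<integral>\<^sup>+x. (\<Sum>i\<in>I. h x * indicator (B i) x) \<partial>M)"
  proof (intro nn_integral_mono)
    fix x
    show "h x * indicator A x \<le> (\<Sum>i\<in>I. h x * indicator (B i) x)"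
    proof (cases "x \<in> A")
      case True
      then obtain i where i: "i \<in> I" "x \<in> B i" using sub by auto
      then have "h x * indicator A x \<le> h x * indicator (B i) x" using True by simp
      also have "\<dots> \<le> (\<Sum>i\<in>I. h x * indicator (B i) x)" by (rule member_le_sum) (use i assms in auto)
      finally show ?thesis .
    qed simp
  qed
  also have "\<dots> = (\<Sum>i\<in>I. \<integral>\<^sup>+x\<in>B i. h x \<partial>M)"
    using assms by (intro nn_integral_sum) auto
  finally show ?thesis .
qed

text \<open>If the inequality failed throughout B, integration would give 2 X \<le> X with X finite,
  hence X = 0. Then \<phi> vanishes almost everywhere on B although it is positive there, so B would
  be null. Applied to the deviation from u w, it finds a constant among the values of u.\<close>

lemma exists_le_average:
  fixes X :: ennreal
  assumes [measurable]: "\<phi> \<in> borel_measurable M" "B \<in> sets M"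
    and em: "emeasure M B \<noteq> 0" "emeasure M B \<noteq> \<infinity>" and X: "(\<integral>\<^sup>+x\<in>B. \<phi> x \<partial>M) \<le> X"
  obtains w where "w \<in> B" "\<phi> w * emeasure M B \<le> 2 * X"
proof (rule ccontr)
  assume "\<not> thesis"
  then have less: "2 * X < \<phi> w * emeasure M B" if "w \<in> B" for w using that \<open>\<And>w. _ \<Longrightarrow> _ \<Longrightarrow> thesis\<close> by (meson not_le)
  have "B \<noteq> {}" using em by auto
  then have Xtop: "X \<noteq> top" using less by (auto simp: ennreal_mult_top)
  have "2 * X * emeasure M B = (\<integral>\<^sup>+x\<in>B. 2 * X \<partial>M)"
    by (subst nn_integral_cmult_indicator) auto
  also have "\<dots> \<le> (\<integral>\<^sup>+x. emeasure M B * (\<phi> x * indicator B x) \<partial>M)"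
    using less by (intro nn_integral_mono) (auto simp: indicator_def mult.commute intro: less_imp_le)
  also have "\<dots> = emeasure M B * (\<integral>\<^sup>+x\<in>B. \<phi> x \<partial>M)" by (simp add: nn_integral_cmult)
  also have "\<dots> \<le> emeasure M B * X" by (intro mult_left_mono X) simp
  finally have "emeasure M B * (2 * X) \<le> emeasure M B * X" by (simp add: mult.commute)
  then have "2 * X \<le> X" using em by (simp add: ennreal_mult_le_mult_iff)
  then have "X = 0" using Xtop by (cases X) (auto simp flip: ennreal_numeral ennreal_mult)
  then have "(\<integral>\<^sup>+x. \<phi> x * indicator B x \<partial>M) = 0" using X by simp
  then have "AE x in M. \<phi> x * indicator B x = 0" by (simp add: nn_integral_0_iff_AE)
  then have "AE x in M. x \<notin> B"
  proof eventually_elim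
    case (elim x)
    then show ?case using less[of x] \<open>X = 0\<close> by auto
  qed
  then have "emeasure M B = 0" using AE_iff_measurable[of B M "\<lambda>x. x \<notin> B"] sets.sets_into_space[of B M] by auto
  then show False using em by simp
qed

lemma emeasure_lborel_ball:
  fixes x :: "'a::euclidean_space"
  shows "emeasure lborel (ball x r) = ennreal (measure lborel (ball x r))"
  using emeasure_lborel_ball_finite[of x r] by (intro emeasure_eq_ennreal_measure) auto

text \<open>Two points of B are closer than \<tau> d(x)/2, and d(x)/2 \<le> d(z) for z in B; hence B
  lies in the ball used by \<open>osc_density\<close> at z. The constant accounts for the weight
  d(z)^q, comparable to d(x)^q on B.\<close>

lemma ball_energy_le:
  fixes \<Omega> :: "'a::euclidean_space set"
  assumes \<Omega>: "open \<Omega>" "bounded \<Omega>" and \<tau>: "0 < \<tau>" "\<tau> \<le> 1" and x: "x \<in> \<Omega>"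
  defines "B \<equiv> ball x (\<tau> * bdist \<Omega> x / 4)"
  obtains C :: real where "0 \<le> C"
    "\<And>u. u \<in> borel_measurable borel \<Longrightarrow>
      (\<integral>\<^sup>+z\<in>B. (\<integral>\<^sup>+w\<in>B. ennreal (\<bar>u w - u z\<bar> powr p) \<partial>lborel) \<partial>lborel) \<le> ennreal C * osc_energy p q \<tau> \<Omega> u"
proof -
  define d where "d = bdist \<Omega> x"
  have d: "0 < d" using bdist_pos[OF \<Omega> x] by (simp add: d_def)
  define C where "C = 2 powr \<bar>q\<bar> * d powr (- q)"
  have ld: "\<tau> * d \<le> d" using \<tau> d by (simp add: mult_le_cancel_right1)
  have [measurable]: "\<Omega> \<in> sets borel" using \<Omega> by simp
  show ?thesis
  proof (rule that)
    show "0 \<le> C" by (simp add: C_def)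
    fix u :: "'a \<Rightarrow> real" assume u [measurable]: "u \<in> borel_measurable borel"
    have "(\<integral>\<^sup>+z\<in>B. (\<integral>\<^sup>+w\<in>B. ennreal (\<bar>u w - u z\<bar> powr p) \<partial>lborel) \<partial>lborel)
        \<le> (\<integral>\<^sup>+z. ennreal C * (osc_density p q \<tau> \<Omega> u z * indicator \<Omega> z) \<partial>lborel)"
    proof (rule nn_integral_mono)
      fix z
      show "(\<integral>\<^sup>+w\<in>B. ennreal (\<bar>u w - u z\<bar> powr p) \<partial>lborel) * indicator B z
        \<le> ennreal C * (osc_density p q \<tau> \<Omega> u z * indicator \<Omega> z)"
      proof (cases "z \<in> B")
        case True
        then have xz: "dist x z < \<tau> * d / 4" by (simp add: B_def d_def)
        have "dist x z < d" using xz ld d by linarith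
        then have z: "z \<in> \<Omega>" using ball_bdist_subset[OF x, of d] by (auto simp: d_def)
        have dz: "d / 2 \<le> bdist \<Omega> z" "bdist \<Omega> z \<le> 2 * d"
          using bdist_comparable[of x z \<Omega>] xz ld d by (auto simp: d_def)
        have "B \<subseteq> ball z (\<tau> * bdist \<Omega> z)"
        proof
          fix w assume "w \<in> B"
          then have "dist x w < \<tau> * d / 4" by (simp add: B_def d_def)
          moreover have "dist z w \<le> dist x z + dist x w" by (rule dist_triangle3)
          ultimately have "dist z w < \<tau> * (d / 2)" using xz by simp
          also have "\<dots> \<le> \<tau> * bdist \<Omega> z" using \<tau> dz by (intro mult_left_mono) auto
          finally show "w \<in> ball z (\<tau> * bdist \<Omega> z)" by simp
        qed
        then have le: "(\<integral>\<^sup>+w\<in>B. ennreal (\<bar>u w - u z\<bar> powr p) \<partial>lborel)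
            \<le> (\<integral>\<^sup>+w\<in>ball z (\<tau> * bdist \<Omega> z). ennreal (\<bar>u w - u z\<bar> powr p) \<partial>lborel)"
          by (intro nn_integral_mono) (auto simp: indicator_def)
        have "1 = d powr q * d powr (- q)" using d by (simp flip: powr_add)
        also have "\<dots> \<le> 2 powr \<bar>q\<bar> * bdist \<Omega> z powr q * d powr (- q)"
          using powr_comparable[OF d dz, of q] by (intro mult_right_mono) auto
        finally have "1 \<le> C * bdist \<Omega> z powr q" by (simp add: C_def mult_ac)
        then have "1 \<le> ennreal C * ennreal (bdist \<Omega> z powr q)"
          by (simp add: C_def flip: ennreal_mult ennreal_1 add: ennreal_leI)
        then have "1 * (\<integral>\<^sup>+w\<in>B. ennreal (\<bar>u w - u z\<bar> powr p) \<partial>lborel)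
            \<le> ennreal C * ennreal (bdist \<Omega> z powr q) * (\<integral>\<^sup>+w\<in>ball z (\<tau> * bdist \<Omega> z). ennreal (\<bar>u w - u z\<bar> powr p) \<partial>lborel)"
          by (rule mult_mono[OF _ le]) auto
        then show ?thesis using True z by (simp add: osc_density_eq mult.assoc)
      qed simp
    qed
    also have "\<dots> = ennreal C * osc_energy p q \<tau> \<Omega> u"
      unfolding osc_energy_def by (rule nn_integral_cmult) measurable
    finally show "(\<integral>\<^sup>+z\<in>B. (\<integral>\<^sup>+w\<in>B. ennreal (\<bar>u w - u z\<bar> powr p) \<partial>lborel) \<partial>lborel) \<le> ennreal C * osc_energy p q \<tau> \<Omega> u" .
  qed
qed

text \<open>The set \<open>B\<close> is a fixed reference ball. The property spreads along chains of balls, hence over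
  the connected set \<open>\<Omega>\<close>.\<close>

definition controlled ::
    "real \<Rightarrow> real \<Rightarrow> real \<Rightarrow> 'a::euclidean_space set \<Rightarrow> 'a set \<Rightarrow> 'a \<Rightarrow> bool" where
  "controlled p q \<tau> \<Omega> B x \<longleftrightarrow> (\<exists>\<rho>>0. \<exists>C\<ge>0. \<forall>u c. u \<in> borel_measurable borel \<longrightarrow>
     (\<integral>\<^sup>+z\<in>ball x \<rho>. ennreal (\<bar>u z - c\<bar> powr p) \<partial>lborel)
       \<le> ennreal C * ((\<integral>\<^sup>+z\<in>B. ennreal (\<bar>u z - c\<bar> powr p) \<partial>lborel) + osc_energy p q \<tau> \<Omega> u))"

text \<open>Take a ball A around y inside both the controlled ball and the ball B around x. For z in
  B split u z - c at u w and average over w in A: the first part is the double integral over B, the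
  second is controlled at y. The constant involves the volumes of A and B, but neither u nor
  c.\<close>

lemma controlled_step:
  fixes \<Omega> :: "'a::euclidean_space set"
  assumes \<Omega>: "open \<Omega>" "bounded \<Omega>" and p: "1 < p" and \<tau>: "0 < \<tau>" "\<tau> \<le> 1" and x: "x \<in> \<Omega>"
    and y: "y \<in> ball x (\<tau> * bdist \<Omega> x / 4)" and ctrl: "controlled p q \<tau> \<Omega> B0 y"
  shows "controlled p q \<tau> \<Omega> B0 x"
proof -
  define R where "R = \<tau> * bdist \<Omega> x / 4"
  have R: "0 < R" using bdist_pos[OF \<Omega> x] \<tau> by (simp add: R_def)
  define B where "B = ball x R"
  obtain C1 where C1: "0 \<le> C1" and en: "\<And>u. u \<in> borel_measurable borel \<Longrightarrow>
      (\<integral>\<^sup>+z\<in>B. (\<integral>\<^sup>+w\<in>B. ennreal (\<bar>u w - u z\<bar> powr p) \<partial>lborel) \<partial>lborel) \<le> ennreal C1 * osc_energy p q \<tau> \<Omega> u"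
    unfolding B_def R_def using ball_energy_le[OF \<Omega> \<tau> x] by blast
  obtain \<rho> C2 where \<rho>: "0 < \<rho>" and C2: "0 \<le> C2" and yc: "\<And>u c. u \<in> borel_measurable borel \<Longrightarrow>
     (\<integral>\<^sup>+z\<in>ball y \<rho>. ennreal (\<bar>u z - c\<bar> powr p) \<partial>lborel)
       \<le> ennreal C2 * ((\<integral>\<^sup>+z\<in>B0. ennreal (\<bar>u z - c\<bar> powr p) \<partial>lborel) + osc_energy p q \<tau> \<Omega> u)"
    using ctrl unfolding controlled_def by blast
  define r where "r = min \<rho> (R - dist x y)"
  have r: "0 < r" using \<rho> y by (simp add: r_def R_def)
  define A where "A = ball y r"
  have Ay: "A \<subseteq> ball y \<rho>" by (auto simp: A_def r_def)
  have AB: "A \<subseteq> B"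
  proof
    fix w assume "w \<in> A"
    then have "dist y w < R - dist x y" by (simp add: A_def r_def)
    then show "w \<in> B" using dist_triangle[of x w y] by (simp add: B_def)
  qed
  define a where "a = measure lborel A"
  have a: "0 < a" using r by (simp add: a_def A_def)
  have emA: "emeasure lborel A = ennreal a"
    unfolding a_def A_def by (rule emeasure_lborel_ball)
  define b where "b = measure lborel B"
  have emB: "emeasure lborel B = ennreal b"
    unfolding b_def B_def by (rule emeasure_lborel_ball)
  have b: "0 \<le> b" by (simp add: b_def)
  have [measurable]: "A \<in> sets borel" "B \<in> sets borel" by (auto simp: A_def B_def)
  define C where "C = 2 powr p / a * (C1 + b * C2)"
  have "\<forall>u c. u \<in> borel_measurable borel \<longrightarrow>
     (\<integral>\<^sup>+z\<in>ball x R. ennreal (\<bar>u z - c\<bar> powr p) \<partial>lborel)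
       \<le> ennreal C * ((\<integral>\<^sup>+z\<in>B0. ennreal (\<bar>u z - c\<bar> powr p) \<partial>lborel) + osc_energy p q \<tau> \<Omega> u)"
  proof (intro allI impI)
    fix u :: "'a \<Rightarrow> real" and c :: real
    assume u [measurable]: "u \<in> borel_measurable borel"
    define E where "E = osc_energy p q \<tau> \<Omega> u"
    define I where "I = (\<integral>\<^sup>+z\<in>A. ennreal (\<bar>u z - c\<bar> powr p) \<partial>lborel)"
    define J where "J = (\<integral>\<^sup>+z\<in>B0. ennreal (\<bar>u z - c\<bar> powr p) \<partial>lborel)"
    have IJ: "I \<le> ennreal C2 * (J + E)"
    proof -
      have "I \<le> (\<integral>\<^sup>+z\<in>ball y \<rho>. ennreal (\<bar>u z - c\<bar> powr p) \<partial>lborel)"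
        unfolding I_def using Ay by (intro nn_integral_mono) (auto simp: indicator_def)
      also note yc[OF u]
      finally show ?thesis by (simp add: J_def E_def)
    qed
    have pt: "ennreal (\<bar>u z - c\<bar> powr p) * indicator B z \<le> ennreal (2 powr p / a) *
       ((\<integral>\<^sup>+w\<in>B. ennreal (\<bar>u w - u z\<bar> powr p) \<partial>lborel) * indicator B z + I * indicator B z)" for z
    proof (cases "z \<in> B")
      case True
      have "ennreal (\<bar>u z - c\<bar> powr p) = ennreal (1 / a) * (ennreal (\<bar>u z - c\<bar> powr p) * emeasure lborel A)"
        using a by (simp add: emA flip: ennreal_mult)
      also have "\<dots> \<le> ennreal (1 / a) * (ennreal (2 powr p) *
          ((\<integral>\<^sup>+w\<in>A. ennreal (\<bar>u z - u w\<bar> powr p) \<partial>lborel) + (\<integral>\<^sup>+w\<in>A. ennreal (\<bar>u w - c\<bar> powr p) \<partial>lborel)))"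
        by (intro mult_left_mono powr_diff_le_average p) measurable
      also have "\<dots> \<le> ennreal (1 / a) * (ennreal (2 powr p) *
          ((\<integral>\<^sup>+w\<in>B. ennreal (\<bar>u w - u z\<bar> powr p) \<partial>lborel) + I))"
        unfolding I_def using AB
        by (intro mult_left_mono add_mono nn_integral_mono) (auto simp: indicator_def abs_minus_commute)
      also have "\<dots> = ennreal (2 powr p / a) * ((\<integral>\<^sup>+w\<in>B. ennreal (\<bar>u w - u z\<bar> powr p) \<partial>lborel) + I)"
        using a by (simp add: mult.assoc[symmetric] flip: ennreal_mult)
      finally show ?thesis using True by simp
    qed simp
    have "(\<integral>\<^sup>+z\<in>B. ennreal (\<bar>u z - c\<bar> powr p) \<partial>lborel) \<le> (\<integral>\<^sup>+z. ennreal (2 powr p / a) *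
       ((\<integral>\<^sup>+w\<in>B. ennreal (\<bar>u w - u z\<bar> powr p) \<partial>lborel) * indicator B z + I * indicator B z) \<partial>lborel)"
      using pt by (intro nn_integral_mono) auto
    also have "\<dots> = ennreal (2 powr p / a) *
       ((\<integral>\<^sup>+z\<in>B. (\<integral>\<^sup>+w\<in>B. ennreal (\<bar>u w - u z\<bar> powr p) \<partial>lborel) \<partial>lborel) + I * ennreal b)"
      by (simp add: nn_integral_cmult nn_integral_add emB)
    also have "\<dots> \<le> ennreal (2 powr p / a) * (ennreal C1 * (J + E) + ennreal C2 * (J + E) * ennreal b)"
    proof (intro mult_left_mono add_mono mult_right_mono IJ)
      have "(\<integral>\<^sup>+z\<in>B. (\<integral>\<^sup>+w\<in>B. ennreal (\<bar>u w - u z\<bar> powr p) \<partial>lborel) \<partial>lborel) \<le> ennreal C1 * E"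
        using en[OF u] by (simp add: E_def)
      also have "\<dots> \<le> ennreal C1 * (J + E)" by (intro mult_left_mono) auto
      finally show "(\<integral>\<^sup>+z\<in>B. (\<integral>\<^sup>+w\<in>B. ennreal (\<bar>u w - u z\<bar> powr p) \<partial>lborel) \<partial>lborel) \<le> ennreal C1 * (J + E)" .
    qed auto
    also have "\<dots> = ennreal C * (J + E)"
    proof -
      have "ennreal C = ennreal (2 powr p / a) * (ennreal C1 + ennreal b * ennreal C2)"
        using a b C1 C2 by (simp add: C_def flip: ennreal_mult ennreal_plus)
      then show ?thesis by (simp add: distrib_left distrib_right mult_ac)
    qed
    finally show "(\<integral>\<^sup>+z\<in>ball x R. ennreal (\<bar>u z - c\<bar> powr p) \<partial>lborel)
       \<le> ennreal C * ((\<integral>\<^sup>+z\<in>B0. ennreal (\<bar>u z - c\<bar> powr p) \<partial>lborel) + osc_energy p q \<tau> \<Omega> u)"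
      by (simp add: B_def J_def E_def)
  qed
  moreover have "0 \<le> C" using a b C1 C2 by (simp add: C_def)
  ultimately show ?thesis unfolding controlled_def using R by blast
qed

lemma interior_poincare:
  fixes \<Omega> :: "'a::euclidean_space set"
  assumes \<Omega>: "open \<Omega>" "bounded \<Omega>" "connected \<Omega>" "\<Omega> \<noteq> {}" and p: "1 < p" and \<tau>: "0 < \<tau>" "\<tau> \<le> 1"
    and \<eta>: "0 < \<eta>"
  obtains C :: real where "0 \<le> C"
    "\<And>u. u \<in> borel_measurable borel \<Longrightarrow> \<exists>c.
      (\<integral>\<^sup>+z\<in>{z \<in> \<Omega>. \<eta> \<le> bdist \<Omega> z}. ennreal (\<bar>u z - c\<bar> powr p) \<partial>lborel) \<le> ennreal C * osc_energy p q \<tau> \<Omega> u"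
proof -
  obtain x1 where x1: "x1 \<in> \<Omega>" using \<Omega> by auto
  define B0 where "B0 = ball x1 (\<tau> * bdist \<Omega> x1 / 4)"
  have r1: "0 < \<tau> * bdist \<Omega> x1 / 4" using bdist_pos[OF \<Omega>(1,2) x1] \<tau> by simp
  have c1: "controlled p q \<tau> \<Omega> B0 x1"
    unfolding controlled_def B0_def
    by (rule exI[of _ "\<tau> * bdist \<Omega> x1 / 4"], intro conjI r1 exI[of _ 1]) auto
  have all: "controlled p q \<tau> \<Omega> B0 x" if x: "x \<in> \<Omega>" for x
  proof (rule connected_induction_simple[where P = "controlled p q \<tau> \<Omega> B0", OF \<Omega>(3) x1 x c1])
    fix x assume x: "x \<in> \<Omega>"
    define d where "d = bdist \<Omega> x"
    have d: "0 < d" using bdist_pos[OF \<Omega>(1,2) x] by (simp add: d_def)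
    have ld: "0 < \<tau> * d" "\<tau> * d \<le> d" using \<tau> d by (simp_all add: mult_le_cancel_right1)
    \<comment> \<open>With radius \<tau> d/16 two points y, z of T are closer than \<tau> (d/2)/4
      \<le> \<tau> d(z)/4, so \<open>controlled_step\<close> applies between any two of them, in
      either direction.\<close>
    define T where "T = ball x (\<tau> * d / 16)"
    have T\<Omega>: "T \<subseteq> \<Omega>" using ball_bdist_subset[OF x, of "\<tau> * d / 16"] ld d \<tau> by (simp add: T_def d_def)
    have "controlled p q \<tau> \<Omega> B0 z" if y: "y \<in> T" and z: "z \<in> T" and c: "controlled p q \<tau> \<Omega> B0 y" for y z
    proof -
      have "dist x z < \<tau> * d / 16" "dist x y < \<tau> * d / 16" using y z by (simp_all add: T_def)
      moreover have "dist z y \<le> dist x z + dist x y" by (rule dist_triangle3)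
      ultimately have zy: "dist z y < \<tau> * (d / 2) / 4" and "dist x z \<le> d / 2" using ld by auto
      then have "d / 2 \<le> bdist \<Omega> z" using bdist_comparable[of x z \<Omega>] by (simp add: d_def)
      then have "\<tau> * (d / 2) \<le> \<tau> * bdist \<Omega> z" using \<tau> by (intro mult_left_mono) auto
      then have "y \<in> ball z (\<tau> * bdist \<Omega> z / 4)" using zy by simp
      then show ?thesis using controlled_step[OF \<Omega>(1,2) p \<tau> _ _ c] z T\<Omega> by blast
    qed
    moreover have "openin (top_of_set \<Omega>) T" using T\<Omega> \<Omega>(1) by (simp add: openin_open_eq T_def)
    moreover have "x \<in> T" using ld by (simp add: T_def)
    ultimately show "\<exists>T. openin (top_of_set \<Omega>) T \<and> x \<in> T \<and>
        (\<forall>y\<in>T. \<forall>z\<in>T. controlled p q \<tau> \<Omega> B0 y \<longrightarrow> controlled p q \<tau> \<Omega> B0 z)" by blast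
  qed
  define Z where "Z = {z \<in> \<Omega>. \<eta> \<le> bdist \<Omega> z}"
  \<comment> \<open>Describing Z inside the closure makes it visibly compact; frontier points are
    excluded because the distance vanishes there.\<close>
  have Z_eq: "Z = closure \<Omega> \<inter> {z. \<eta> \<le> bdist \<Omega> z}"
  proof -
    have "z \<in> \<Omega>" if "z \<in> closure \<Omega>" "\<eta> \<le> bdist \<Omega> z" for z
    proof (rule ccontr)
      assume "z \<notin> \<Omega>"
      then have "z \<in> frontier \<Omega>" using that \<Omega> by (simp add: frontier_def interior_open)
      then show False using that \<eta> by (simp add: bdist_def)
    qed
    then show ?thesis using closure_subset by (auto simp: Z_def)
  qed
  have "compact Z" unfolding Z_eq using \<Omega>
    by (intro compact_Int_closed closed_Collect_le continuous_intros) (auto simp: compact_closure)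
  \<comment> \<open>The body of \<open>controlled\<close> with radius and constant exposed, so that
    both can be chosen as functions of x.\<close>
  define G where "G x \<rho> K \<longleftrightarrow> (\<forall>u c. u \<in> borel_measurable borel \<longrightarrow>
     (\<integral>\<^sup>+z\<in>ball x \<rho>. ennreal (\<bar>u z - c\<bar> powr p) \<partial>lborel)
       \<le> ennreal K * ((\<integral>\<^sup>+z\<in>B0. ennreal (\<bar>u z - c\<bar> powr p) \<partial>lborel) + osc_energy p q \<tau> \<Omega> u))"
    for x \<rho> K
  have "\<forall>x\<in>\<Omega>. \<exists>\<rho> K. 0 < \<rho> \<and> 0 \<le> K \<and> G x \<rho> K"
    using all unfolding controlled_def G_def by blast
  then obtain \<rho> K where \<rho>: "\<And>x. x \<in> \<Omega> \<Longrightarrow> 0 < \<rho> x" and K: "\<And>x. x \<in> \<Omega> \<Longrightarrow> 0 \<le> K x"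
    and ctrl: "\<And>x. x \<in> \<Omega> \<Longrightarrow> G x (\<rho> x) (K x)"
    by metis
  have "Z \<subseteq> (\<Union>x\<in>\<Omega>. ball x (\<rho> x))" using \<rho> by (force simp: Z_def)
  then obtain F where F: "F \<subseteq> \<Omega>" "finite F" "Z \<subseteq> (\<Union>x\<in>F. ball x (\<rho> x))"
    using compactE_image[OF \<open>compact Z\<close>, of \<Omega> "\<lambda>x. ball x (\<rho> x)"] by (metis open_ball)
  define S where "S = (\<Sum>x\<in>F. K x)"
  have S: "0 \<le> S" unfolding S_def using K F by (intro sum_nonneg) auto
  define a where "a = measure lborel B0"
  have a: "0 < a" using r1 by (simp add: a_def B0_def)
  have ema: "emeasure lborel B0 = ennreal a"
    unfolding a_def B0_def by (rule emeasure_lborel_ball)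
  obtain C1 where C1: "0 \<le> C1" and en: "\<And>u. u \<in> borel_measurable borel \<Longrightarrow>
      (\<integral>\<^sup>+z\<in>B0. (\<integral>\<^sup>+w\<in>B0. ennreal (\<bar>u w - u z\<bar> powr p) \<partial>lborel) \<partial>lborel) \<le> ennreal C1 * osc_energy p q \<tau> \<Omega> u"
    unfolding B0_def using ball_energy_le[OF \<Omega>(1,2) \<tau> x1] by blast
  have [measurable]: "B0 \<in> sets borel" by (simp add: B0_def)
  show ?thesis
  proof (rule that)
    show "0 \<le> S * (2 * C1 / a + 1)" using S C1 a by simp
    fix u :: "'a \<Rightarrow> real" assume u [measurable]: "u \<in> borel_measurable borel"
    define E where "E = osc_energy p q \<tau> \<Omega> u"
    define \<phi> where "\<phi> c = (\<integral>\<^sup>+z\<in>B0. ennreal (\<bar>u z - c\<bar> powr p) \<partial>lborel)" for c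
    have [measurable]: "\<phi> \<in> borel_measurable borel" unfolding \<phi>_def by measurable
    \<comment> \<open>The average of \<phi> (u w) over w in B0 is the double integral of
      \<open>ball_energy_le\<close>; hence some value u w is a good constant on the reference
      ball.\<close>
    have "(\<integral>\<^sup>+w\<in>B0. \<phi> (u w) \<partial>lborel) \<le> ennreal C1 * E"
      using en[OF u] by (simp add: \<phi>_def E_def)
    then obtain w where "\<phi> (u w) * emeasure lborel B0 \<le> 2 * (ennreal C1 * E)"
      using exists_le_average[of "\<lambda>w. \<phi> (u w)" lborel B0 "ennreal C1 * E"] a ema by auto
    then have "ennreal (1 / a) * (\<phi> (u w) * emeasure lborel B0) \<le> ennreal (1 / a) * (2 * (ennreal C1 * E))"
      by (intro mult_left_mono) auto
    moreover have "ennreal (1 / a) * (\<phi> (u w) * ennreal a) = \<phi> (u w)"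
      using a by (simp add: mult.left_commute flip: ennreal_mult)
    moreover have "ennreal (1 / a) * (2 * (ennreal C1 * E)) = ennreal (2 * C1 / a) * E"
      using a C1 by (simp add: mult.assoc[symmetric] flip: ennreal_mult ennreal_numeral)
    ultimately have \<phi>w: "\<phi> (u w) \<le> ennreal (2 * C1 / a) * E" by (simp add: ema)
    have "(\<integral>\<^sup>+z\<in>Z. ennreal (\<bar>u z - u w\<bar> powr p) \<partial>lborel)
        \<le> (\<Sum>x\<in>F. \<integral>\<^sup>+z\<in>ball x (\<rho> x). ennreal (\<bar>u z - u w\<bar> powr p) \<partial>lborel)"
      by (intro nn_integral_finite_cover F) auto
    also have "\<dots> \<le> (\<Sum>x\<in>F. ennreal (K x) * (\<phi> (u w) + E))"
      using ctrl F u unfolding \<phi>_def E_def G_def by (intro sum_mono) blast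
    also have "\<dots> = ennreal S * (\<phi> (u w) + E)"
      unfolding S_def using K F by (subst sum_ennreal[symmetric]) (auto simp: sum_distrib_right)
    also have "\<dots> \<le> ennreal S * (ennreal (2 * C1 / a) * E + E)"
      by (intro mult_left_mono add_mono \<phi>w) auto
    also have "\<dots> = ennreal (S * (2 * C1 / a + 1)) * E"
    proof -
      have "ennreal (S * (2 * C1 / a + 1)) = ennreal S * (ennreal (2 * C1 / a) + 1)"
        using S C1 a by (simp add: ennreal_mult)
      then show ?thesis by (simp add: distrib_left distrib_right mult_ac)
    qed
    finally show "\<exists>c. (\<integral>\<^sup>+z\<in>{z \<in> \<Omega>. \<eta> \<le> bdist \<Omega> z}. ennreal (\<bar>u z - c\<bar> powr p) \<partial>lborel)
        \<le> ennreal (S * (2 * C1 / a + 1)) * osc_energy p q \<tau> \<Omega> u"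
      unfolding Z_def E_def by blast
  qed
qed

section \<open>The weighted inequality\<close>

text \<open>It allows the boundary estimates to be applied to u - c after c has been fixed by the
  interior.\<close>

lemma osc_energy_diff_const: "osc_energy p q \<tau> \<Omega> (\<lambda>x. u x - c) = osc_energy p q \<tau> \<Omega> u"
  by (simp add: osc_energy_def osc_density_def)

lemma near_boundary_osc_estimate:
  fixes \<Omega> :: "'a::euclidean_space set" and \<alpha> p b \<tau> :: real
  assumes dom: "bounded_holder_domain \<alpha> \<Omega>" and \<alpha>: "0 < \<alpha>" "\<alpha> \<le> 1" and p: "1 < p" and b: "- \<alpha> < b"
    and \<tau>: "0 < \<tau>" "\<tau> \<le> 1" and x0: "x0 \<in> frontier \<Omega>"
  defines "q \<equiv> \<alpha> * p + b - p - real DIM('a)"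
  shows "\<exists>\<rho>>0. \<exists>\<eta>>0. \<exists>C\<ge>0. \<forall>u. u \<in> borel_measurable borel \<longrightarrow>
      (\<integral>\<^sup>+y\<in>\<Omega> \<inter> ball x0 \<rho>. ennreal (\<bar>u y\<bar> powr p * bdist \<Omega> y powr b) \<partial>lborel)
      \<le> ennreal C * ((\<integral>\<^sup>+y\<in>{y \<in> \<Omega>. \<eta> \<le> bdist \<Omega> y}. ennreal (\<bar>u y\<bar> powr p) \<partial>lborel) + osc_energy p q \<tau> \<Omega> u)"
proof -
  obtain K R \<nu> v where "holder_chart \<Omega> \<alpha> K R x0 \<nu> v"
    using bounded_holder_domain_chart[OF dom \<alpha> x0] .
  then interpret holder_chart \<Omega> \<alpha> K R x0 \<nu> v .
  \<comment> \<open>The line estimate uses differences up to 4 \<kappa> d, so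
    \<open>directional_energy_le\<close> is applied with 4 \<kappa> in place of \<kappa> and asks
    for 16 \<kappa> \<le> \<tau>.\<close>
  define \<kappa> where "\<kappa> = \<tau> / 16"
  have \<kappa>: "0 < \<kappa>" "\<kappa> \<le> 1/2" and \<kappa>4: "0 < 4 * \<kappa>" "4 * \<kappa> \<le> 1/2" "4 * (4 * \<kappa>) \<le> \<tau>"
    using \<tau> by (auto simp: \<kappa>_def)
  obtain \<rho> \<eta> C1 where \<rho>: "0 < \<rho>" and \<eta>: "0 < \<eta>" and C1: "0 \<le> C1" and near:
    "\<And>u. u \<in> borel_measurable borel \<Longrightarrow>
      (\<integral>\<^sup>+y\<in>\<Omega> \<inter> ball x0 \<rho>. ennreal (\<bar>u y\<bar> powr p * bdist \<Omega> y powr b) \<partial>lborel)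
      \<le> ennreal C1 * ((\<integral>\<^sup>+y\<in>{y \<in> \<Omega>. \<eta> \<le> bdist \<Omega> y}. ennreal (\<bar>u y\<bar> powr p) \<partial>lborel)
        + (\<integral>\<^sup>+y\<in>\<Omega>. (\<integral>\<^sup>+r\<in>{r. \<bar>r\<bar> < 4 * \<kappa> * bdist \<Omega> y}.
            ennreal (\<bar>u (y + r *\<^sub>R \<nu>) - u y\<bar> powr p * bdist \<Omega> y powr (\<alpha> * p + b - p - 1)) \<partial>lborel) \<partial>lborel))"
    using near_boundary_estimate[OF p b \<kappa>] by blast
  obtain C2 where C2: "0 \<le> C2" and dir: "\<And>u. u \<in> borel_measurable borel \<Longrightarrow>
      (\<integral>\<^sup>+y\<in>\<Omega>. (\<integral>\<^sup>+r\<in>{r. \<bar>r\<bar> < 4 * \<kappa> * bdist \<Omega> y}.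
          ennreal (\<bar>u (y + r *\<^sub>R \<nu>) - u y\<bar> powr p * bdist \<Omega> y powr (q + real DIM('a) - 1)) \<partial>lborel) \<partial>lborel)
      \<le> ennreal C2 * osc_energy p q \<tau> \<Omega> u"
    using directional_energy_le[OF open_\<Omega> bounded_\<Omega> p \<kappa>4 \<nu>] by blast
  have e: "q + real DIM('a) - 1 = \<alpha> * p + b - p - 1" by (simp add: q_def)
  have "\<forall>u. u \<in> borel_measurable borel \<longrightarrow>
      (\<integral>\<^sup>+y\<in>\<Omega> \<inter> ball x0 \<rho>. ennreal (\<bar>u y\<bar> powr p * bdist \<Omega> y powr b) \<partial>lborel)
      \<le> ennreal (C1 * (1 + C2)) * ((\<integral>\<^sup>+y\<in>{y \<in> \<Omega>. \<eta> \<le> bdist \<Omega> y}. ennreal (\<bar>u y\<bar> powr p) \<partial>lborel) + osc_energy p q \<tau> \<Omega> u)"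
  proof (intro allI impI)
    fix u :: "'a \<Rightarrow> real" assume u: "u \<in> borel_measurable borel"
    define I where "I = (\<integral>\<^sup>+y\<in>{y \<in> \<Omega>. \<eta> \<le> bdist \<Omega> y}. ennreal (\<bar>u y\<bar> powr p) \<partial>lborel)"
    define E where "E = osc_energy p q \<tau> \<Omega> u"
    have "(\<integral>\<^sup>+y\<in>\<Omega> \<inter> ball x0 \<rho>. ennreal (\<bar>u y\<bar> powr p * bdist \<Omega> y powr b) \<partial>lborel)
        \<le> ennreal C1 * (I + ennreal C2 * E)"
      using near[OF u] dir[OF u] unfolding e I_def E_def
      by (meson add_left_mono mult_left_mono order_trans zero_le)
    also have "\<dots> \<le> ennreal C1 * (ennreal (1 + C2) * I + ennreal (1 + C2) * E)"
    proof (intro mult_left_mono add_mono mult_right_mono)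
      have "1 * I \<le> ennreal (1 + C2) * I"
        using C2 by (intro mult_right_mono) (auto simp flip: ennreal_1 intro: ennreal_leI)
      then show "I \<le> ennreal (1 + C2) * I" by simp
    qed (use C2 in \<open>auto intro: ennreal_leI\<close>)
    also have "\<dots> = ennreal (C1 * (1 + C2)) * (I + E)"
    proof -
      have "ennreal (C1 * (1 + C2)) = ennreal C1 * ennreal (1 + C2)"
        using C1 C2 by (intro ennreal_mult) auto
      then show ?thesis by (simp only: distrib_left mult.assoc)
    qed
    finally show "(\<integral>\<^sup>+y\<in>\<Omega> \<inter> ball x0 \<rho>. ennreal (\<bar>u y\<bar> powr p * bdist \<Omega> y powr b) \<partial>lborel)
      \<le> ennreal (C1 * (1 + C2)) * ((\<integral>\<^sup>+y\<in>{y \<in> \<Omega>. \<eta> \<le> bdist \<Omega> y}. ennreal (\<bar>u y\<bar> powr p) \<partial>lborel) + osc_energy p q \<tau> \<Omega> u)"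
      by (simp add: I_def E_def)
  qed
  moreover have "0 \<le> C1 * (1 + C2)" using C1 C2 by simp
  ultimately show ?thesis using \<rho> \<eta> by blast
qed

text \<open>One constant has to serve all pieces. It is taken from the interior estimate on a set Z
  large enough to contain the interior sets of all finitely many boundary balls; each boundary
  estimate, applied to u - c, then leaves only an integral over Z and the energy.\<close>

lemma weighted_poincare:
  fixes \<Omega> :: "'a::euclidean_space set" and \<alpha> p b \<tau> :: real
  assumes dom: "bounded_holder_domain \<alpha> \<Omega>" and \<alpha>: "0 < \<alpha>" "\<alpha> \<le> 1" and p: "1 < p" and b: "- \<alpha> < b"
    and \<tau>: "0 < \<tau>" "\<tau> \<le> 1"
  defines "q \<equiv> \<alpha> * p + b - p - real DIM('a)"
  obtains C :: real where "0 \<le> C"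
    "\<And>u. u \<in> borel_measurable borel \<Longrightarrow> \<exists>c.
      (\<integral>\<^sup>+y\<in>\<Omega>. ennreal (\<bar>u y - c\<bar> powr p * bdist \<Omega> y powr b) \<partial>lborel) \<le> ennreal C * osc_energy p q \<tau> \<Omega> u"
proof -
  have \<Omega>: "open \<Omega>" "bounded \<Omega>" "connected \<Omega>" "\<Omega> \<noteq> {}"
    using dom by (auto simp: bounded_holder_domain_def)
  have [measurable]: "\<Omega> \<in> sets borel" using \<Omega> by simp
  define G where "G x \<rho> \<eta> C \<longleftrightarrow> (\<forall>u. u \<in> borel_measurable borel \<longrightarrow>
      (\<integral>\<^sup>+y\<in>\<Omega> \<inter> ball x \<rho>. ennreal (\<bar>u y\<bar> powr p * bdist \<Omega> y powr b) \<partial>lborel)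
      \<le> ennreal C * ((\<integral>\<^sup>+y\<in>{y \<in> \<Omega>. \<eta> \<le> bdist \<Omega> y}. ennreal (\<bar>u y\<bar> powr p) \<partial>lborel) + osc_energy p q \<tau> \<Omega> u))"
    for x \<rho> \<eta> C
  have "\<exists>\<rho>>0. \<exists>\<eta>>0. \<exists>C\<ge>0. G x \<rho> \<eta> C" if "x \<in> frontier \<Omega>" for x
    unfolding G_def q_def by (rule near_boundary_osc_estimate[OF dom \<alpha> p b \<tau> that])
  then obtain \<rho> \<eta> K where \<rho>: "\<And>x. x \<in> frontier \<Omega> \<Longrightarrow> 0 < \<rho> x" and \<eta>: "\<And>x. x \<in> frontier \<Omega> \<Longrightarrow> 0 < \<eta> x"
    and K: "\<And>x. x \<in> frontier \<Omega> \<Longrightarrow> 0 \<le> K x" and G: "\<And>x. x \<in> frontier \<Omega> \<Longrightarrow> G x (\<rho> x) (\<eta> x) (K x)"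
    by metis
  have "compact (frontier \<Omega>)" using \<Omega> by (simp add: compact_frontier_bounded)
  moreover have "frontier \<Omega> \<subseteq> (\<Union>x\<in>frontier \<Omega>. ball x (\<rho> x))" using \<rho> by force
  ultimately obtain F where F: "F \<subseteq> frontier \<Omega>" "finite F" "frontier \<Omega> \<subseteq> (\<Union>x\<in>F. ball x (\<rho> x))"
    using compactE_image[of "frontier \<Omega>" "frontier \<Omega>" "\<lambda>x. ball x (\<rho> x)"] by (metis open_ball)
  define U where "U = (\<Union>x\<in>F. ball x (\<rho> x))"
  \<comment> \<open>The balls cover the whole boundary, so this remainder is a compact subset of
    \<Omega> and keeps a positive distance from the boundary.\<close>
  have "compact (closure \<Omega> - U)" using \<Omega> by (intro compact_diff) (auto simp: U_def compact_closure)
  moreover have sub: "closure \<Omega> - U \<subseteq> \<Omega>" using F(3) \<Omega> by (auto simp: U_def frontier_def interior_open)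
  ultimately obtain \<eta>0 where \<eta>0: "0 < \<eta>0" "\<And>x. x \<in> closure \<Omega> - U \<Longrightarrow> \<eta>0 \<le> bdist \<Omega> x"
  proof (cases "closure \<Omega> - U = {}")
    case True
    show ?thesis by (rule that[of 1]) (use True in auto)
  next
    case False
    have "continuous_on (closure \<Omega> - U) (bdist \<Omega>)" by (intro continuous_intros)
    then obtain x where x: "x \<in> closure \<Omega> - U" "\<And>y. y \<in> closure \<Omega> - U \<Longrightarrow> bdist \<Omega> x \<le> bdist \<Omega> y"
      using continuous_attains_inf[OF \<open>compact (closure \<Omega> - U)\<close> False] by blast
    show ?thesis using that[of "bdist \<Omega> x"] x sub bdist_pos[OF \<Omega>(1,2)] by blast
  qed
  \<comment> \<open>Below \<eta>0, so that Z contains the part of \<Omega> outside U, and below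
    every \<eta> x, so that Z contains the interior set of each boundary estimate.\<close>
  define \<epsilon> where "\<epsilon> = Min (insert \<eta>0 (\<eta> ` F))"
  have \<epsilon>: "0 < \<epsilon>" "\<epsilon> \<le> \<eta>0" "\<And>x. x \<in> F \<Longrightarrow> \<epsilon> \<le> \<eta> x"
    using F \<eta>0 \<eta> by (auto simp: \<epsilon>_def)
  define Z where "Z = {y \<in> \<Omega>. \<epsilon> \<le> bdist \<Omega> y}"
  have [measurable]: "Z \<in> sets borel" unfolding Z_def by measurable
  obtain D where D: "\<And>x. x \<in> \<Omega> \<Longrightarrow> bdist \<Omega> x \<le> D"
  proof -
    have "continuous_on (closure \<Omega>) (bdist \<Omega>)" by (intro continuous_intros)
    then obtain x where "\<And>y. y \<in> closure \<Omega> \<Longrightarrow> bdist \<Omega> y \<le> bdist \<Omega> x"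
      using continuous_attains_sup[of "closure \<Omega>" "bdist \<Omega>"] \<Omega> by (auto simp: compact_closure)
    then show ?thesis using that closure_subset by blast
  qed
  \<comment> \<open>Bounds d^b on Z for either sign of b: through the largest distance D if b \<ge>
    0, through \<epsilon> if b < 0.\<close>
  define W where "W = \<epsilon> powr b + D powr b"
  have W: "bdist \<Omega> y powr b \<le> W" if "y \<in> Z" for y
  proof (cases "0 \<le> b")
    case True
    then have "bdist \<Omega> y powr b \<le> D powr b" using that D bdist_nonneg by (intro powr_mono2) (auto simp: Z_def)
    then show ?thesis by (simp add: W_def add_increasing)
  next
    case False
    then have "bdist \<Omega> y powr b \<le> \<epsilon> powr b" using that \<epsilon> by (intro powr_mono2') (auto simp: Z_def)
    then show ?thesis by (simp add: W_def add_increasing2)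
  qed
  have W0: "0 \<le> W" by (simp add: W_def)
  define S where "S = (\<Sum>x\<in>F. K x)"
  have S: "0 \<le> S" unfolding S_def using K F by (intro sum_nonneg) auto
  obtain C1 where C1: "0 \<le> C1" and int: "\<And>u. u \<in> borel_measurable borel \<Longrightarrow> \<exists>c.
      (\<integral>\<^sup>+z\<in>Z. ennreal (\<bar>u z - c\<bar> powr p) \<partial>lborel) \<le> ennreal C1 * osc_energy p q \<tau> \<Omega> u"
    unfolding Z_def using interior_poincare[OF \<Omega> p \<tau> \<epsilon>(1), of q] by blast
  show ?thesis
  proof (rule that)
    show "0 \<le> S * (C1 + 1) + W * C1" using S C1 W0 by simp
    fix u :: "'a \<Rightarrow> real" assume u [measurable]: "u \<in> borel_measurable borel"
    define E where "E = osc_energy p q \<tau> \<Omega> u"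
    obtain c where c: "(\<integral>\<^sup>+z\<in>Z. ennreal (\<bar>u z - c\<bar> powr p) \<partial>lborel) \<le> ennreal C1 * E"
      using int[OF u] by (auto simp: E_def)
    define h where "h y = ennreal (\<bar>u y - c\<bar> powr p * bdist \<Omega> y powr b)" for y
    have [measurable]: "h \<in> borel_measurable borel" unfolding h_def by measurable
    define J where "J = (\<integral>\<^sup>+z\<in>Z. ennreal (\<bar>u z - c\<bar> powr p) \<partial>lborel)"
    have "open U" by (auto simp: U_def)
    then have [measurable]: "U \<in> sets borel" by simp
    have "(\<integral>\<^sup>+y\<in>\<Omega>. h y \<partial>lborel) \<le> (\<integral>\<^sup>+y. h y * indicator (\<Omega> \<inter> U) y + h y * indicator Z y \<partial>lborel)"
    proof (intro nn_integral_mono)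
      fix y
      have "y \<in> Z" if "y \<in> \<Omega>" "y \<notin> U"
        using that \<eta>0(2)[of y] \<epsilon>(2) closure_subset[of \<Omega>] by (auto simp: Z_def)
      then show "h y * indicator \<Omega> y \<le> h y * indicator (\<Omega> \<inter> U) y + h y * indicator Z y"
        by (auto simp: indicator_def)
    qed
    also have "\<dots> = (\<integral>\<^sup>+y\<in>\<Omega> \<inter> U. h y \<partial>lborel) + (\<integral>\<^sup>+y\<in>Z. h y \<partial>lborel)"
      by (simp add: nn_integral_add)
    also have "(\<integral>\<^sup>+y\<in>\<Omega> \<inter> U. h y \<partial>lborel) \<le> (\<Sum>x\<in>F. \<integral>\<^sup>+y\<in>\<Omega> \<inter> ball x (\<rho> x). h y \<partial>lborel)"
      using \<Omega> by (intro nn_integral_finite_cover F) (auto simp: U_def)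
    also have "\<dots> \<le> (\<Sum>x\<in>F. ennreal (K x) * (J + E))"
    proof (intro sum_mono)
      fix x assume x: "x \<in> F"
      have "(\<integral>\<^sup>+y\<in>\<Omega> \<inter> ball x (\<rho> x). h y \<partial>lborel)
        \<le> ennreal (K x) * ((\<integral>\<^sup>+y\<in>{y \<in> \<Omega>. \<eta> x \<le> bdist \<Omega> y}. ennreal (\<bar>u y - c\<bar> powr p) \<partial>lborel)
          + osc_energy p q \<tau> \<Omega> (\<lambda>y. u y - c))"
        using G[of x] x F unfolding G_def h_def by auto
      also have "\<dots> \<le> ennreal (K x) * (J + E)"
        unfolding J_def E_def osc_energy_diff_const using \<epsilon>(3)[OF x]
        by (intro mult_left_mono add_mono nn_integral_mono) (auto simp: indicator_def Z_def)
      finally show "(\<integral>\<^sup>+y\<in>\<Omega> \<inter> ball x (\<rho> x). h y \<partial>lborel) \<le> ennreal (K x) * (J + E)" .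
    qed
    also have "\<dots> = ennreal S * (J + E)"
      unfolding S_def using K F by (subst sum_ennreal[symmetric]) (auto simp: sum_distrib_right)
    also have "(\<integral>\<^sup>+y\<in>Z. h y \<partial>lborel) \<le> (\<integral>\<^sup>+y. ennreal W * (ennreal (\<bar>u y - c\<bar> powr p) * indicator Z y) \<partial>lborel)"
    proof (intro nn_integral_mono)
      fix y
      show "h y * indicator Z y \<le> ennreal W * (ennreal (\<bar>u y - c\<bar> powr p) * indicator Z y)"
      proof (cases "y \<in> Z")
        case True
        have "\<bar>u y - c\<bar> powr p * bdist \<Omega> y powr b \<le> \<bar>u y - c\<bar> powr p * W"
          using W[OF True] by (intro mult_left_mono) auto
        then show ?thesis using True W0 by (simp add: h_def mult.commute ennreal_leI flip: ennreal_mult)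
      qed simp
    qed
    also have "\<dots> = ennreal W * J" unfolding J_def by (rule nn_integral_cmult) measurable
    finally have "(\<integral>\<^sup>+y\<in>\<Omega>. h y \<partial>lborel) \<le> ennreal S * (J + E) + ennreal W * J"
      by (simp add: add_mono)
    also have "\<dots> \<le> ennreal S * (ennreal C1 * E + E) + ennreal W * (ennreal C1 * E)"
      using c unfolding J_def by (intro add_mono mult_left_mono) auto
    also have "\<dots> = ennreal (S * (C1 + 1) + W * C1) * E"
    proof -
      have "ennreal (S * (C1 + 1) + W * C1) = ennreal S * (ennreal C1 + 1) + ennreal W * ennreal C1"
        using S C1 W0 by (simp add: ennreal_mult)
      then show ?thesis by (simp add: distrib_left distrib_right mult_ac)
    qed
    finally show "\<exists>c. (\<integral>\<^sup>+y\<in>\<Omega>. ennreal (\<bar>u y - c\<bar> powr p * bdist \<Omega> y powr b) \<partial>lborel)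
        \<le> ennreal (S * (C1 + 1) + W * C1) * osc_energy p q \<tau> \<Omega> u"
      unfolding h_def E_def by blast
  qed
qed

text \<open>On the ball |y - x| < \<tau> d(x) the kernel |y - x|^(-n-sp) is at least d(x)^(-n-sp).
  Moreover min (d x) (d y) lies between (1 - \<tau>) d(x) and d(x), which costs the factor (1 -
  \<tau>)^(-\<gamma>) if \<gamma> \<ge> 0 and nothing otherwise. The ball lies in \<Omega>, so it is
  the full domain of the inner integral, and replacing f by u changes both integrals only on null
  sets.\<close>

lemma osc_energy_le_frac_energy:
  fixes \<Omega> :: "'a::euclidean_space set" and p s \<tau> \<gamma> :: real
  assumes \<Omega>: "open \<Omega>" "bounded \<Omega>" and p: "1 < p" and s: "0 < s" and \<tau>: "0 < \<tau>" "\<tau> < 1"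
    and u [measurable]: "u \<in> borel_measurable borel" and f: "AE x in lborel. x \<in> \<Omega> \<longrightarrow> f x = u x"
  shows "osc_energy p (\<gamma> - s * p - real DIM('a)) \<tau> \<Omega> u
    \<le> ennreal (1 + (1 - \<tau>) powr (- \<gamma>)) * frac_energy p s \<tau> \<gamma> \<Omega> f"
proof -
  define N where "N = real DIM('a)"
  define C where "C = 1 + (1 - \<tau>) powr (- \<gamma>)"
  have C: "0 \<le> C" by (simp add: C_def)
  have [measurable]: "\<Omega> \<in> sets borel" using \<Omega> by simp
  define k where "k x y = ennreal (\<bar>u y - u x\<bar> powr p / norm (y - x) powr (N + s * p)
                 * min (bdist \<Omega> x) (bdist \<Omega> y) powr \<gamma>)" for x y
  have k_meas [measurable]: "case_prod k \<in> borel_measurable (borel \<Otimes>\<^sub>M borel)"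
    unfolding k_def by measurable
  define L where "L x = (\<integral>\<^sup>+y\<in>ball x (\<tau> * bdist \<Omega> x). k x y \<partial>lborel)" for x
  have [measurable]: "L \<in> borel_measurable borel"
    unfolding L_def by (intro nn_integral_moving_ball_measurable) measurable
  have "frac_energy p s \<tau> \<gamma> \<Omega> f = (\<integral>\<^sup>+x\<in>\<Omega>. L x \<partial>lborel)"
  proof -
    have "(\<integral>\<^sup>+y\<in>\<Omega> \<inter> ball x (\<tau> * bdist \<Omega> x).
        ennreal (\<bar>f y - f x\<bar> powr p / norm (y - x) powr (real DIM('a) + s * p)
                 * min (bdist \<Omega> x) (bdist \<Omega> y) powr \<gamma>) \<partial>lborel) = L x"
      if x: "x \<in> \<Omega>" "f x = u x" for x
    proof -
      have "\<tau> * bdist \<Omega> x \<le> bdist \<Omega> x" using \<tau> bdist_nonneg[of \<Omega> x] by (simp add: mult_left_le_one_le)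
      then have sub: "ball x (\<tau> * bdist \<Omega> x) \<subseteq> \<Omega>" by (rule ball_bdist_subset[OF x(1)])
      show ?thesis unfolding L_def k_def N_def
      proof (intro nn_integral_cong_AE, use f in eventually_elim)
        case (elim y)
        then show ?case using sub x by (auto simp: indicator_def)
      qed
    qed
    then have "(\<integral>\<^sup>+x\<in>\<Omega>. (\<integral>\<^sup>+y\<in>\<Omega> \<inter> ball x (\<tau> * bdist \<Omega> x).
        ennreal (\<bar>f y - f x\<bar> powr p / norm (y - x) powr (real DIM('a) + s * p)
                 * min (bdist \<Omega> x) (bdist \<Omega> y) powr \<gamma>) \<partial>lborel) \<partial>lborel) = (\<integral>\<^sup>+x\<in>\<Omega>. L x \<partial>lborel)"
      using f by (intro nn_integral_cong_AE) (auto simp: indicator_def)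
    then show ?thesis by (simp add: frac_energy_def nn_integral_completion)
  qed
  moreover have "osc_energy p (\<gamma> - s * p - N) \<tau> \<Omega> u \<le> (\<integral>\<^sup>+x. ennreal C * (L x * indicator \<Omega> x) \<partial>lborel)"
    unfolding osc_energy_def
  proof (rule nn_integral_mono)
    fix x
    show "osc_density p (\<gamma> - s * p - N) \<tau> \<Omega> u x * indicator \<Omega> x \<le> ennreal C * (L x * indicator \<Omega> x)"
    proof (cases "x \<in> \<Omega>")
      case True
      define d where "d = bdist \<Omega> x"
      have d: "0 < d" using bdist_pos[OF \<Omega> True] by (simp add: d_def)
      have [measurable]: "ball x (\<tau> * d) \<in> sets borel" by simp
      have "osc_density p (\<gamma> - s * p - N) \<tau> \<Omega> u x
          \<le> (\<integral>\<^sup>+y. ennreal C * (k x y * indicator (ball x (\<tau> * d)) y) \<partial>lborel)"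
        unfolding osc_density_def
      proof (rule nn_integral_mono)
        fix y
        show "ennreal (\<bar>u y - u x\<bar> powr p * bdist \<Omega> x powr (\<gamma> - s * p - N)) * indicator (ball x (\<tau> * bdist \<Omega> x)) y
          \<le> ennreal C * (k x y * indicator (ball x (\<tau> * d)) y)"
        \<comment> \<open>On the diagonal the left-hand side is 0 because \<open>0 powr p\<close> is
          0, so the singular kernel has to be compared only for y \<noteq> x.\<close>
        proof (cases "y \<in> ball x (\<tau> * d) \<and> y \<noteq> x")
          case True
          define m r where "m = min d (bdist \<Omega> y)" and "r = norm (y - x)"
          have r: "0 < r" "r < \<tau> * d" using True by (auto simp: r_def dist_norm norm_minus_commute)
          have td: "\<tau> * d \<le> 1 * d" using \<tau> d by (intro mult_right_mono) auto
          have "\<bar>d - bdist \<Omega> y\<bar> \<le> r" using bdist_lipschitz[of \<Omega> x y] by (simp add: d_def r_def dist_norm norm_minus_commute)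
          then have m: "(1 - \<tau>) * d \<le> m" "m \<le> d" using r \<tau> d by (auto simp: m_def algebra_simps)
          have m0: "0 < m" using m \<tau> d by (smt (verit) mult_pos_pos)
          have 1: "d powr \<gamma> \<le> C * m powr \<gamma>"
          proof (cases "0 \<le> \<gamma>")
            case True
            have "d powr \<gamma> \<le> (m / (1 - \<tau>)) powr \<gamma>" using m True \<tau> d by (intro powr_mono2) (auto simp: field_simps)
            also have "\<dots> = (1 - \<tau>) powr (- \<gamma>) * m powr \<gamma>" using m0 \<tau> by (simp add: powr_divide powr_minus field_simps)
            also have "\<dots> \<le> C * m powr \<gamma>" by (intro mult_right_mono) (auto simp: C_def)
            finally show ?thesis .
          next
            case False
            have "d powr \<gamma> \<le> 1 * m powr \<gamma>" using m False m0 by (simp add: powr_mono2')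
            also have "\<dots> \<le> C * m powr \<gamma>" by (intro mult_right_mono) (auto simp: C_def)
            finally show ?thesis .
          qed
          have "0 < N + s * p" using s p by (simp add: N_def add_pos_pos)
          then have 2: "d powr (- (N + s * p)) \<le> r powr (- (N + s * p))"
            using r td by (intro powr_mono2') auto
          have "d powr (\<gamma> - s * p - N) = d powr \<gamma> * d powr (- (N + s * p))"
            by (simp add: algebra_simps flip: powr_add)
          also have "\<dots> \<le> C * m powr \<gamma> * r powr (- (N + s * p))"
            using 1 2 C by (intro mult_mono) auto
          finally have "\<bar>u y - u x\<bar> powr p * d powr (\<gamma> - s * p - N)
              \<le> \<bar>u y - u x\<bar> powr p * (C * m powr \<gamma> * r powr (- (N + s * p)))"
            by (intro mult_left_mono) auto
          also have "\<dots> = C * (\<bar>u y - u x\<bar> powr p / r powr (N + s * p) * m powr \<gamma>)"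
            unfolding powr_minus_divide[of r "N + s * p"] by simp
          finally show ?thesis using True C
            by (simp add: k_def d_def m_def r_def ennreal_leI flip: ennreal_mult)
        qed (auto simp: indicator_def d_def)
      qed
      also have "\<dots> = ennreal C * L x"
        unfolding L_def d_def[symmetric] by (rule nn_integral_cmult) measurable
      finally show ?thesis using True by simp
    qed simp
  qed
  moreover have "(\<integral>\<^sup>+x. ennreal C * (L x * indicator \<Omega> x) \<partial>lborel) = ennreal C * (\<integral>\<^sup>+x\<in>\<Omega>. L x \<partial>lborel)"
    by (rule nn_integral_cmult) measurable
  ultimately show ?thesis by (simp add: N_def C_def)
qed

section \<open>Roots in [0, \<infinity>] and the final inequality\<close>

lemma enn_root_mono:
  assumes "0 < p" "x \<le> y"
  shows "enn_root p x \<le> enn_root p y"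
proof (cases "y = \<infinity>")
  case False
  then have "x \<noteq> \<infinity>" using assms by (auto simp: top_unique)
  with False assms show ?thesis
    by (auto simp: enn_root_def intro!: ennreal_leI powr_mono2 enn2real_mono simp: less_top)
qed (simp add: enn_root_def)

lemma enn_root_cmult:
  assumes "0 < p" "0 \<le> C" "t \<noteq> \<infinity>"
  shows "enn_root p (ennreal C * t) = ennreal (C powr (1 / p)) * enn_root p t"
  using assms by (simp add: enn_root_def ennreal_mult_eq_top_iff enn2real_mult powr_mult ennreal_mult)

theorem theorem5p4:
  fixes \<Omega> :: "'a::euclidean_space set" and p \<alpha> s \<tau> \<beta> :: real
  assumes "DIM('a) \<ge> 2"
    and "1 < p"
    and "0 < \<alpha>" and "\<alpha> \<le> 1"
    and "bounded_holder_domain \<alpha> \<Omega>"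
    and "0 < s" and "s < 1"
    and "0 < \<tau>" and "\<tau> < 1"
    and "\<beta> * p > - \<alpha>"
  shows "\<exists>C::real. 0 \<le> C \<and>
    (\<forall>u \<in> weighted_Lp p \<Omega> (\<lambda>x. bdist \<Omega> x powr (\<beta> * p)).
       enn_root p (frac_energy p s \<tau> ((s + \<beta> + \<alpha> - 1) * p) \<Omega> u) < \<infinity> \<longrightarrow>
       (INF c::real. weighted_Lp_norm p \<Omega> (\<lambda>x. bdist \<Omega> x powr (\<beta> * p)) (\<lambda>x. u x - c))
         \<le> ennreal C * enn_root p (frac_energy p s \<tau> ((s + \<beta> + \<alpha> - 1) * p) \<Omega> u))"
proof -
  have \<Omega>: "open \<Omega>" "bounded \<Omega>" using assms(5) by (auto simp: bounded_holder_domain_def)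
  define \<gamma> where "\<gamma> = (s + \<beta> + \<alpha> - 1) * p"
  \<comment> \<open>The parameter s cancels: this is the exponent of
    \<open>weighted_poincare\<close> for b = \<beta> p.\<close>
  have q: "\<gamma> - s * p - real DIM('a) = \<alpha> * p + \<beta> * p - p - real DIM('a)"
    by (simp add: \<gamma>_def algebra_simps)
  obtain C1 where C1: "0 \<le> C1" and poincare: "\<And>u. u \<in> borel_measurable borel \<Longrightarrow> \<exists>c.
      (\<integral>\<^sup>+y\<in>\<Omega>. ennreal (\<bar>u y - c\<bar> powr p * bdist \<Omega> y powr (\<beta> * p)) \<partial>lborel)
      \<le> ennreal C1 * osc_energy p (\<alpha> * p + \<beta> * p - p - real DIM('a)) \<tau> \<Omega> u"
    using weighted_poincare[OF assms(5) assms(3,4) assms(2) assms(10) assms(8) less_imp_le[OF assms(9)]] by blast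
  define C2 where "C2 = 1 + (1 - \<tau>) powr (- \<gamma>)"
  have C2: "0 \<le> C2" by (simp add: C2_def)
  show ?thesis
  proof (intro exI[of _ "(C1 * C2) powr (1 / p)"] conjI ballI impI)
    show "0 \<le> (C1 * C2) powr (1 / p)" by simp
    fix f
    assume f: "f \<in> weighted_Lp p \<Omega> (\<lambda>x. bdist \<Omega> x powr (\<beta> * p))"
      and fin: "enn_root p (frac_energy p s \<tau> ((s + \<beta> + \<alpha> - 1) * p) \<Omega> f) < \<infinity>"
    define E where "E = frac_energy p s \<tau> \<gamma> \<Omega> f"
    \<comment> \<open>A finite energy lets the constant be taken out of the root by
      \<open>enn_root_cmult\<close>.\<close>
    have E: "E \<noteq> \<infinity>" using fin by (auto simp: enn_root_def E_def \<gamma>_def)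
    \<comment> \<open>Extension by 0 makes f Lebesgue measurable on the whole space, where a Borel
      function equal to it almost everywhere exists.\<close>
    have "(\<lambda>x. indicator \<Omega> x *\<^sub>R f x) \<in> borel_measurable lebesgue"
      using f \<Omega> by (subst borel_measurable_restrict_space_iff[symmetric]) (auto simp: weighted_Lp_def)
    then obtain u where u: "u \<in> borel_measurable lborel" and ae: "AE x in lborel. indicator \<Omega> x *\<^sub>R f x = u x"
      using completion_ex_borel_measurable_real by blast
    have u': "u \<in> borel_measurable borel" using u by simp
    have fu: "AE x in lborel. x \<in> \<Omega> \<longrightarrow> f x = u x" using ae by eventually_elim auto
    obtain c where c: "(\<integral>\<^sup>+y\<in>\<Omega>. ennreal (\<bar>u y - c\<bar> powr p * bdist \<Omega> y powr (\<beta> * p)) \<partial>lborel)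
      \<le> ennreal C1 * osc_energy p (\<gamma> - s * p - real DIM('a)) \<tau> \<Omega> u"
      using poincare[OF u'] unfolding q by blast
    have "(\<integral>\<^sup>+x\<in>\<Omega>. ennreal (\<bar>f x - c\<bar> powr p * bdist \<Omega> x powr (\<beta> * p)) \<partial>lebesgue)
        = (\<integral>\<^sup>+y\<in>\<Omega>. ennreal (\<bar>u y - c\<bar> powr p * bdist \<Omega> y powr (\<beta> * p)) \<partial>lborel)"
      unfolding nn_integral_completion using fu
      by (intro nn_integral_cong_AE) (auto simp: indicator_def)
    also note c
    also have "osc_energy p (\<gamma> - s * p - real DIM('a)) \<tau> \<Omega> u \<le> ennreal C2 * E"
      unfolding C2_def E_def by (rule osc_energy_le_frac_energy[OF \<Omega> assms(2,6,8,9) u' fu])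
    finally have "(\<integral>\<^sup>+x\<in>\<Omega>. ennreal (\<bar>f x - c\<bar> powr p * bdist \<Omega> x powr (\<beta> * p)) \<partial>lebesgue)
        \<le> ennreal (C1 * C2) * E"
      using C1 C2 by (simp add: ennreal_mult mult.assoc mult_left_mono)
    then have "weighted_Lp_norm p \<Omega> (\<lambda>x. bdist \<Omega> x powr (\<beta> * p)) (\<lambda>x. f x - c)
        \<le> enn_root p (ennreal (C1 * C2) * E)"
      unfolding weighted_Lp_norm_def using assms(2) by (intro enn_root_mono) auto
    also have "\<dots> = ennreal ((C1 * C2) powr (1 / p)) * enn_root p E"
      using assms(2) C1 C2 E by (intro enn_root_cmult) auto
    finally show "(INF c::real. weighted_Lp_norm p \<Omega> (\<lambda>x. bdist \<Omega> x powr (\<beta> * p)) (\<lambda>x. f x - c))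
         \<le> ennreal ((C1 * C2) powr (1 / p)) * enn_root p (frac_energy p s \<tau> ((s + \<beta> + \<alpha> - 1) * p) \<Omega> f)"
      unfolding E_def \<gamma>_def by (intro INF_lower2[of c]) auto
  qed
qed

end
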